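(* Assume the Unique Games Conjecture. Then for every constant $C\ge 1$ it is NP-hard to approximate non-uniform BalancedEdge-Separator within factor $C$; more precisely, it is NP-hard, given an instance with balance parameter $B$, to distinguish between the case that some non-trivial $B$-balanced cut has weight at most $\alpha$ and the case that every non-trivial $B/3$-balanced cut has weight greater than $C\alpha$.
   Context: Unique Games: an instance $\mathcal U=(G(V,E),[N],\{\pi_e\}_{e\in E},{\rm wt})$ consists of a graph $G(V,E)$, for each edge $e\{v,w\}$ a bijection $\pi_e:[N]\to[N]$ and a weight ${\rm wt}(e)>0$ with $\sum_e{\rm wt}(e)=1$. A labeling $\lambda:V\to[N]$ satisfies $e\{v,w\}$ if $\lambda(v)=\pi_e(\lambda(w))$; ${\rm opt}(\mathcal U)$ is the maximum over labelings of the total weight of satisfied edges. Unique Games Conjecture: for every $\eta,\zeta>0$ there is a constant $N=N(\eta,\zeta)$ such that, given a Unique Games instance with label set $[N]$, it is NP-hard to distinguish ${\rm opt}(\mathcal U)\ge 1-\eta$ from ${\rm opt}(\mathcal U)\le\zeta$. Non-uniform BalancedEdge-Separator: a complete graph on vertex set $V$ with edge weights ${\rm wt}(e)\ge0$, edge demands ${\rm dem}(e)\ge0$, total demand $D=\sum_e{\rm dem}(e)$ and balance parameter $B$ with $D/6\le B\le D/2$; a non-trivial cut $(S,\overline S)$ is $B'$-balanced if the total demand of edges with exactly one endpoint in $S$ is at least $B'$, and its weight is the total weight of such edges. Approximating within factor $C$ means finding a $B/3$-balanced cut whose weight is at most $C$ times the minimum weight of a $B$-balanced cut. *)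

theory Defs
  imports Complex_Main "HOL-Computational_Algebra.Polynomial" "HOL-Library.FuncSet"
begin

section \<open>Multi-tape Turing machines and polynomial time\<close>

text \<open>
  States and tape symbols are initial segments of the naturals. Symbol 0 is the blank, 1 and 2
  stand for the bits 0 and 1. State 0 is initial and state 1 is the halting state. The input is
  written on tape 0 and the output is read from tape 1. Tapes are infinite in both directions.
\<close>

datatype move = MoveLeft | Stay | MoveRight

record tm =
  tm_tapes :: nat
  tm_symbols :: nat
  tm_states :: nat
  tm_delta :: "nat \<Rightarrow> nat list \<Rightarrow> nat \<times> (nat \<times> move) list"

definition wf_tm :: "tm \<Rightarrow> bool" where
  "wf_tm M \<longleftrightarrow>
     2 \<le> tm_tapes M \<and> 3 \<le> tm_symbols M \<and> 2 \<le> tm_states M \<and>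
     (\<forall>q<tm_states M. \<forall>r. length r = tm_tapes M \<and> set r \<subseteq> {..<tm_symbols M} \<longrightarrow>
        (case tm_delta M q r of (q', acts) \<Rightarrow>
           q' < tm_states M \<and> length acts = tm_tapes M \<and>
           (\<forall>(s, d)\<in>set acts. s < tm_symbols M)))"

type_synonym tape = "(int \<Rightarrow> nat) \<times> int"  \<comment> \<open>cell contents and head position\<close>
type_synonym config = "nat \<times> tape list"

fun move_head :: "move \<Rightarrow> int \<Rightarrow> int" where
  "move_head MoveLeft i = i - 1"
| "move_head Stay i = i"
| "move_head MoveRight i = i + 1"

fun tape_act :: "tape \<Rightarrow> nat \<times> move \<Rightarrow> tape" where
  "tape_act (c, i) (s, d) = (c(i := s), move_head d i)"

fun tm_step :: "tm \<Rightarrow> config \<Rightarrow> config" where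
  "tm_step M (q, ts) =
     (if q = 1 then (q, ts)
      else case tm_delta M q (map (\<lambda>(c, i). c i) ts) of
        (q', acts) \<Rightarrow> (q', map2 tape_act ts acts))"

definition tape_of :: "bool list \<Rightarrow> int \<Rightarrow> nat" where
  "tape_of x i =
     (if 0 \<le> i \<and> i < int (length x) then (if x ! nat i then 2 else 1) else 0)"

definition tm_init :: "tm \<Rightarrow> bool list \<Rightarrow> config" where
  "tm_init M x = (0, (tape_of x, 0) # replicate (tm_tapes M - 1) (tape_of [], 0))"

text \<open>
  The halting state is absorbing, so the configuration after \<open>poly p (length x)\<close> steps is the
  final one if the machine halts within that many steps.
\<close>

definition polytime :: "(bool list \<Rightarrow> bool list) \<Rightarrow> bool" where
  "polytime f \<longleftrightarrow> (\<exists>M (p :: nat poly). wf_tm M \<and>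
     (\<forall>x. case (tm_step M ^^ poly p (length x)) (tm_init M x) of
            (q, ts) \<Rightarrow> q = 1 \<and> fst (ts ! 1) = tape_of (f x)))"


section \<open>NP and NP-hardness of promise problems\<close>

type_synonym language = "bool list set"

definition class_P :: "language set" where
  "class_P = {L. polytime (\<lambda>x. [x \<in> L])}"

text \<open>Self-delimiting (prefix-free) code of a bit string.\<close>

definition delimited :: "bool list \<Rightarrow> bool list" where
  "delimited x = concat (map (\<lambda>b. [True, b]) x) @ [False]"

definition class_NP :: "language set" where
  "class_NP = {L. \<exists>R\<in>class_P. \<exists>p :: nat poly. \<forall>x.
     x \<in> L \<longleftrightarrow> (\<exists>y. length y \<le> poly p (length x) \<and> delimited x @ y \<in> R)}"

text \<open>
  NP-hardness, under polynomial-time many-one reductions, of distinguishing the strings in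
  \<open>yes\<close> from the strings in \<open>no\<close>.
\<close>

definition NP_hard_to_distinguish :: "language \<Rightarrow> language \<Rightarrow> bool" where
  "NP_hard_to_distinguish yes no \<longleftrightarrow>
     (\<forall>L\<in>class_NP. \<exists>f. polytime f \<and> (\<forall>x. (x \<in> L \<longrightarrow> f x \<in> yes) \<and> (x \<notin> L \<longrightarrow> f x \<in> no)))"


section \<open>Binary encoding of numbers and lists\<close>

fun binary :: "nat \<Rightarrow> bool list" where  \<comment> \<open>least significant bit first\<close>
  "binary n = (if n = 0 then [] else odd n # binary (n div 2))"

declare binary.simps [simp del]

definition enc_nat :: "nat \<Rightarrow> bool list" where
  "enc_nat n = delimited (binary n)"

definition enc_rat :: "rat \<Rightarrow> bool list" where
  "enc_rat q = (case quotient_of q of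
     (a, b) \<Rightarrow> (a < 0) # enc_nat (nat \<bar>a\<bar>) @ enc_nat (nat b))"

definition enc_list :: "('a \<Rightarrow> bool list) \<Rightarrow> 'a list \<Rightarrow> bool list" where
  "enc_list e xs = enc_nat (length xs) @ concat (map e xs)"


section \<open>Unique Games\<close>

text \<open>
  The vertex set is \<open>{..<ug_size U}\<close> and the label set \<open>[N]\<close> is \<open>{..<N}\<close>. The graph is finite,
  simple and undirected. Each edge \<open>{v, w}\<close> is listed once, as one of the pairs \<open>(v, w)\<close> and
  \<open>(w, v)\<close>; the order chosen fixes the direction in which the bijection \<open>\<pi>\<^sub>e\<close> is read.
\<close>

record ug =
  ug_size :: nat
  ug_edges :: "(nat \<times> nat) list"
  ug_perm :: "nat \<times> nat \<Rightarrow> nat \<Rightarrow> nat"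
  ug_wt :: "nat \<times> nat \<Rightarrow> rat"

definition wf_ug :: "nat \<Rightarrow> ug \<Rightarrow> bool" where
  "wf_ug N U \<longleftrightarrow>
     distinct (ug_edges U) \<and>
     (\<forall>(v, w)\<in>set (ug_edges U).
        v < ug_size U \<and> w < ug_size U \<and> v \<noteq> w \<and> (w, v) \<notin> set (ug_edges U)) \<and>
     (\<forall>e\<in>set (ug_edges U). bij_betw (ug_perm U e) {..<N} {..<N} \<and> 0 < ug_wt U e) \<and>
     (\<Sum>e\<in>set (ug_edges U). ug_wt U e) = 1"

definition ug_satisfies :: "ug \<Rightarrow> (nat \<Rightarrow> nat) \<Rightarrow> nat \<times> nat \<Rightarrow> bool" where
  "ug_satisfies U l e \<longleftrightarrow> l (fst e) = ug_perm U e (l (snd e))"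

definition ug_value :: "ug \<Rightarrow> (nat \<Rightarrow> nat) \<Rightarrow> rat" where
  "ug_value U l = (\<Sum>e | e \<in> set (ug_edges U) \<and> ug_satisfies U l e. ug_wt U e)"

definition ug_opt :: "nat \<Rightarrow> ug \<Rightarrow> rat" where
  "ug_opt N U = Max (ug_value U ` ({..<ug_size U} \<rightarrow>\<^sub>E {..<N}))"

text \<open>
  The number of vertices is encoded in unary, so that isolated vertices count towards the
  input length.
\<close>

definition enc_ug :: "nat \<Rightarrow> ug \<Rightarrow> bool list" where
  "enc_ug N U =
     replicate (ug_size U) True @ [False] @
     enc_list (\<lambda>e. enc_nat (fst e) @ enc_nat (snd e) @
                   enc_list enc_nat (map (ug_perm U e) [0..<N]) @ enc_rat (ug_wt U e))
       (ug_edges U)"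

definition ug_yes :: "nat \<Rightarrow> real \<Rightarrow> language" where
  "ug_yes N \<eta> = {enc_ug N U | U. wf_ug N U \<and> real_of_rat (ug_opt N U) \<ge> 1 - \<eta>}"

definition ug_no :: "nat \<Rightarrow> real \<Rightarrow> language" where
  "ug_no N \<zeta> = {enc_ug N U | U. wf_ug N U \<and> real_of_rat (ug_opt N U) \<le> \<zeta>}"

definition unique_games_conjecture :: bool where
  "unique_games_conjecture \<longleftrightarrow>
     (\<forall>\<eta>>0. \<forall>\<zeta>>0. \<exists>N\<ge>1. NP_hard_to_distinguish (ug_yes N \<eta>) (ug_no N \<zeta>))"


section \<open>Non-uniform Balanced Edge-Separator\<close>

text \<open>
  Weights and demands are functions on the edges of the complete graph on \<open>{..<bes_size I}\<close>,
  that is, on its two-element vertex sets.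
\<close>

record bes =
  bes_size :: nat
  bes_wt :: "nat set \<Rightarrow> rat"
  bes_dem :: "nat set \<Rightarrow> rat"
  bes_bal :: rat

definition bes_edges :: "bes \<Rightarrow> nat set set" where
  "bes_edges I = {e. e \<subseteq> {..<bes_size I} \<and> card e = 2}"

definition bes_total_dem :: "bes \<Rightarrow> rat" where
  "bes_total_dem I = (\<Sum>e\<in>bes_edges I. bes_dem I e)"

definition wf_bes :: "bes \<Rightarrow> bool" where
  "wf_bes I \<longleftrightarrow>
     (\<forall>e\<in>bes_edges I. 0 \<le> bes_wt I e \<and> 0 \<le> bes_dem I e) \<and>
     bes_total_dem I / 6 \<le> bes_bal I \<and> bes_bal I \<le> bes_total_dem I / 2"

definition nontrivial_cut :: "bes \<Rightarrow> nat set \<Rightarrow> bool" where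
  "nontrivial_cut I S \<longleftrightarrow> S \<subseteq> {..<bes_size I} \<and> S \<noteq> {} \<and> S \<noteq> {..<bes_size I}"

definition cut_edges :: "bes \<Rightarrow> nat set \<Rightarrow> nat set set" where
  "cut_edges I S = {e \<in> bes_edges I. card (e \<inter> S) = 1}"

definition cut_weight :: "bes \<Rightarrow> nat set \<Rightarrow> rat" where
  "cut_weight I S = (\<Sum>e\<in>cut_edges I S. bes_wt I e)"

definition balanced_cut :: "bes \<Rightarrow> rat \<Rightarrow> nat set \<Rightarrow> bool" where
  "balanced_cut I B' S \<longleftrightarrow> nontrivial_cut I S \<and> (\<Sum>e\<in>cut_edges I S. bes_dem I e) \<ge> B'"

definition enc_bes :: "bes \<Rightarrow> bool list" where
  "enc_bes I =
     enc_nat (bes_size I) @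
     concat [enc_rat (bes_wt I {u, v}) @ enc_rat (bes_dem I {u, v}).
               v \<leftarrow> [0..<bes_size I], u \<leftarrow> [0..<v]] @
     enc_rat (bes_bal I)"

text \<open>The threshold \<open>\<alpha>\<close> is part of the input.\<close>

definition bes_yes :: language where
  "bes_yes = {enc_bes I @ enc_rat \<alpha> | I \<alpha>. wf_bes I \<and> 0 \<le> \<alpha> \<and>
     (\<exists>S. balanced_cut I (bes_bal I) S \<and> cut_weight I S \<le> \<alpha>)}"

definition bes_no :: "real \<Rightarrow> language" where
  "bes_no C = {enc_bes I @ enc_rat \<alpha> | I \<alpha>. wf_bes I \<and> 0 \<le> \<alpha> \<and>
     (\<forall>S. balanced_cut I (bes_bal I / 3) S \<longrightarrow>
        real_of_rat (cut_weight I S) > C * real_of_rat \<alpha>)}"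

end

theory Submission
  imports Defs "HOL-Analysis.Convex" "HOL-Library.Nat_Bijection"
begin

text \<open>
  Each edge of a Unique Games instance becomes several copies of the cube \<open>{0, 1}\<^sup>N\<close>, tied by heavy
  edges to one cube per endpoint, so that a cheap cut is a family of Boolean functions, one for each
  vertex. The light edges are the edges of the cubes and many parallel copies of the identification of
  the two cubes of an edge; the demand joins antipodal points. Labelings yield dictator cuts. Conversely,
  in a cheap balanced cut most functions have bounded total influence and large variance, so by
  the argument of Kahn, Kalai and Linial (via Bonami's inequality) they have an influential coordinate, and
  a random choice among the few influential coordinates of each vertex satisfies many constraints.

  Weights and demands of the edges of the Unique Games instance occur unscaled in the new instance;
  all the other numbers are constants. The reduction is thus computed by a machine with finitely many
  pointers into its input, for which halting implies a polynomial running time.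
\<close>

section \<open>Machines with an arbitrary finite state type\<close>

text \<open>The gap must not depend on the label size N, which the conjecture supplies only after
  \<eta> and \<zeta> are fixed. The bounds on Boolean functions are therefore free of the dimension:
  C determines d and \<tau>, these determine the number 2^r - 1 of parallel copies and the number m
  of candidate labels per vertex, and then \<eta> and \<zeta>. Only the weight M of the heavy edges
  is chosen after N. The demand joins antipodal points because a dictator separates all such pairs,
  whereas a nearly constant function separates few: the separated fraction is at most the variance.
  Balance thus supplies the large variance that the influence argument needs. Running time is
  measured on concrete machines, so the construction avoids arithmetic on weights. Blocks are
  indexed by positions of the input rather than by constraints: a pointer into the input is then
  itself the block number. The price is a large number of isolated nodes, which carry neither weight
  nor demand and do not affect any cut.\<close>

definition mstep :: "'s \<Rightarrow> ('s \<Rightarrow> nat list \<Rightarrow> 's \<times> (nat \<times> move) list) \<Rightarrow> 's \<times> tape list \<Rightarrow> 's \<times> tape list" where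
  "mstep h \<delta> = (\<lambda>(s, ts). if s = h then (s, ts)
     else case \<delta> s (map (\<lambda>(c, i). c i) ts) of (s', acts) \<Rightarrow> (s', map2 tape_act ts acts))"

definition tapes_below :: "nat \<Rightarrow> tape list \<Rightarrow> bool" where
  "tapes_below m ts \<longleftrightarrow> (\<forall>(c, i)\<in>set ts. \<forall>j. c j < m)"

lemma tapes_below_act:
  assumes "tapes_below m ts" "\<forall>(a, d)\<in>set acts. a < m"
  shows "tapes_below m (map2 tape_act ts acts)"
proof -
  have "\<forall>j. fst (tape_act t a) j < m" if "(t, a) \<in> set (zip ts acts)" for t a
  proof -
    obtain c i b d where ta: "t = (c, i)" "a = (b, d)" by (metis surj_pair)
    have "t \<in> set ts" "a \<in> set acts" using that by (auto dest: set_zip_leftD set_zip_rightD)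
    then show ?thesis using assms ta by (fastforce simp: tapes_below_def)
  qed
  then show ?thesis unfolding tapes_below_def by fastforce
qed

lemma tapes_below_read: "tapes_below m ts \<Longrightarrow> set (map (\<lambda>(c, i). c i) ts) \<subseteq> {..<m}"
  by (fastforce simp: tapes_below_def)

text \<open>The states are numbered along a list that starts with \<open>s0\<close> and
  \<open>h\<close>, since a machine must start in state 0 and halt in state 1. The bound on the tape
  contents enters the simulation because \<open>closed\<close> controls the transitions only for
  symbols below \<open>m\<close>.\<close>

lemma finite_state_machine:
  fixes Q :: "'s set"
  assumes Q: "finite Q" "s0 \<in> Q" "h \<in> Q" "s0 \<noteq> h" and k: "2 \<le> k" and m: "3 \<le> m"
    and closed: "\<And>s r. s \<in> Q \<Longrightarrow> length r = k \<Longrightarrow> set r \<subseteq> {..<m} \<Longrightarrow>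
      fst (\<delta> s r) \<in> Q \<and> length (snd (\<delta> s r)) = k \<and> (\<forall>(a, d)\<in>set (snd (\<delta> s r)). a < m)"
  obtains M where "wf_tm M" "tm_tapes M = k"
    "\<And>n ts ts'. length ts = k \<Longrightarrow> tapes_below m ts \<Longrightarrow> (mstep h \<delta> ^^ n) (s0, ts) = (h, ts') \<Longrightarrow>
       (tm_step M ^^ n) (0, ts) = (1, ts')"
proof -
  obtain xs where xs: "set xs = Q - {s0, h}" "distinct xs"
    using Q(1) by (metis finite_Diff finite_distinct_list)
  define L where "L = s0 # h # xs"
  have L: "set L = Q" "distinct L" "L ! 0 = s0" "L ! 1 = h" "2 \<le> length L"
    using xs Q by (auto simp: L_def)
  define enc where "enc s = (THE i. i < length L \<and> L ! i = s)" for s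
  have enc: "enc s < length L" "L ! enc s = s" if "s \<in> Q" for s
  proof -
    have "\<exists>!i. i < length L \<and> L ! i = s"
      using that L by (metis distinct_Ex1)
    from theI'[OF this] show "enc s < length L" "L ! enc s = s" unfolding enc_def by auto
  qed
  have enc_nth: "enc (L ! i) = i" if "i < length L" for i
    using enc[of "L ! i"] that L by (metis nth_eq_iff_index_eq nth_mem)
  have e0: "enc s0 = 0" and e1: "enc h = 1"
  proof -
    have "0 < length L" "1 < length L" using L(5) by linarith+
    then show "enc s0 = 0" "enc h = 1" using enc_nth[of 0] enc_nth[of 1] L(3,4) by metis+
  qed
  define M where "M = \<lparr>tm_tapes = k, tm_symbols = m, tm_states = length L,
     tm_delta = (\<lambda>q r. case \<delta> (L ! q) r of (s, acts) \<Rightarrow> (enc s, acts))\<rparr>"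
  have wf: "wf_tm M"
  proof -
    have "enc (fst (\<delta> (L ! q) r)) < length L" "length (snd (\<delta> (L ! q) r)) = k"
        "\<forall>(a, d)\<in>set (snd (\<delta> (L ! q) r)). a < m"
      if "q < length L" "length r = k" "set r \<subseteq> {..<m}" for q r
      using closed[of "L ! q" r] that enc(1) L(1) nth_mem by blast+
    then show ?thesis unfolding wf_tm_def M_def using L(5) k m by (simp add: split_beta) blast
  qed
  have sim: "fst ((mstep h \<delta> ^^ n) (s0, ts)) \<in> Q \<and> length (snd ((mstep h \<delta> ^^ n) (s0, ts))) = k
      \<and> tapes_below m (snd ((mstep h \<delta> ^^ n) (s0, ts)))
      \<and> (tm_step M ^^ n) (0, ts) = map_prod enc id ((mstep h \<delta> ^^ n) (s0, ts))"
    if "length ts = k" "tapes_below m ts" for n ts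
  proof (induction n)
    case 0
    then show ?case using that Q by (simp add: e0)
  next
    case (Suc n)
    obtain s us where su: "(mstep h \<delta> ^^ n) (s0, ts) = (s, us)" by fastforce
    have s: "s \<in> Q" "length us = k" "tapes_below m us" "(tm_step M ^^ n) (0, ts) = (enc s, us)"
      using Suc su by auto
    obtain s' acts where d: "\<delta> s (map (\<lambda>(c, i). c i) us) = (s', acts)" by fastforce
    have c: "s' \<in> Q" "length acts = k" "\<forall>(a, d)\<in>set acts. a < m"
      using closed[OF s(1) _ tapes_below_read[OF s(3)]] s(2) d by auto
    have h: "enc s = 1 \<longleftrightarrow> s = h" using e1 enc s Q by metis
    show ?case
      using s c su d h tapes_below_act[OF s(3) c(3)]
      by (auto simp: mstep_def M_def enc e1 simp del: One_nat_def)
  qed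
  show thesis
  proof
    show "wf_tm M" by fact
    show "tm_tapes M = k" by (simp add: M_def)
    fix n ts ts' assume "length ts = k" "tapes_below m ts" "(mstep h \<delta> ^^ n) (s0, ts) = (h, ts')"
    then show "(tm_step M ^^ n) (0, ts) = (1, ts')" using sim[of ts n] by (simp add: e1)
  qed
qed

section \<open>Pointer programs\<close>

text \<open>
  A register is a read-only head on the input. Position 0 carries a left end marker with symbol 3,
  the input occupies the positions from 1 to its length with symbols 1 and 2, and the blank after
  the input has symbol 0. Heads never leave this range. There are finitely many configurations
  per input, so that termination alone already gives a polynomial time bound.
\<close>

datatype com =
    Skip
  | Emit bool
  | Inc nat
  | Dec nat
  | Seq com com
  | Cond nat "nat set" com com
  | While nat "nat set" com

definition symb :: "bool list \<Rightarrow> nat \<Rightarrow> nat" where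
  "symb w p = (if p = 0 then 3 else if p \<le> length w then (if w ! (p - 1) then 2 else 1) else 0)"

inductive big :: "bool list \<Rightarrow> com \<Rightarrow> (nat \<Rightarrow> nat) \<Rightarrow> bool list \<Rightarrow> (nat \<Rightarrow> nat) \<Rightarrow> bool" for w where
  big_Skip: "big w Skip s [] s"
| big_Emit: "big w (Emit b) s [b] s"
| big_Inc: "big w (Inc r) s [] (s(r := if symb w (s r) = 0 then s r else Suc (s r)))"
| big_Dec: "big w (Dec r) s [] (s(r := s r - 1))"
| big_Seq: "big w c s o1 s1 \<Longrightarrow> big w d s1 o2 s2 \<Longrightarrow> big w (Seq c d) s (o1 @ o2) s2"
| big_CondT: "symb w (s r) \<in> A \<Longrightarrow> big w c s o1 s1 \<Longrightarrow> big w (Cond r A c d) s o1 s1"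
| big_CondF: "symb w (s r) \<notin> A \<Longrightarrow> big w d s o1 s1 \<Longrightarrow> big w (Cond r A c d) s o1 s1"
| big_WhileT: "symb w (s r) \<in> A \<Longrightarrow> big w c s o1 s1 \<Longrightarrow> big w (While r A c) s1 o2 s2 \<Longrightarrow>
    big w (While r A c) s (o1 @ o2) s2"
| big_WhileF: "symb w (s r) \<notin> A \<Longrightarrow> big w (While r A c) s [] s"

fun regs :: "com \<Rightarrow> nat set" where
  "regs Skip = {}"
| "regs (Emit b) = {}"
| "regs (Inc r) = {r}"
| "regs (Dec r) = {r}"
| "regs (Seq c d) = regs c \<union> regs d"
| "regs (Cond r A c d) = insert r (regs c \<union> regs d)"
| "regs (While r A c) = insert r (regs c)"

text \<open>The control state is the stack of commands still to be run. A loop is pushed back below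
  its body, so the stacks reachable from one program form a finite set and can serve as machine
  states. The argument \<open>v\<close> gives only the symbols under the heads; symbols 0 and 3 stop
  a head at the two ends of the input.\<close>

fun cstep :: "com list \<Rightarrow> (nat \<Rightarrow> nat) \<Rightarrow> com list \<times> bool option \<times> (nat \<Rightarrow> move)" where
  "cstep [] v = ([], None, \<lambda>_. Stay)"
| "cstep (Skip # k) v = (k, None, \<lambda>_. Stay)"
| "cstep (Emit b # k) v = (k, Some b, \<lambda>_. Stay)"
| "cstep (Inc r # k) v = (k, None, (\<lambda>_. Stay)(r := if v r = 0 then Stay else MoveRight))"
| "cstep (Dec r # k) v = (k, None, (\<lambda>_. Stay)(r := if v r = 3 then Stay else MoveLeft))"
| "cstep (Seq c d # k) v = (c # d # k, None, \<lambda>_. Stay)"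
| "cstep (Cond r A c d # k) v = ((if v r \<in> A then c else d) # k, None, \<lambda>_. Stay)"
| "cstep (While r A c # k) v = (if v r \<in> A then c # While r A c # k else k, None, \<lambda>_. Stay)"

fun move_pos :: "move \<Rightarrow> nat \<Rightarrow> nat" where
  "move_pos MoveLeft p = p - 1"
| "move_pos Stay p = p"
| "move_pos MoveRight p = Suc p"

definition pstep :: "bool list \<Rightarrow> com list \<times> (nat \<Rightarrow> nat) \<Rightarrow> com list \<times> (nat \<Rightarrow> nat)" where
  "pstep w = (\<lambda>(ks, s). case cstep ks (\<lambda>r. symb w (s r)) of (ks', e, mv) \<Rightarrow> (ks', \<lambda>r. move_pos (mv r) (s r)))"

definition pemit :: "bool list \<Rightarrow> com list \<times> (nat \<Rightarrow> nat) \<Rightarrow> bool list" where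
  "pemit w = (\<lambda>(ks, s). case cstep ks (\<lambda>r. symb w (s r)) of (ks', e, mv) \<Rightarrow> (case e of None \<Rightarrow> [] | Some b \<Rightarrow> [b]))"

definition ptrace :: "bool list \<Rightarrow> com list \<times> (nat \<Rightarrow> nat) \<Rightarrow> nat \<Rightarrow> bool list" where
  "ptrace w c n = concat (map (\<lambda>i. pemit w ((pstep w ^^ i) c)) [0..<n])"

lemma ptrace_0 [simp]: "ptrace w c 0 = []"
  by (simp add: ptrace_def)

lemma ptrace_Suc: "ptrace w c (Suc n) = ptrace w c n @ pemit w ((pstep w ^^ n) c)"
  by (simp add: ptrace_def)

lemma ptrace_add: "ptrace w c (n + m) = ptrace w c n @ ptrace w ((pstep w ^^ n) c) m"
  by (induction m) (simp_all add: ptrace_Suc funpow_add add.commute)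

lemma ptrace_Suc2: "ptrace w c (Suc n) = pemit w c @ ptrace w (pstep w c) n"
  using ptrace_add[of w c 1 n] by (simp add: ptrace_Suc)

lemma small_trans:
  assumes "(pstep w ^^ n1) c = c1" "ptrace w c n1 = o1" "(pstep w ^^ n2) c1 = c2" "ptrace w c1 n2 = o2"
  shows "(pstep w ^^ (n1 + n2)) c = c2 \<and> ptrace w c (n1 + n2) = o1 @ o2"
proof -
  have "(pstep w ^^ (n1 + n2)) c = (pstep w ^^ n2) ((pstep w ^^ n1) c)"
    by (simp only: add.commute[of n1 n2] funpow_add o_apply)
  then show ?thesis using assms by (simp add: ptrace_add)
qed

lemma small_step:
  assumes "pstep w c = c1" "pemit w c = o1" "\<exists>n. (pstep w ^^ n) c1 = c2 \<and> ptrace w c1 n = o2"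
  shows "\<exists>n. (pstep w ^^ n) c = c2 \<and> ptrace w c n = o1 @ o2"
proof -
  obtain n where "(pstep w ^^ n) c1 = c2" "ptrace w c1 n = o2" using assms by auto
  then have "(pstep w ^^ Suc n) c = c2 \<and> ptrace w c (Suc n) = o1 @ o2"
    using assms by (simp add: ptrace_Suc2 funpow_swap1 del: funpow.simps) (simp add: funpow_swap1)
  then show ?thesis by blast
qed

text \<open>The stack \<open>k\<close> below the command is arbitrary, which lets the induction pass
  through sequences and loops.\<close>

lemma big_small: "big w c s out s' \<Longrightarrow>
  \<exists>n. (pstep w ^^ n) (c # k, s) = (k, s') \<and> ptrace w (c # k, s) n = out"
proof (induction arbitrary: k rule: big.induct)
  case (big_Skip s)
  show ?case by (rule exI[of _ 1]) (simp add: pstep_def pemit_def ptrace_Suc)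
next
  case (big_Emit b s)
  show ?case by (rule exI[of _ 1]) (simp add: pstep_def pemit_def ptrace_Suc)
next
  case (big_Inc r s)
  show ?case by (rule exI[of _ 1]) (auto simp add: pstep_def pemit_def ptrace_Suc)
next
  case (big_Dec r s)
  show ?case by (rule exI[of _ 1]) (auto simp add: pstep_def pemit_def ptrace_Suc symb_def split: if_splits)
next
  case (big_Seq c s o1 s1 d o2 s2)
  obtain n1 where n1: "(pstep w ^^ n1) (c # d # k, s) = (d # k, s1)" "ptrace w (c # d # k, s) n1 = o1"
    using big_Seq.IH(1)[of "d # k"] by auto
  obtain n2 where n2: "(pstep w ^^ n2) (d # k, s1) = (k, s2)" "ptrace w (d # k, s1) n2 = o2"
    using big_Seq.IH(2)[of k] by auto
  have "\<exists>n. (pstep w ^^ n) (Seq c d # k, s) = (k, s2) \<and> ptrace w (Seq c d # k, s) n = [] @ (o1 @ o2)"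
    by (rule small_step[of w _ "(c # d # k, s)"])
       (use small_trans[OF n1 n2] in \<open>auto simp: pstep_def pemit_def\<close>)
  then show ?case by simp
next
  case (big_CondT s r A c o1 s1 d)
  have "\<exists>n. (pstep w ^^ n) (Cond r A c d # k, s) = (k, s1) \<and> ptrace w (Cond r A c d # k, s) n = [] @ o1"
    by (rule small_step[of w _ "(c # k, s)"])
       (use big_CondT in \<open>auto simp: pstep_def pemit_def\<close>)
  then show ?case by simp
next
  case (big_CondF s r A d o1 s1 c)
  have "\<exists>n. (pstep w ^^ n) (Cond r A c d # k, s) = (k, s1) \<and> ptrace w (Cond r A c d # k, s) n = [] @ o1"
    by (rule small_step[of w _ "(d # k, s)"])
       (use big_CondF in \<open>auto simp: pstep_def pemit_def\<close>)
  then show ?case by simp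
next
  case (big_WhileT s r A c o1 s1 o2 s2)
  let ?W = "While r A c"
  obtain n1 where n1: "(pstep w ^^ n1) (c # ?W # k, s) = (?W # k, s1)" "ptrace w (c # ?W # k, s) n1 = o1"
    using big_WhileT.IH(1)[of "?W # k"] by auto
  obtain n2 where n2: "(pstep w ^^ n2) (?W # k, s1) = (k, s2)" "ptrace w (?W # k, s1) n2 = o2"
    using big_WhileT.IH(2)[of k] by auto
  have "\<exists>n. (pstep w ^^ n) (?W # k, s) = (k, s2) \<and> ptrace w (?W # k, s) n = [] @ (o1 @ o2)"
    by (rule small_step[of w _ "(c # ?W # k, s)"])
       (use small_trans[OF n1 n2] big_WhileT.hyps(1) in \<open>auto simp: pstep_def pemit_def\<close>)
  then show ?case by simp
next
  case (big_WhileF s r A c)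
  then show ?case by (intro exI[of _ 1]) (simp add: pstep_def pemit_def ptrace_Suc)
qed

text \<open>An over-approximation of the stacks met while \<open>c\<close> runs on top of
  \<open>k\<close>, before \<open>k\<close> itself is exposed. It follows the program text rather
  than the runs, so its finiteness is immediate.\<close>

fun conts :: "com \<Rightarrow> com list \<Rightarrow> com list set" where
  "conts (Seq c d) k = insert (Seq c d # k) (conts c (d # k) \<union> conts d k)"
| "conts (Cond r A c d) k = insert (Cond r A c d # k) (conts c k \<union> conts d k)"
| "conts (While r A c) k = insert (While r A c # k) (conts c (While r A c # k))"
| "conts c k = {c # k}"

lemma finite_conts: "finite (conts c k)"
  by (induction c k rule: conts.induct) auto

lemma conts_start: "c # k \<in> conts c k"
  by (cases c) auto

lemma conts_closed: "x \<in> conts c k \<Longrightarrow> fst (cstep x v) \<in> insert k (conts c k)"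
proof (induction c arbitrary: x k)
  case (Seq c d)
  from Seq.prems consider "x = Seq c d # k" | "x \<in> conts c (d # k)" | "x \<in> conts d k" by auto
  then show ?case
    by cases (use Seq.IH(1)[of x "d # k"] Seq.IH(2)[of x k] in \<open>auto simp: conts_start\<close>)
next
  case (Cond r A c d)
  from Cond.prems consider "x = Cond r A c d # k" | "x \<in> conts c k" | "x \<in> conts d k" by auto
  then show ?case
    by cases (use Cond.IH(1)[of x k] Cond.IH(2)[of x k] in \<open>auto simp: conts_start\<close>)
next
  case (While r A c)
  from While.prems consider "x = While r A c # k" | "x \<in> conts c (While r A c # k)" by auto
  then show ?case
    by cases (use While.IH[of x "While r A c # k"] in \<open>auto simp: conts_start\<close>)
qed auto

definition all_conts :: "com \<Rightarrow> com list set" where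
  "all_conts c = insert [] (conts c [])"

lemma finite_all_conts: "finite (all_conts c)"
  by (simp add: all_conts_def finite_conts)

lemma all_conts_closed: "x \<in> all_conts c \<Longrightarrow> fst (cstep x v) \<in> all_conts c"
  using conts_closed[of x c "[]" v] by (auto simp: all_conts_def)

lemma conts_regs: "x \<in> conts c k \<Longrightarrow> \<Union> (regs ` set x) \<subseteq> regs c \<union> \<Union> (regs ` set k)"
  by (induction c k rule: conts.induct) fastforce+

lemma all_conts_regs: "x \<in> all_conts c \<Longrightarrow> \<Union> (regs ` set x) \<subseteq> regs c"
  using conts_regs[of x c "[]"] by (auto simp: all_conts_def)

lemma symb_eq_0: "symb w p = 0 \<longleftrightarrow> length w < p"
  by (auto simp: symb_def)

lemma pstep_range:
  assumes "ks \<in> all_conts c" "regs c \<subseteq> {..<kk}" "\<forall>r. s r \<le> Suc (length w) \<and> (kk \<le> r \<longrightarrow> s r = 0)"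
  shows "case pstep w (ks, s) of (ks', s') \<Rightarrow> ks' \<in> all_conts c \<and>
     (\<forall>r. s' r \<le> Suc (length w) \<and> (kk \<le> r \<longrightarrow> s' r = 0))"
proof -
  have "ks' \<in> all_conts c" if "pstep w (ks, s) = (ks', s')" for ks' s'
    using that all_conts_closed[OF assms(1), of "\<lambda>r. symb w (s r)"]
    by (auto simp: pstep_def split: prod.splits)
  moreover have "\<forall>r. snd (pstep w (ks, s)) r \<le> Suc (length w) \<and> (kk \<le> r \<longrightarrow> snd (pstep w (ks, s)) r = 0)"
  proof -
    have R: "\<Union> (regs ` set ks) \<subseteq> {..<kk}"
      using all_conts_regs[OF assms(1)] assms(2) by blast
    show ?thesis
      using R assms(3)
      by (cases "(ks, \<lambda>r. symb w (s r))" rule: cstep.cases)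
         (auto simp: pstep_def symb_eq_0 not_less Suc_le_eq le_diff_conv le_SucI)
  qed
  ultimately show ?thesis by (auto split: prod.split)
qed

text \<open>Before the first entry into \<open>F\<close> no state of the orbit can repeat, since
  cutting out the cycle would give an earlier entry. By the pigeonhole principle the entry happens
  within \<open>card A\<close> steps.\<close>

lemma funpow_absorbing_bound:
  assumes A: "finite A" "a \<in> A" "\<And>x. x \<in> A \<Longrightarrow> f x \<in> A" and F: "(f ^^ t) a \<in> F" "\<And>x. x \<in> F \<Longrightarrow> f x \<in> F"
  shows "(f ^^ card A) a \<in> F"
proof -
  define n where "n = (LEAST n. (f ^^ n) a \<in> F)"
  have n: "(f ^^ n) a \<in> F" unfolding n_def by (rule LeastI[of _ t]) fact
  have least: "(f ^^ i) a \<notin> F" if "i < n" for i using that not_less_Least n_def by blast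
  have inA: "(f ^^ i) a \<in> A" for i by (induction i) (auto simp: A)
  have stay: "(f ^^ (n + i)) a \<in> F" for i
    by (induction i) (use n F(2) in auto)
  have "inj_on (\<lambda>i. (f ^^ i) a) {..n}"
  proof (rule linorder_inj_onI')
    fix i j assume ij: "i \<in> {..n}" "j \<in> {..n}" "i < j"
    show "(f ^^ i) a \<noteq> (f ^^ j) a"
    proof
      assume eq: "(f ^^ i) a = (f ^^ j) a"
      have "(f ^^ (n - j + i)) a = (f ^^ (n - j + j)) a"
        by (simp add: funpow_add eq)
      then have "(f ^^ (n - j + i)) a \<in> F" using n ij by simp
      moreover have "n - j + i < n" using ij by auto
      ultimately show False using least by blast
    qed
  qed
  then have "card {..n} \<le> card A"
    using inA by (intro card_inj_on_le[OF _ _ A(1)]) auto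
  then have "n \<le> card A" by simp
  then show ?thesis using stay[of "card A - n"] by simp
qed

text \<open>A configuration consists of a stack and of \<open>kk\<close> positions between 0 and
  \<open>length w + 1\<close>. The bound is the number of these configurations, and a run that
  terminates at all does so within that many steps.\<close>

lemma program_time:
  assumes big: "big w c (\<lambda>_. 0) out s'" and regs: "regs c \<subseteq> {..<kk}"
  obtains n s' where "n \<le> card (all_conts c) * (length w + 2) ^ kk"
    "(pstep w ^^ n) ([c], \<lambda>_. 0) = ([], s')" "ptrace w ([c], \<lambda>_. 0) n = out"
proof -
  define S where "S = {s. \<forall>r. s r \<le> Suc (length w) \<and> (kk \<le> r \<longrightarrow> s r = (0::nat))}"
  define A where "A = all_conts c \<times> S"
  have inj: "inj_on (\<lambda>s. map s [0..<kk]) S"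
  proof (rule inj_onI)
    fix x y assume xy: "x \<in> S" "y \<in> S" "map x [0..<kk] = map y [0..<kk]"
    then have "x r = y r" if "r < kk" for r using that by simp
    moreover have "x r = y r" if "kk \<le> r" for r using that xy(1,2) by (simp add: S_def)
    ultimately show "x = y" by (meson ext not_le)
  qed
  have sub: "(\<lambda>s. map s [0..<kk]) ` S \<subseteq> {xs. set xs \<subseteq> {..<length w + 2} \<and> length xs = kk}"
    by (auto simp: S_def less_Suc_eq_le)
  have fin: "finite {xs. set xs \<subseteq> {..<length w + 2} \<and> length xs = kk}"
    by (rule finite_lists_length_eq) simp
  have finS: "finite S" using inj_on_finite[OF inj sub fin] .
  have "card S \<le> card {xs. set xs \<subseteq> {..<length w + 2} \<and> length xs = kk}"
    by (rule card_inj_on_le[OF inj sub fin])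
  also have "\<dots> = (length w + 2) ^ kk" by (simp add: card_lists_length_eq)
  finally have cardA: "card A \<le> card (all_conts c) * (length w + 2) ^ kk"
    by (simp add: A_def card_cartesian_product)
  have finA: "finite A" by (simp add: A_def finS finite_all_conts)
  have a: "([c], \<lambda>_. 0) \<in> A" by (auto simp: A_def S_def all_conts_def conts_start)
  have step: "pstep w x \<in> A" if "x \<in> A" for x
    using that pstep_range[OF _ regs, of "fst x" "snd x" w] by (auto simp: A_def S_def split: prod.splits)
  define F where "F = {([] :: com list, s) | s :: nat \<Rightarrow> nat. True}"
  obtain t where t: "(pstep w ^^ t) ([c], \<lambda>_. 0) = ([], s')" "ptrace w ([c], \<lambda>_. 0) t = out"
    using big_small[OF big, of "[]"] by auto
  have stF: "pstep w x = x" "pemit w x = []" if "x \<in> F" for x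
    using that by (auto simp: F_def pstep_def pemit_def)
  have halt: "(pstep w ^^ i) x = x \<and> ptrace w x i = []" if "x \<in> F" for x i
    by (induction i) (auto simp: stF that ptrace_Suc)
  define n where "n = card A"
  have n: "(pstep w ^^ n) ([c], \<lambda>_. 0) \<in> F"
    unfolding n_def
  proof (rule funpow_absorbing_bound[OF finA a step])
    show "(pstep w ^^ t) ([c], \<lambda>_. 0) \<in> F" using t by (simp add: F_def)
    show "pstep w x \<in> F" if "x \<in> F" for x using that by (simp add: stF)
  qed
  \<comment> \<open>Both times lie past the end of the run; from there on nothing changes and
    nothing is emitted, so the results at \<open>n\<close> and \<open>t\<close> agree.\<close>
  have "(pstep w ^^ n) ([c], \<lambda>_. 0) = (pstep w ^^ t) ([c], \<lambda>_. 0) \<and>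
     ptrace w ([c], \<lambda>_. 0) n = ptrace w ([c], \<lambda>_. 0) t"
  proof (cases "n \<le> t")
    case True
    then show ?thesis
      using halt[OF n, of "t - n"] small_trans[of n w "([c], \<lambda>_. 0)" _ _ "t - n"] by fastforce
  next
    case False
    have "(pstep w ^^ t) ([c], \<lambda>_. 0) \<in> F" using t by (simp add: F_def)
    from halt[OF this, of "n - t"] show ?thesis
      using False small_trans[of t w "([c], \<lambda>_. 0)" _ _ "n - t"] by fastforce
  qed
  then show ?thesis using t cardA by (intro that[of n s']) (auto simp: n_def)
qed

section \<open>Running a pointer program on the output of a Turing machine\<close>

datatype phase = Run nat | Unwind | Copying | Rewind | Prog "com list"

definition keep :: "nat list \<Rightarrow> (nat \<times> move) list" where
  "keep = map (\<lambda>a. (a, Stay))"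

text \<open>The records 1 and 2 differ from the blank, so the blank before the first record ends the
  unwinding. A step without movement leaves no record.\<close>

fun hist_act :: "move \<Rightarrow> nat \<Rightarrow> nat \<times> move" where
  "hist_act MoveLeft a = (1, MoveRight)"
| "hist_act MoveRight a = (2, MoveRight)"
| "hist_act Stay a = (a, Stay)"

text \<open>
  The tapes are the input tape of \<open>M\<close>, the output tape, the other tapes of \<open>M\<close> (starting with
  its output tape), a history tape and the pointer tapes. The history tape records the moves of the
  head of \<open>M\<close> on its output tape, because the head position at which \<open>M\<close> halts is unknown.
\<close>

fun comp_act :: "tm \<Rightarrow> com \<Rightarrow> phase \<Rightarrow> nat \<Rightarrow> nat \<Rightarrow> nat list \<Rightarrow> nat \<Rightarrow> nat list \<Rightarrow>
    phase \<times> (nat \<times> move) \<times> (nat \<times> move) \<times> (nat \<times> move) list \<times> (nat \<times> move) \<times> (nat \<times> move) list" where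
  "comp_act M c (Run q) r0 ro rs rh rp =
     (if q = 1 then (Unwind, (r0, Stay), (ro, Stay), keep rs, (rh, MoveLeft), keep rp)
      else if set (r0 # rs) \<subseteq> {..<tm_symbols M} then
        (case tm_delta M q (r0 # rs) of (q', acts) \<Rightarrow>
          (Run q', hd acts, (ro, Stay), tl acts, hist_act (snd (acts ! 1)) rh, keep rp))
      else (Run q, (r0, Stay), (ro, Stay), keep rs, (rh, Stay), keep rp))"
| "comp_act M c Unwind r0 ro rs rh rp =
     (if rh = 1 then (Unwind, (r0, Stay), (ro, Stay), (hd rs, MoveRight) # keep (tl rs), (rh, MoveLeft), keep rp)
      else if rh = 2 then (Unwind, (r0, Stay), (ro, Stay), (hd rs, MoveLeft) # keep (tl rs), (rh, MoveLeft), keep rp)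
      else (Copying, (r0, Stay), (ro, Stay), keep rs, (rh, Stay), map (\<lambda>_. (3, MoveRight)) rp))"
| "comp_act M c Copying r0 ro rs rh rp =
     (if hd rs \<in> {1, 2}
      then (Copying, (r0, Stay), (ro, Stay), (hd rs, MoveRight) # keep (tl rs), (rh, Stay),
            map (\<lambda>_. (hd rs, MoveRight)) rp)
      else (Rewind, (r0, Stay), (ro, Stay), keep rs, (rh, Stay), map (\<lambda>a. (a, MoveLeft)) rp))"
| "comp_act M c Rewind r0 ro rs rh rp =
     (if hd rp = 3 then (Prog [c], (r0, Stay), (ro, Stay), keep rs, (rh, Stay), keep rp)
      else (Rewind, (r0, Stay), (ro, Stay), keep rs, (rh, Stay), map (\<lambda>a. (a, MoveLeft)) rp))"
| "comp_act M c (Prog ks) r0 ro rs rh rp =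
     (case cstep ks (\<lambda>r. rp ! r) of (ks', e, mv) \<Rightarrow>
        (Prog ks', (r0, Stay), (case e of None \<Rightarrow> (ro, Stay) | Some b \<Rightarrow> (if b then 2 else 1, MoveRight)),
         keep rs, (rh, Stay), map (\<lambda>r. (rp ! r, mv r)) [0..<length rp]))"

definition comp_delta :: "tm \<Rightarrow> com \<Rightarrow> phase \<Rightarrow> nat list \<Rightarrow> phase \<times> (nat \<times> move) list" where
  "comp_delta M c s r = (case comp_act M c s (r ! 0) (r ! 1) (take (tm_tapes M - 1) (drop 2 r))
       (r ! (tm_tapes M + 1)) (drop (tm_tapes M + 2) r) of
     (s', a0, ao, as, ah, ap) \<Rightarrow> (s', a0 # ao # as @ ah # ap))"

type_synonym comp_config = "phase \<times> tape \<times> tape \<times> tape list \<times> tape \<times> tape list"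

definition flat :: "comp_config \<Rightarrow> phase \<times> tape list" where
  "flat = (\<lambda>(s, t0, to, ts, th, tp). (s, t0 # to # ts @ th # tp))"

abbreviation read :: "tape \<Rightarrow> nat" where
  "read t \<equiv> (case t of (c, i) \<Rightarrow> c i)"

definition comp_step :: "tm \<Rightarrow> com \<Rightarrow> comp_config \<Rightarrow> comp_config" where
  "comp_step M c = (\<lambda>(s, t0, to, ts, th, tp).
     (case comp_act M c s (read t0) (read to) (map read ts) (read th) (map read tp) of
       (s', a0, ao, as, ah, ap) \<Rightarrow>
         (s', tape_act t0 a0, tape_act to ao, map2 tape_act ts as, tape_act th ah, map2 tape_act tp ap)))"

lemma length_keep [simp]: "length (keep r) = length r"
  by (simp add: keep_def)

lemma keep_Cons [simp]: "keep (a # r) = (a, Stay) # keep r"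
  by (simp add: keep_def)

lemma act_keep [simp]: "map2 tape_act ts (keep (map read ts)) = ts"
  by (induction ts) (auto simp: keep_def)

lemma act_same [simp]: "tape_act t (read t, Stay) = t"
  by (cases t) auto

lemma act_uniform: "map2 tape_act (replicate k t) (map (\<lambda>_. a) (map read (replicate k t))) = replicate k (tape_act t a)"
  by (induction k) auto

lemma act_uniform': "map2 tape_act (replicate k t) (map f (map read (replicate k t))) = replicate k (tape_act t (f (read t)))"
  by (induction k) auto

locale composite =
  fixes M :: tm and c :: com and kk :: nat and h :: "bool list \<Rightarrow> bool list" and P :: "nat poly"
  assumes wf: "wf_tm M" and regs: "regs c \<subseteq> {..<kk}" and kk: "0 < kk"
    and M: "\<And>x. case (tm_step M ^^ poly P (length x)) (tm_init M x) of
            (q, ts) \<Rightarrow> q = 1 \<and> fst (ts ! 1) = tape_of (h x)"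
begin

text \<open>At least four symbols, since 3 marks the left end of the pointer tapes.\<close>

definition "syms = max 4 (tm_symbols M)"

definition "comp_states = Run ` {..<tm_states M} \<union> {Unwind, Copying, Rewind} \<union> Prog ` all_conts c"

definition wf_acts :: "(nat \<times> move) list \<Rightarrow> bool" where
  "wf_acts acts \<longleftrightarrow> (\<forall>(a, d)\<in>set acts. a < syms)"

lemma wf_facts: "2 \<le> tm_tapes M" "3 \<le> tm_symbols M" "2 \<le> tm_states M"
  using wf by (auto simp: wf_tm_def)

lemma wf_acts_keep: "set r \<subseteq> {..<syms} \<Longrightarrow> wf_acts (keep r)"
  by (auto simp: wf_acts_def keep_def)

lemma wf_acts_Nil [simp]: "wf_acts []"
  by (simp add: wf_acts_def)

lemma wf_acts_Cons [simp]: "wf_acts ((a, d) # r) \<longleftrightarrow> a < syms \<and> wf_acts r"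
  by (auto simp: wf_acts_def)

lemma wf_acts_append [simp]: "wf_acts (r @ r') \<longleftrightarrow> wf_acts r \<and> wf_acts r'"
  by (auto simp: wf_acts_def)

text \<open>\<open>M\<close> may have only three symbols, and then its transition function says
  nothing about the marker 3. The guard on the symbols read in phase \<open>Run\<close> keeps the
  transitions well formed in that case as well.\<close>

lemma comp_act_closed:
  assumes s: "s \<in> comp_states" and len: "length rs = tm_tapes M - 1" "length rp = kk"
    and below: "set (r0 # ro # rs @ rh # rp) \<subseteq> {..<syms}"
  shows "case comp_act M c s r0 ro rs rh rp of (s', a0, ao, as, ah, ap) \<Rightarrow>
     s' \<in> comp_states \<and> length as = length rs \<and> length ap = length rp \<and> wf_acts (a0 # ao # as @ ah # ap)"
proof (cases s)
  case (Run q)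
  have q: "q < tm_states M" using s Run by (auto simp: comp_states_def)
  show ?thesis
  proof (cases "q \<noteq> 1 \<and> set (r0 # rs) \<subseteq> {..<tm_symbols M}")
    case True
    obtain q' acts where d: "tm_delta M q (r0 # rs) = (q', acts)" by fastforce
    have "length (r0 # rs) = tm_tapes M" using len wf_facts by simp
    then have a: "q' < tm_states M" "length acts = tm_tapes M" "\<forall>(a, d)\<in>set acts. a < tm_symbols M"
      using wf q True d unfolding wf_tm_def by fastforce+
    obtain a0 as where as: "acts = a0 # as" using a(2) wf_facts by (cases acts) auto
    have "wf_acts acts" using a(3) by (auto simp: wf_acts_def syms_def less_max_iff_disj)
    moreover have "wf_acts [hist_act (snd (acts ! 1)) rh]"
      using below by (cases "snd (acts ! 1)") (auto simp: syms_def)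
    ultimately show ?thesis
      using True below len a(1,2) d as wf_acts_keep
      by (cases a0; cases "hist_act (snd (acts ! 1)) rh") (auto simp: Run comp_states_def)
  next
    case False
    then show ?thesis using q below by (auto simp: Run comp_states_def wf_acts_keep)
  qed
next
  case Unwind
  have "rs \<noteq> []" using len wf_facts by auto
  then obtain a rs' where "rs = a # rs'" by (cases rs) auto
  then show ?thesis using below by (auto simp: Unwind comp_states_def wf_acts_keep) (auto simp: wf_acts_def syms_def)
next
  case Copying
  have "rs \<noteq> []" using len wf_facts by auto
  then obtain a rs' where "rs = a # rs'" by (cases rs) auto
  then show ?thesis using below by (auto simp: Copying comp_states_def wf_acts_keep) (auto simp: wf_acts_def syms_def)
next
  case Rewind
  show ?thesis using below
    by (auto simp: Rewind comp_states_def wf_acts_keep all_conts_def conts_start) (auto simp: wf_acts_def)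
next
  case (Prog ks)
  have ks: "ks \<in> all_conts c" using s Prog by (auto simp: comp_states_def)
  obtain ks' e mv where st: "cstep ks (\<lambda>r. rp ! r) = (ks', e, mv)" by (metis prod_cases3)
  have "ks' \<in> all_conts c" using all_conts_closed[OF ks, of "\<lambda>r. rp ! r"] st by simp
  moreover have "wf_acts (map (\<lambda>r. (rp ! r, mv r)) [0..<length rp])"
    using below nth_mem by (fastforce simp: wf_acts_def)
  ultimately show ?thesis
    using below st by (auto simp: Prog comp_states_def wf_acts_keep syms_def less_max_iff_disj split: option.split)
qed

lemma comp_closed:
  assumes s: "s \<in> comp_states" and r: "length r = tm_tapes M + 2 + kk" "set r \<subseteq> {..<syms}"
  shows "fst (comp_delta M c s r) \<in> comp_states \<and> length (snd (comp_delta M c s r)) = tm_tapes M + 2 + kk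
    \<and> (\<forall>(a, d)\<in>set (snd (comp_delta M c s r)). a < syms)"
proof -
  let ?k = "tm_tapes M"
  define r0 where "r0 = r ! 0"
  define ro where "ro = r ! 1"
  define rs where "rs = take (?k - 1) (drop 2 r)"
  define rh where "rh = r ! (?k + 1)"
  define rp where "rp = drop (?k + 2) r"
  note defs = r0_def ro_def rs_def rh_def rp_def
  have len: "length rs = ?k - 1" "length rp = kk"
    using r wf_facts by (auto simp: defs)
  have "set (r0 # ro # rs @ rh # rp) \<subseteq> set r"
    unfolding defs using r wf_facts by (auto dest!: in_set_takeD in_set_dropD intro!: nth_mem)
  then have below: "set (r0 # ro # rs @ rh # rp) \<subseteq> {..<syms}" using r by blast
  obtain s' a0 ao as ah ap where
    a: "comp_act M c s r0 ro rs rh rp = (s', a0, ao, as, ah, ap)" by (metis prod_cases6)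
  have "comp_delta M c s r = (s', a0 # ao # as @ ah # ap)"
    using a by (simp add: comp_delta_def defs)
  moreover have "s' \<in> comp_states" "length as = length rs" "length ap = length rp" "wf_acts (a0 # ao # as @ ah # ap)"
    using comp_act_closed[OF s len below] a by auto
  ultimately show ?thesis using len wf_facts by (simp add: wf_acts_def)
qed

lemma flat_step:
  assumes C: "C = (s, t0, to, ts, th, tp)" "s \<in> comp_states" "length ts = tm_tapes M - 1" "length tp = kk"
     "tapes_below syms (t0 # to # ts @ th # tp)"
  shows "mstep (Prog []) (comp_delta M c) (flat C) = flat (comp_step M c C)"
    and "case comp_step M c C of (s, t0, to, ts, th, tp) \<Rightarrow> s \<in> comp_states \<and> length ts = tm_tapes M - 1 \<and>
     length tp = kk \<and> tapes_below syms (t0 # to # ts @ th # tp)"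
proof -
  let ?r = "map read (t0 # to # ts @ th # tp)"
  have r: "set ?r \<subseteq> {..<syms}" by (rule tapes_below_read[OF C(5)])
  obtain s' a0 ao as ah ap where
    a: "comp_act M c s (read t0) (read to) (map read ts) (read th) (map read tp) = (s', a0, ao, as, ah, ap)"
    by (metis prod_cases6)
  have st: "comp_step M c C = (s', tape_act t0 a0, tape_act to ao, map2 tape_act ts as, tape_act th ah, map2 tape_act tp ap)"
    using a C(1) by (simp add: comp_step_def)
  have ca: "s' \<in> comp_states" "length as = length ts" "length ap = length tp" "wf_acts (a0 # ao # as @ ah # ap)"
    using comp_act_closed[OF C(2), of "map read ts" "map read tp" "read t0" "read to" "read th"] a r C(3,4) by auto
  have t: "Suc (length ts) = tm_tapes M" using C(3) wf_facts by simp
  have d: "comp_delta M c s ?r = (s', a0 # ao # as @ ah # ap)"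
    using a by (simp add: comp_delta_def nth_append t[symmetric])
  have m: "map2 tape_act (t0 # to # ts @ th # tp) (a0 # ao # as @ ah # ap)
      = tape_act t0 a0 # tape_act to ao # map2 tape_act ts as @ tape_act th ah # map2 tape_act tp ap"
    using ca(2,3) by simp
  show "case comp_step M c C of (s, t0, to, ts, th, tp) \<Rightarrow> s \<in> comp_states \<and> length ts = tm_tapes M - 1 \<and>
     length tp = kk \<and> tapes_below syms (t0 # to # ts @ th # tp)"
  proof -
    have "tapes_below syms (map2 tape_act (t0 # to # ts @ th # tp) (a0 # ao # as @ ah # ap))"
      by (rule tapes_below_act[OF C(5)]) (use ca(4) in \<open>simp only: wf_acts_def\<close>)
    then have "tapes_below syms (tape_act t0 a0 # tape_act to ao # map2 tape_act ts as @ tape_act th ah # map2 tape_act tp ap)"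
      by (simp only: m)
    then show ?thesis unfolding st using ca(1-3) C(3,4) by (simp only: prod.case length_map length_zip min.idem)
  qed
  show "mstep (Prog []) (comp_delta M c) (flat C) = flat (comp_step M c C)"
  \<comment> \<open>In the halting state \<open>mstep\<close> is idle by convention, whereas
    \<open>comp_step\<close> still acts; with an empty stack this action changes nothing.\<close>
  proof (cases "s = Prog []")
    case True
    have k: "map (\<lambda>r. (map read tp ! r, Stay)) [0..<length (map read tp)] = keep (map read tp)"
      by (rule nth_equalityI) (simp_all add: keep_def)
    have "comp_act M c s (read t0) (read to) (map read ts) (read th) (map read tp) =
        (Prog [], (read t0, Stay), (read to, Stay), keep (map read ts), (read th, Stay), keep (map read tp))"
      unfolding True comp_act.simps cstep.simps prod.case option.case k ..
    then have "comp_step M c C = C"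
      unfolding C(1) comp_step_def prod.case by (simp only: prod.case act_same act_keep True)
    then show ?thesis using True C(1) by (simp add: mstep_def flat_def)
  next
    case False
    have "flat C = (s, t0 # to # ts @ th # tp)" by (simp add: flat_def C(1))
    then show ?thesis using False by (simp only: mstep_def prod.case if_False d m st) (simp add: flat_def)
  qed
qed

lemma flat_steps:
  assumes C: "C = (s, t0, to, ts, th, tp)" "s \<in> comp_states" "length ts = tm_tapes M - 1" "length tp = kk"
     "tapes_below syms (t0 # to # ts @ th # tp)"
  shows "(mstep (Prog []) (comp_delta M c) ^^ n) (flat C) = flat ((comp_step M c ^^ n) C)"
proof -
  have "(mstep (Prog []) (comp_delta M c) ^^ n) (flat C) = flat ((comp_step M c ^^ n) C) \<and>
    (case (comp_step M c ^^ n) C of (s, t0, to, ts, th, tp) \<Rightarrow> s \<in> comp_states \<and> length ts = tm_tapes M - 1 \<and>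
     length tp = kk \<and> tapes_below syms (t0 # to # ts @ th # tp))"
  proof (induction n)
    case 0
    then show ?case using C by simp
  next
    case (Suc n)
    obtain s t0 to ts th tp where n: "(comp_step M c ^^ n) C = (s, t0, to, ts, th, tp)" by (metis prod_cases6)
    show ?case using flat_step[OF n] Suc n by simp
  qed
  then show ?thesis ..
qed

end

section \<open>Correctness and running time of the composed machine\<close>

lemma tape_of_Nil: "tape_of [] = (\<lambda>_. 0)"
  by (auto simp: tape_of_def)

lemma tape_of_snoc: "(tape_of xs)(int (length xs) := if b then 2 else 1) = tape_of (xs @ [b])"
  by (rule ext) (auto simp: tape_of_def nth_append)

lemma tm_step_support:
  assumes "\<And>t. t \<in> set (tl ts) \<Longrightarrow> snd t \<le> n \<and> (\<forall>i\<ge>n. fst t i = 0)"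
  assumes "t \<in> set (tl (snd (tm_step M (q, ts))))"
  shows "snd t \<le> n + 1 \<and> (\<forall>i\<ge>n + 1. fst t i = 0)"
proof (cases "q = 1")
  case True
  then show ?thesis using assms by fastforce
next
  case False
  obtain q' acts where d: "tm_delta M q (map (\<lambda>(c, i). c i) ts) = (q', acts)" by fastforce
  have "t \<in> set (tl (map2 tape_act ts acts))" using assms(2) False d by simp
  then have "t \<in> set (map2 tape_act (tl ts) (tl acts))" by (cases ts; cases acts) auto
  then obtain u a where ua: "(u, a) \<in> set (zip (tl ts) (tl acts))" "t = tape_act u a" by auto
  then have "u \<in> set (tl ts)" by (auto dest: set_zip_leftD)
  from assms(1)[OF this] show ?thesis
    using ua(2) by (cases u; cases a; cases "snd a") auto
qed

text \<open>On every tape except the input tape the head gets at most one cell further to the right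
  per step, so after \<open>n\<close> steps all cells from \<open>n\<close> on are blank. The
  running time thus bounds the length of the intermediate string on which the pointer program
  runs.\<close>

lemma tm_output_length:
  assumes "(tm_step M ^^ n) (tm_init M x) = (q, ts)" "2 \<le> length ts" "fst (ts ! 1) = tape_of y"
  shows "length y \<le> n"
proof -
  have inv: "snd t \<le> int n \<and> (\<forall>i\<ge>int n. fst t i = 0)" if "t \<in> set (tl (snd ((tm_step M ^^ n) (tm_init M x))))" for t n
    using that
  proof (induction n arbitrary: t)
    case 0
    then show ?case by (auto simp: tm_init_def tape_of_Nil)
  next
    case (Suc n)
    obtain q ts where qs: "(tm_step M ^^ n) (tm_init M x) = (q, ts)" by fastforce
    have "snd u \<le> int n \<and> (\<forall>i\<ge>int n. fst u i = 0)" if "u \<in> set (tl ts)" for u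
      using Suc.IH that qs by simp
    from tm_step_support[where n = "int n" and ts = ts and t = t and M = M and q = q, OF this] show ?case
      using Suc.prems qs by (simp add: add.commute)
  qed
  have "ts ! 1 \<in> set (tl ts)"
    using assms(2) by (cases ts; cases "tl ts") auto
  then have z: "tape_of y i = 0" if "int n \<le> i" for i using inv[of "ts ! 1" n] assms that by auto
  show ?thesis
  proof (rule ccontr)
    assume "\<not> ?thesis"
    then show False using z[of "int n"] by (auto simp: tape_of_def split: if_splits)
  qed
qed

definition hist_cells :: "nat list \<Rightarrow> int \<Rightarrow> nat" where
  "hist_cells hs i = (if 0 \<le> i \<and> i < int (length hs) then hs ! nat i else 0)"

definition net :: "nat list \<Rightarrow> int" where
  "net hs = (\<Sum>a\<leftarrow>hs. if a = 2 then 1 else - 1)"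

lemma hist_cells_snoc: "(hist_cells hs)(int (length hs) := a) = hist_cells (hs @ [a])"
  by (rule ext) (auto simp: hist_cells_def nth_append)

text \<open>A pointer tape during copying: the end marker and the first \<open>j\<close> bits are
  written and the head stands at \<open>p\<close>.\<close>

definition ptape :: "bool list \<Rightarrow> nat \<Rightarrow> nat \<Rightarrow> tape" where
  "ptape w j p = ((\<lambda>i. if i < 0 \<or> int j < i then 0 else symb w (nat i)), int p)"

lemma ptape_write: "tape_act (ptape w j (Suc j)) (symb w (Suc j), MoveRight) = ptape w (Suc j) (Suc (Suc j))"
  by (auto simp: ptape_def fun_eq_iff) (metis nat_int of_nat_Suc not_less_eq_eq)

lemma read_ptape [simp]: "read (ptape w (length w) p) = symb w p"
  by (auto simp: ptape_def symb_def)

lemma ptape_left [simp]: "tape_act (ptape w (length w) (Suc p)) (symb w (Suc p), MoveLeft) = ptape w (length w) p"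
  by (auto simp: ptape_def fun_eq_iff symb_def nat_add_distrib)

lemma ptape_right [simp]: "tape_act (ptape w (length w) p) (symb w p, MoveRight) = ptape w (length w) (Suc p)"
  by (auto simp: ptape_def fun_eq_iff symb_def nat_add_distrib)

lemma ptape_stay [simp]: "tape_act (ptape w (length w) p) (symb w p, Stay) = ptape w (length w) p"
  by (auto simp: ptape_def fun_eq_iff symb_def)

lemma cstep_cong: "(\<And>r. r \<in> \<Union> (regs ` set ks) \<Longrightarrow> v r = v' r) \<Longrightarrow> cstep ks v = cstep ks v'"
  by (cases "(ks, v)" rule: cstep.cases) auto

lemma cstep_left: "snd (snd (cstep ks v)) r = MoveLeft \<Longrightarrow> v r \<noteq> 3"
  by (cases "(ks, v)" rule: cstep.cases) (auto split: if_splits)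

context composite
begin

abbreviation "blank \<equiv> (tape_of [], 0 :: int)"

definition "start x = (Run 0, (tape_of x, 0), blank, replicate (tm_tapes M - 1) blank, blank, replicate kk blank)"

text \<open>The head on the output tape starts at 0, so its position is the net displacement of the
  recorded moves. The claim stops at the first halting time because the composed machine leaves the
  phase \<open>Run\<close> as soon as it sees state 1.\<close>

lemma run_phase:
  assumes "\<And>i. i < n \<Longrightarrow> fst ((tm_step M ^^ i) (tm_init M x)) \<noteq> 1"
  shows "\<exists>q t0 ts hs. (tm_step M ^^ n) (tm_init M x) = (q, t0 # ts) \<and>
    (comp_step M c ^^ n) (start x) = (Run q, t0, blank, ts, (hist_cells hs, int (length hs)), replicate kk blank) \<and>
    length hs \<le> n \<and> set hs \<subseteq> {1, 2} \<and> length ts = tm_tapes M - 1 \<and> q < tm_states M \<and>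
    tapes_below (tm_symbols M) (t0 # ts) \<and> snd (hd ts) = net hs"
  using assms
proof (induction n)
  case 0
  have "hist_cells [] = tape_of []" by (auto simp: hist_cells_def tape_of_def)
  then show ?case using wf_facts
    by (intro exI[of _ 0] exI[of _ "(tape_of x, 0)"] exI[of _ "replicate (tm_tapes M - 1) blank"] exI[of _ "[]"])
       (auto simp: tm_init_def start_def tapes_below_def net_def tape_of_def hd_replicate)
next
  case (Suc n)
  then obtain q t0 ts hs where IH: "(tm_step M ^^ n) (tm_init M x) = (q, t0 # ts)"
    "(comp_step M c ^^ n) (start x) = (Run q, t0, blank, ts, (hist_cells hs, int (length hs)), replicate kk blank)"
    "length hs \<le> n" "set hs \<subseteq> {1, 2}" "length ts = tm_tapes M - 1" "q < tm_states M"
    "tapes_below (tm_symbols M) (t0 # ts)" "snd (hd ts) = net hs" by fastforce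
  have q: "q \<noteq> 1" using Suc.prems[of n] IH(1) by auto
  let ?r = "map read (t0 # ts)"
  obtain q' acts where d: "tm_delta M q ?r = (q', acts)" by fastforce
  have r: "set ?r \<subseteq> {..<tm_symbols M}" by (rule tapes_below_read[OF IH(7)])
  have len: "length ?r = tm_tapes M" using IH(5) wf_facts by simp
  have a: "q' < tm_states M" "length acts = tm_tapes M" "\<forall>(a, d)\<in>set acts. a < tm_symbols M"
    using wf IH(6) r len d unfolding wf_tm_def by fastforce+
  obtain a0 a1 as where as: "acts = a0 # a1 # as"
    using a(2) wf_facts by (cases acts; cases "tl acts") auto
  obtain t1 ts' where ts: "ts = t1 # ts'" using IH(5) wf_facts by (cases ts) auto
  obtain c1 i1 where t1: "t1 = (c1, i1)" by fastforce
  obtain s1 d1 where a1: "a1 = (s1, d1)" by fastforce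
  define hs' where "hs' = (case d1 of MoveLeft \<Rightarrow> hs @ [1] | MoveRight \<Rightarrow> hs @ [2] | Stay \<Rightarrow> hs)"
  have hist: "tape_act (hist_cells hs, int (length hs)) (hist_act d1 (hist_cells hs (int (length hs))))
      = (hist_cells hs', int (length hs'))"
    by (cases d1) (auto simp: hs'_def hist_cells_snoc)
  have "(comp_step M c ^^ Suc n) (start x) =
     (Run q', tape_act t0 a0, blank, map2 tape_act ts (a1 # as), (hist_cells hs', int (length hs')), replicate kk blank)"
    using IH(2) q r d hist act_keep[of "replicate kk blank"] by (simp add: comp_step_def as a1)
  moreover have "(tm_step M ^^ Suc n) (tm_init M x) = (q', tape_act t0 a0 # map2 tape_act ts (a1 # as))"
    using IH(1) q d by (simp add: as)
  moreover have "snd (hd (map2 tape_act ts (a1 # as))) = net hs'"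
    using IH(8) by (cases d1) (auto simp: ts t1 a1 hs'_def net_def)
  moreover have "tapes_below (tm_symbols M) (tape_act t0 a0 # map2 tape_act ts (a1 # as))"
    using tapes_below_act[OF IH(7) a(3)] by (simp add: as)
  moreover have "length (map2 tape_act ts (a1 # as)) = tm_tapes M - 1"
    using IH(5) a(2) by (simp add: as)
  moreover have "length hs' \<le> Suc n" "set hs' \<subseteq> {1, 2}"
    using IH(3,4) by (auto simp: hs'_def split: move.splits)
  ultimately show ?case using a(1) by blast
qed

text \<open>Moves are undone from the last one backwards, hence the induction from the end of the
  history. The tape \<open>H\<close> stays fixed while \<open>hs\<close> shrinks.\<close>

lemma unwind_phase:
  assumes "\<And>i. i < length hs \<Longrightarrow> H (int i) = hs ! i" "set hs \<subseteq> {1, 2}"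
  shows "(comp_step M c ^^ length hs) (Unwind, t0, to, (y, net hs) # ts, (H, int (length hs) - 1), tp) =
    (Unwind, t0, to, (y, 0) # ts, (H, -1), tp)"
  using assms
proof (induction hs rule: rev_induct)
  case Nil
  then show ?case by (simp add: net_def)
next
  case (snoc a hs)
  have H: "H (int i) = hs ! i" if "i < length hs" for i
    using snoc.prems(1)[of i] that by (simp add: nth_append)
  have a: "H (int (length hs)) = a" "a \<in> {1, 2}"
    using snoc.prems(1)[of "length hs"] snoc.prems(2) by auto
  have "comp_step M c (Unwind, t0, to, (y, net (hs @ [a])) # ts, (H, int (length (hs @ [a])) - 1), tp)
      = (Unwind, t0, to, (y, net hs) # ts, (H, int (length hs) - 1), tp)"
    using a by (auto simp: comp_step_def net_def)
  then show ?case
    using snoc.IH[OF H] snoc.prems(2) by (simp add: funpow_swap1)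
qed

lemma copy_phase:
  assumes "j \<le> length w"
  shows "(comp_step M c ^^ j) (Copying, t0, to, (tape_of w, 0) # ts, th, replicate kk (ptape w 0 1)) =
    (Copying, t0, to, (tape_of w, int j) # ts, th, replicate kk (ptape w j (Suc j)))"
  using assms
proof (induction j)
  case (Suc j)
  have "tape_of w (int j) = symb w (Suc j)" "symb w (Suc j) \<in> {1, 2}"
    using Suc.prems by (auto simp: tape_of_def symb_def)
  then show ?case
    using Suc by (auto simp: comp_step_def act_uniform ptape_write)
qed simp

lemma rewind_phase:
  "(comp_step M c ^^ j) (Rewind, t0, to, ts, th, replicate kk (ptape w (length w) j)) =
    (Rewind, t0, to, ts, th, replicate kk (ptape w (length w) 0))"
proof (induction j)
  case (Suc j)
  have "hd (map read (replicate kk (ptape w (length w) (Suc j)))) = symb w (Suc j)"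
    using kk by (cases kk) auto
  moreover have "symb w (Suc j) \<noteq> 3" by (simp add: symb_def)
  ultimately have "comp_step M c (Rewind, t0, to, ts, th, replicate kk (ptape w (length w) (Suc j))) =
     (Rewind, t0, to, ts, th, replicate kk (ptape w (length w) j))"
    by (simp add: comp_step_def act_uniform' del: map_replicate map_map)
  then show ?case using Suc by (simp add: funpow_swap1)
qed simp

lemma program_step:
  assumes "ks \<in> all_conts c"
  shows "comp_step M c (Prog ks, t0, (tape_of out, int (length out)), ts, th, map (\<lambda>r. ptape w (length w) (s r)) [0..<kk])
    = (case pstep w (ks, s) of (ks', s') \<Rightarrow> (Prog ks', t0,
        (tape_of (out @ pemit w (ks, s)), int (length (out @ pemit w (ks, s)))), ts, th,
         map (\<lambda>r. ptape w (length w) (s' r)) [0..<kk]))"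
proof -
  have R: "\<Union> (regs ` set ks) \<subseteq> {..<kk}"
    using all_conts_regs[OF assms] regs by blast
  let ?rp = "map read (map (\<lambda>r. ptape w (length w) (s r)) [0..<kk])"
  have eq: "cstep ks (\<lambda>r. ?rp ! r) = cstep ks (\<lambda>r. symb w (s r))"
    by (rule cstep_cong) (use R in auto)
  obtain ks' e mv where st: "cstep ks (\<lambda>r. symb w (s r)) = (ks', e, mv)" by (metis prod_cases3)
  have mv: "tape_act (ptape w (length w) (s r)) (symb w (s r), mv r) = ptape w (length w) (move_pos (mv r) (s r))" for r
  proof (cases "mv r")
    case MoveLeft
    then have "symb w (s r) \<noteq> 3" using cstep_left[of ks "\<lambda>r. symb w (s r)" r] st by simp
    then obtain p where "s r = Suc p" by (cases "s r") (auto simp: symb_def)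
    then show ?thesis using MoveLeft by simp
  qed auto
  have "map2 tape_act (map (\<lambda>r. ptape w (length w) (s r)) [0..<kk]) (map (\<lambda>r. (?rp ! r, mv r)) [0..<length ?rp])
      = map (\<lambda>r. ptape w (length w) (move_pos (mv r) (s r))) [0..<kk]"
    by (rule nth_equalityI) (auto simp: mv)
  then show ?thesis
    using eq st
    by (auto simp: comp_step_def pstep_def pemit_def tape_of_snoc simp del: map_map length_map split: option.split)
qed

lemma program_phase:
  "(comp_step M c ^^ n) (Prog [c], t0, blank, ts, th, replicate kk (ptape w (length w) 0)) =
    (case (pstep w ^^ n) ([c], \<lambda>_. 0) of (ks', s') \<Rightarrow> (Prog ks', t0,
        (tape_of (ptrace w ([c], \<lambda>_. 0) n), int (length (ptrace w ([c], \<lambda>_. 0) n))), ts, th,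
         map (\<lambda>r. ptape w (length w) (s' r)) [0..<kk]))
   \<and> fst ((pstep w ^^ n) ([c], \<lambda>_. 0)) \<in> all_conts c"
proof (induction n)
  case 0
  then show ?case by (auto simp: all_conts_def conts_start map_replicate_const)
next
  case (Suc n)
  obtain ks s where n: "(pstep w ^^ n) ([c], \<lambda>_. 0) = (ks, s)" by fastforce
  have ks: "ks \<in> all_conts c" using Suc n by simp
  have "fst (pstep w (ks, s)) \<in> all_conts c"
    using all_conts_closed[OF ks, of "\<lambda>r. symb w (s r)"] by (auto simp: pstep_def split: prod.splits)
  then show ?case using Suc n program_step[OF ks]
    by (simp add: ptrace_Suc split: prod.splits)
qed

text \<open>With T for the value of \<open>P\<close>: at most T steps each for the run of
  \<open>M\<close>, the unwinding, the copying and the rewinding, four transitions between phases,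
  and the configuration count of the pointer program on a string of length at most T.\<close>

definition "time_poly = smult 4 P + [:4:] + smult (card (all_conts c)) ((P + [:2:]) ^ kk)"

lemma composite_run:
  assumes big: "big (h x) c (\<lambda>_. 0) out s'"
  obtains n t0 to ts th tp where "n \<le> poly time_poly (length x)"
    "(comp_step M c ^^ n) (start x) = (Prog [], t0, (tape_of out, to), ts, th, tp)"
proof -
  define T where "T = poly P (length x)"
  define w where "w = h x"
  obtain n where nT: "n \<le> T" and n: "fst ((tm_step M ^^ n) (tm_init M x)) = 1"
    and least: "\<And>i. i < n \<Longrightarrow> fst ((tm_step M ^^ i) (tm_init M x)) \<noteq> 1"
  proof -
    let ?Q = "\<lambda>n. fst ((tm_step M ^^ n) (tm_init M x)) = 1"
    have "?Q T" using M[of x] by (auto simp: T_def)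
    then show thesis using that[of "LEAST n. ?Q n"] LeastI[of ?Q T] Least_le[of ?Q T] not_less_Least by blast
  qed
  from run_phase[OF least] obtain t0 ts hs where
    run: "(tm_step M ^^ n) (tm_init M x) = (1, t0 # ts)"
    "(comp_step M c ^^ n) (start x) = (Run 1, t0, blank, ts, (hist_cells hs, int (length hs)), replicate kk blank)"
    and hs: "length hs \<le> n" "set hs \<subseteq> {1, 2}" "length ts = tm_tapes M - 1" "snd (hd ts) = net hs"
    using n by fastforce
  have stay: "(tm_step M ^^ i) (1, t0 # ts) = (1, t0 # ts)" for i by (induction i) auto
  have "(tm_step M ^^ T) (tm_init M x) = (tm_step M ^^ (T - n)) ((tm_step M ^^ n) (tm_init M x))"
    using nT by (simp flip: funpow_add[unfolded fun_eq_iff comp_def, rule_format])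
  then have fin: "(tm_step M ^^ T) (tm_init M x) = (1, t0 # ts)" by (simp only: run stay)
  then have out1: "fst ((t0 # ts) ! 1) = tape_of w" using M[of x] by (simp add: T_def w_def)
  then obtain ts' where ts: "ts = (tape_of w, net hs) # ts'"
    using hs(3,4) wf_facts by (cases ts) auto
  have lw: "length w \<le> T"
    using tm_output_length[OF fin _ out1] hs(3) wf_facts by simp
  let ?S = "comp_step M c"
  let ?H = "hist_cells hs"
  have s1: "?S (Run 1, t0, blank, ts, (?H, int (length hs)), replicate kk blank)
     = (Unwind, t0, blank, (tape_of w, net hs) # ts', (?H, int (length hs) - 1), replicate kk blank)"
    using act_keep[of "replicate kk blank"] by (simp add: comp_step_def ts)
  have s2: "(?S ^^ length hs) (Unwind, t0, blank, (tape_of w, net hs) # ts', (?H, int (length hs) - 1), replicate kk blank)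
     = (Unwind, t0, blank, (tape_of w, 0) # ts', (?H, -1), replicate kk blank)"
    by (rule unwind_phase) (use hs in \<open>auto simp: hist_cells_def\<close>)
  \<comment> \<open>The marker goes into cell 0 and the heads move on, so that the first input bit
    lands in cell 1.\<close>
  have "(\<lambda>_. 0)(0 := 3) = (\<lambda>i. if i < 0 \<or> 0 < i then 0 else symb w (nat i))"
    by (auto simp: symb_def fun_eq_iff)
  then have s3: "?S (Unwind, t0, blank, (tape_of w, 0) # ts', (?H, -1), replicate kk blank)
     = (Copying, t0, blank, (tape_of w, 0) # ts', (?H, -1), replicate kk (ptape w 0 1))"
    using act_uniform[of kk blank "(3, MoveRight)"]
    by (simp add: comp_step_def ptape_def tape_of_Nil del: map_replicate map_map)
       (auto simp: hist_cells_def)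
  have s4: "(?S ^^ length w) (Copying, t0, blank, (tape_of w, 0) # ts', (?H, -1), replicate kk (ptape w 0 1))
     = (Copying, t0, blank, (tape_of w, int (length w)) # ts', (?H, -1), replicate kk (ptape w (length w) (Suc (length w))))"
    by (rule copy_phase) simp
  have s5: "?S (Copying, t0, blank, (tape_of w, int (length w)) # ts', (?H, -1), replicate kk (ptape w (length w) (Suc (length w))))
     = (Rewind, t0, blank, (tape_of w, int (length w)) # ts', (?H, -1), replicate kk (ptape w (length w) (length w)))"
    by (simp add: comp_step_def act_uniform' fun_upd_idem tape_of_def[of w "int (length w)"] del: map_replicate map_map)
  let ?R = "replicate kk (ptape w (length w) 0)"
  have s6: "(?S ^^ length w) (Rewind, t0, blank, (tape_of w, int (length w)) # ts', (?H, -1), replicate kk (ptape w (length w) (length w)))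
     = (Rewind, t0, blank, (tape_of w, int (length w)) # ts', (?H, -1), ?R)"
    by (rule rewind_phase)
  have "hd (map read ?R) = 3" using kk by (cases kk) (auto simp: symb_def)
  then have s7: "?S (Rewind, t0, blank, (tape_of w, int (length w)) # ts', (?H, -1), ?R)
     = (Prog [c], t0, blank, (tape_of w, int (length w)) # ts', (?H, -1), ?R)"
    using act_keep[of ?R] by (simp add: comp_step_def del: map_replicate)
  obtain m s'' where m: "m \<le> card (all_conts c) * (length w + 2) ^ kk"
    "(pstep w ^^ m) ([c], \<lambda>_. 0) = ([], s'')" "ptrace w ([c], \<lambda>_. 0) m = out"
    using program_time[OF big regs] unfolding w_def by metis
  have s8: "(?S ^^ m) (Prog [c], t0, blank, (tape_of w, int (length w)) # ts', (?H, -1), ?R) =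
    (Prog [], t0, (tape_of out, int (length out)), (tape_of w, int (length w)) # ts', (?H, -1),
       map (\<lambda>r. ptape w (length w) (s'' r)) [0..<kk])"
    using program_phase[of m t0 "(tape_of w, int (length w)) # ts'" "(?H, -1)" w] m by simp
  have tr: "(?S ^^ (a + b)) C = E" if "(?S ^^ a) C = D" "(?S ^^ b) D = E" for a b C D E
    using that by (simp add: funpow_add add.commute[of a b])
  have tr1: "(?S ^^ (a + 1)) C = E" if "(?S ^^ a) C = D" "?S D = E" for a C D E
    using that by simp
  have all: "(?S ^^ (n + 1 + length hs + 1 + length w + 1 + length w + 1 + m)) (start x) =
    (Prog [], t0, (tape_of out, int (length out)), (tape_of w, int (length w)) # ts', (?H, -1),
       map (\<lambda>r. ptape w (length w) (s'' r)) [0..<kk])"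
    by (rule tr[OF tr1[OF tr[OF tr1[OF tr[OF tr1[OF tr[OF tr1[OF run(2) s1] s2] s3] s4] s5] s6] s7] s8])
  have "m \<le> card (all_conts c) * (T + 2) ^ kk"
    using m(1) lw by (meson add_le_mono1 le_trans mult_le_mono2 power_mono zero_le)
  then have "n + 1 + length hs + 1 + length w + 1 + length w + 1 + m \<le> poly time_poly (length x)"
    using nT hs(1) lw by (simp add: time_poly_def T_def)
  then show thesis using all that by blast
qed

end

text \<open>The composition of reductions and the time bound in one statement. A derivation is
  required only on strings of the form \<open>h x\<close>, so malformed inputs never have to be
  considered.\<close>

theorem polytime_program:
  assumes h: "polytime h" and big: "\<And>x. \<exists>s'. big (h x) c (\<lambda>_. 0) (f x) s'"
  shows "polytime f"
proof -
  obtain M P where M: "wf_tm M" "\<And>x. case (tm_step M ^^ poly P (length x)) (tm_init M x) of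
            (q, ts) \<Rightarrow> q = 1 \<and> fst (ts ! 1) = tape_of (h x)"
    using h unfolding polytime_def by blast
  have "finite (regs c)" by (induction c) auto
  then obtain k0 where k0: "regs c \<subseteq> {..<k0}" by (meson finite_nat_iff_bounded)
  interpret composite M c "Suc k0" h P
    using M k0 by unfold_locales auto
  let ?k = "tm_tapes M + 2 + Suc k0"
  have fin: "finite comp_states" by (simp add: comp_states_def finite_all_conts)
  have mem: "Run 0 \<in> comp_states" "Prog [] \<in> comp_states"
    using wf_facts by (auto simp: comp_states_def all_conts_def)
  have "3 \<le> syms" by (simp add: syms_def)
  then obtain U where U: "wf_tm U" "tm_tapes U = ?k"
    and sim: "\<And>n ts ts'. length ts = ?k \<Longrightarrow> tapes_below syms ts \<Longrightarrow>
       (mstep (Prog []) (comp_delta M c) ^^ n) (Run 0, ts) = (Prog [], ts') \<Longrightarrow> (tm_step U ^^ n) (0, ts) = (1, ts')"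
    using finite_state_machine[OF fin mem, of ?k syms "comp_delta M c"] comp_closed by auto
  have "case (tm_step U ^^ poly time_poly (length x)) (tm_init U x) of
      (q, ts) \<Rightarrow> q = 1 \<and> fst (ts ! 1) = tape_of (f x)" for x
  proof -
    obtain s' where "big (h x) c (\<lambda>_. 0) (f x) s'" using big by blast
    then obtain n t0 to ts th tp where n: "n \<le> poly time_poly (length x)"
      "(comp_step M c ^^ n) (start x) = (Prog [], t0, (tape_of (f x), to), ts, th, tp)"
      by (rule composite_run)
    have below: "tapes_below syms (snd (flat (start x)))"
      by (auto simp: tapes_below_def start_def flat_def syms_def tape_of_def less_max_iff_disj)
    have len: "length (snd (flat (start x))) = ?k"
      using wf_facts by (simp add: start_def flat_def)
    have "(tm_tapes U - 1) = 1 + ((tm_tapes M - 1) + (1 + Suc k0))"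
      using U(2) wf_facts by simp
    then have "replicate (tm_tapes U - 1) blank
        = blank # replicate (tm_tapes M - 1) blank @ blank # replicate (Suc k0) blank"
      by (simp only: replicate_add One_nat_def replicate_Suc replicate_0 append.simps)
    then have init: "tm_init U x = (0, snd (flat (start x)))"
      by (simp add: tm_init_def start_def flat_def)
    have "(mstep (Prog []) (comp_delta M c) ^^ n) (flat (start x)) = flat ((comp_step M c ^^ n) (start x))"
      by (rule flat_steps[of "start x", unfolded start_def, OF refl mem(1), folded start_def])
         (use below in \<open>auto simp: start_def flat_def\<close>)
    moreover have "flat (start x) = (Run 0, snd (flat (start x)))" by (simp add: flat_def start_def)
    ultimately have "(mstep (Prog []) (comp_delta M c) ^^ n) (Run 0, snd (flat (start x)))
       = (Prog [], t0 # (tape_of (f x), to) # ts @ th # tp)"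
      using n by (simp add: flat_def)
    from sim[OF len below this]
    have r: "(tm_step U ^^ n) (tm_init U x) = (1, t0 # (tape_of (f x), to) # ts @ th # tp)"
      by (simp add: init)
    have "(tm_step U ^^ i) (1, us) = (1, us)" for i us by (induction i) auto
    then have "(tm_step U ^^ (poly time_poly (length x) - n + n)) (tm_init U x)
        = (1, t0 # (tape_of (f x), to) # ts @ th # tp)"
      by (simp only: funpow_add o_apply r)
    then show ?thesis using n(1) by simp
  qed
  then show ?thesis unfolding polytime_def using U(1) by blast
qed

section \<open>A library of pointer programs\<close>

lemma big_Seq': "big w c s o1 s1 \<Longrightarrow> big w d s1 o2 s2 \<Longrightarrow> out = o1 @ o2 \<Longrightarrow> big w (Seq c d) s out s2"
  by (simp add: big_Seq)

lemma big_Inc': "s r \<le> length w \<Longrightarrow> s' = s(r := Suc (s r)) \<Longrightarrow> big w (Inc r) s [] s'"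
  using big_Inc[of w r s] by (simp add: symb_eq_0)

lemma big_Dec': "s' = s(r := s r - 1) \<Longrightarrow> big w (Dec r) s [] s'"
  using big_Dec[of w r s] by simp

lemma big_iterate:
  assumes "\<And>j. j < n \<Longrightarrow> symb w (S j r) \<in> A \<and> big w c (S j) (out j) (S (Suc j))" "symb w (S n r) \<notin> A"
  shows "big w (While r A c) (S 0) (concat (map out [0..<n])) (S n)"
  using assms
proof (induction n arbitrary: S out)
  case 0
  then show ?case by (simp add: big_WhileF)
next
  case (Suc n)
  have "big w (While r A c) (S (Suc 0)) (concat (map (\<lambda>j. out (Suc j)) [0..<n])) (S (Suc n))"
    by (rule Suc.IH[of "\<lambda>j. S (Suc j)"]) (use Suc.prems in auto)
  then have "big w (While r A c) (S 0) (out 0 @ concat (map (\<lambda>j. out (Suc j)) [0..<n])) (S (Suc n))"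
    using Suc.prems(1)[of 0] by (auto intro: big_WhileT)
  also have "out 0 @ concat (map (\<lambda>j. out (Suc j)) [0..<n]) = concat (map out [0..<Suc n])"
    by (simp add: upt_conv_Cons map_Suc_upt[symmetric] o_def del: upt_Suc)
  finally show ?case .
qed

lemma big_iterate':
  assumes "\<And>j. j < n \<Longrightarrow> symb w (S j r) \<in> A" "\<And>j. j < n \<Longrightarrow> big w c (S j) (out j) (S (Suc j))"
    "symb w (S n r) \<notin> A" "s = S 0" "s' = S n" "o' = concat (map out [0..<n])"
  shows "big w (While r A c) s o' s'"
  using big_iterate[of n w S r A c out] assms by simp

lemma symb_eq_3 [simp]: "symb w p = 3 \<longleftrightarrow> p = 0"
  by (auto simp: symb_def)

lemma big_Cond:
  assumes "symb w (s r) \<in> A \<Longrightarrow> big w c s out s'" "symb w (s r) \<notin> A \<Longrightarrow> big w d s out s'"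
  shows "big w (Cond r A c d) s out s'"
  using assms by (cases "symb w (s r) \<in> A") (auto intro: big_CondT big_CondF)

lemma big_Cond_emit:
  assumes "symb w (s r) \<in> A \<longleftrightarrow> u"
  shows "big w (Cond r A (Emit True) (Emit False)) s [u] s"
proof (cases u)
  case True
  then show ?thesis using assms by (auto intro!: big_CondT intro: big_Emit)
next
  case False
  have "big w (Emit False) s [u] s" using False big_Emit[of w False s] by simp
  then show ?thesis using assms False by (auto intro!: big_CondF)
qed

definition Zero :: "nat \<Rightarrow> com" where
  "Zero r = While r (- {3}) (Dec r)"

lemma big_Zero: "s' = s(r := 0) \<Longrightarrow> big w (Zero r) s [] s'"
  unfolding Zero_def
  by (rule big_iterate'[where n = "s r" and S = "\<lambda>j. s(r := s r - j)" and out = "\<lambda>_. []"])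
     (auto intro!: big_Dec')

text \<open>A position can be read only by counting it down, so the source is consumed and
  afterwards restored from \<open>t\<close>.\<close>

definition Copy :: "nat \<Rightarrow> nat \<Rightarrow> nat \<Rightarrow> com" where
  "Copy a b t = Seq (Zero a) (Seq (Zero t) (Seq
     (While b (- {3}) (Seq (Dec b) (Seq (Inc a) (Inc t))))
     (While t (- {3}) (Seq (Dec t) (Inc b)))))"

lemma big_Copy:
  assumes "distinct [a, b, t]" "s b \<le> Suc (length w)" "s' = s(a := s b, t := 0)"
  shows "big w (Copy a b t) s [] s'"
proof -
  let ?n = "s b"
  let ?S = "\<lambda>j. s(b := ?n - j, a := j, t := j)"
  have 1: "big w (While b (- {3}) (Seq (Dec b) (Seq (Inc a) (Inc t)))) (s(a := 0, t := 0)) [] (?S ?n)"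
  proof (rule big_iterate'[where n = ?n and S = ?S and out = "\<lambda>_. []"])
    fix j assume j: "j < ?n"
    have "big w (Dec b) (?S j) [] (s(b := ?n - Suc j, a := j, t := j))"
      "big w (Inc a) (s(b := ?n - Suc j, a := j, t := j)) [] (s(b := ?n - Suc j, a := Suc j, t := j))"
      "big w (Inc t) (s(b := ?n - Suc j, a := Suc j, t := j)) [] (?S (Suc j))"
      using assms(1,2) j by (auto intro!: big_Dec' big_Inc' simp: fun_eq_iff)
    from big_Seq[OF this(1) big_Seq[OF this(2,3)]]
    show "big w (Seq (Dec b) (Seq (Inc a) (Inc t))) (?S j) [] (?S (Suc j))" by simp
  qed (use assms(1) in \<open>auto simp: fun_eq_iff\<close>)
  let ?T = "\<lambda>j. s(b := j, a := ?n, t := ?n - j)"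
  have 2: "big w (While t (- {3}) (Seq (Dec t) (Inc b))) (?S ?n) [] s'"
  proof (rule big_iterate'[where n = ?n and S = ?T and out = "\<lambda>_. []"])
    fix j assume j: "j < ?n"
    have "big w (Dec t) (?T j) [] (s(b := j, a := ?n, t := ?n - Suc j))"
      "big w (Inc b) (s(b := j, a := ?n, t := ?n - Suc j)) [] (?T (Suc j))"
      using assms(1,2) j by (auto intro!: big_Dec' big_Inc' simp: fun_eq_iff)
    from big_Seq[OF this] show "big w (Seq (Dec t) (Inc b)) (?T j) [] (?T (Suc j))" by simp
  qed (use assms in \<open>auto simp: fun_eq_iff\<close>)
  show ?thesis
    unfolding Copy_def
    by (rule big_Seq'[OF big_Zero[OF refl] big_Seq'[OF big_Zero[OF refl] big_Seq'[OF 1 2]]]) simp_all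
qed

definition Halve :: "nat \<Rightarrow> nat \<Rightarrow> nat \<Rightarrow> com" where
  "Halve b h g = Seq (Zero g) (Seq (Zero h) (Seq
     (While b (- {3}) (Seq (Dec b) (Cond b (- {3}) (Seq (Dec b) (Inc h)) (Inc g))))
     (While h (- {3}) (Seq (Dec h) (Inc b)))))"

lemma big_Halve:
  assumes "distinct [b, h, g]" "s b \<le> Suc (length w)" "s' = s(b := s b div 2, h := 0, g := s b mod 2)"
  shows "big w (Halve b h g) s [] s'"
proof -
  let ?n = "s b"
  \<comment> \<open>The state after \<open>j\<close> rounds. There are \<open>?n / 2\<close> rounds,
    rounded up; in the last round for an odd number a single unit is left, and it is recorded in
    \<open>g\<close> instead of \<open>h\<close>.\<close>
  let ?S = "\<lambda>j. s(g := if ?n < 2 * j then 1 else 0, h := min j (?n div 2), b := ?n - 2 * j)"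
  have 1: "big w (While b (- {3}) (Seq (Dec b) (Cond b (- {3}) (Seq (Dec b) (Inc h)) (Inc g)))) (s(g := 0, h := 0)) []
     (?S (Suc ?n div 2))"
  proof (rule big_iterate'[where n = "Suc ?n div 2" and S = ?S and out = "\<lambda>_. []"])
    fix j assume j: "j < Suc ?n div 2"
    then show "symb w (?S j b) \<in> - {3}" by auto
    have d: "big w (Dec b) (?S j) [] ((?S j)(b := ?n - 2 * j - 1))" by (rule big_Dec') simp
    show "big w (Seq (Dec b) (Cond b (- {3}) (Seq (Dec b) (Inc h)) (Inc g))) (?S j) [] (?S (Suc j))"
    proof (cases "?n - 2 * j = 1")
      case True
      have "big w (Inc g) ((?S j)(b := ?n - 2 * j - 1)) [] (?S (Suc j))"
        by (rule big_Inc') (use True assms(1) in \<open>auto simp: fun_eq_iff\<close>)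
      then show ?thesis using True by (intro big_Seq'[OF d big_CondF]) auto
    next
      case False
      have e: "big w (Dec b) ((?S j)(b := ?n - 2 * j - 1)) [] ((?S j)(b := ?n - 2 * j - 2))"
        by (rule big_Dec') auto
      have i: "big w (Inc h) ((?S j)(b := ?n - 2 * j - 2)) [] (?S (Suc j))"
        by (rule big_Inc') (use j False assms in \<open>auto simp: fun_eq_iff\<close>)
      have "big w (Seq (Dec b) (Inc h)) ((?S j)(b := ?n - 2 * j - 1)) [] (?S (Suc j))"
        by (rule big_Seq'[OF e i]) simp
      then show ?thesis using False j by (intro big_Seq'[OF d big_CondT]) auto
    qed
  qed (use assms in \<open>auto simp: fun_eq_iff\<close>)
  let ?T = "\<lambda>j. s(g := ?n mod 2, h := ?n div 2 - j, b := j)"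
  have 2: "big w (While h (- {3}) (Seq (Dec h) (Inc b))) (?S (Suc ?n div 2)) [] s'"
  proof (rule big_iterate'[where n = "?n div 2" and S = ?T and out = "\<lambda>_. []"])
    fix j assume j: "j < ?n div 2"
    have "big w (Dec h) (?T j) [] (s(g := ?n mod 2, h := ?n div 2 - Suc j, b := j))"
      "big w (Inc b) (s(g := ?n mod 2, h := ?n div 2 - Suc j, b := j)) [] (?T (Suc j))"
      using assms(1,2) j by (auto intro!: big_Dec' big_Inc' simp: fun_eq_iff)
    from big_Seq[OF this] show "big w (Seq (Dec h) (Inc b)) (?T j) [] (?T (Suc j))" by simp
  next
    show "?S (Suc ?n div 2) = ?T 0"
      by (cases "even ?n") (use assms(1) in \<open>auto simp: fun_eq_iff elim!: evenE oddE\<close>)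
  qed (use assms in \<open>auto simp: fun_eq_iff\<close>)
  show ?thesis
    unfolding Halve_def
    by (rule big_Seq'[OF big_Zero[OF refl] big_Seq'[OF big_Zero[OF refl] big_Seq'[OF 1 2]]]) simp_all
qed

section \<open>Encoded numbers and rationals on the input\<close>

definition occurs :: "bool list \<Rightarrow> nat \<Rightarrow> bool list \<Rightarrow> bool" where
  "occurs w p u \<longleftrightarrow> 1 \<le> p \<and> (\<forall>i<length u. symb w (p + i) = (if u ! i then 2 else 1))"

lemma occurs_Nil [simp]: "occurs w p [] \<longleftrightarrow> 1 \<le> p"
  by (simp add: occurs_def)

lemma occurs_Cons [simp]:
  "occurs w p (b # u) \<longleftrightarrow> 1 \<le> p \<and> symb w p = (if b then 2 else 1) \<and> occurs w (Suc p) u"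
  by (auto simp: occurs_def less_Suc_eq_0_disj)

lemma occurs_append [simp]: "occurs w p (u @ v) \<longleftrightarrow> occurs w p u \<and> occurs w (p + length u) v"
proof (induction u arbitrary: p)
  case Nil
  then show ?case by (auto simp: occurs_def)
qed auto

lemma occurs_self: "occurs w 1 w"
  by (auto simp: occurs_def symb_def)

lemma symb_bit_le: "symb w p = 1 \<or> symb w p = 2 \<Longrightarrow> p \<le> length w"
  by (auto simp: symb_def split: if_splits)

lemma delimited_Nil [simp]: "delimited [] = [False]"
  by (simp add: delimited_def)

lemma delimited_Cons [simp]: "delimited (b # bs) = True # b # delimited bs"
  by (simp add: delimited_def)

lemma length_delimited [simp]: "length (delimited bs) = Suc (2 * length bs)"
  by (induction bs) auto

lemma occurs_delimited:
  assumes "occurs w p (delimited bs)"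
  shows "j < length bs \<Longrightarrow> symb w (p + 2 * j) = 2"
    and "j < length bs \<Longrightarrow> symb w (Suc (p + 2 * j)) = (if bs ! j then 2 else 1)"
    and "symb w (p + 2 * length bs) = 1"
  using assms
proof (induction bs arbitrary: p j)
  case (Cons b bs)
  { case 1 then show ?case using Cons(1)[of "j - 1" "p + 2"] by (cases j) (auto simp: numeral_2_eq_2) }
  { case 2 then show ?case using Cons(2)[of "j - 1" "p + 2"] by (cases j) (auto simp: numeral_2_eq_2) }
  { case 3 then show ?case using Cons(3)[of "p + 2"] by (auto simp: numeral_2_eq_2) }
qed auto

lemma delimited_conv: "delimited bs = concat (map (\<lambda>j. [True, bs ! j]) [0..<length bs]) @ [False]"
proof -
  have "map (\<lambda>b. [True, b]) bs = map (\<lambda>j. [True, bs ! j]) [0..<length bs]"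
    by (rule nth_equalityI) auto
  then show ?thesis by (simp add: delimited_def)
qed

definition Skip_nat :: "nat \<Rightarrow> com" where
  "Skip_nat r = Seq (While r {2} (Seq (Inc r) (Inc r))) (Inc r)"

lemma big_Skip_nat:
  assumes "occurs w (s r) (delimited bs)" "s' = s(r := s r + length (delimited bs))"
  shows "big w (Skip_nat r) s [] s'"
proof -
  note d = occurs_delimited[OF assms(1)]
  have le: "s r + 2 * j \<le> length w \<and> Suc (s r + 2 * j) \<le> length w" if "j < length bs" for j
    using d(1,2)[OF that] symb_bit_le[of w] by metis
  have 1: "big w (While r {2} (Seq (Inc r) (Inc r))) s [] (s(r := s r + 2 * length bs))"
    by (rule big_iterate'[where n = "length bs" and out = "\<lambda>_. []" and S = "\<lambda>j. s(r := s r + 2 * j)"])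
       (use d le in \<open>auto intro!: big_Inc' big_Seq'[where ?o1.0 = "[]" and ?o2.0 = "[]"]\<close>)
  show ?thesis
    unfolding Skip_nat_def
    by (rule big_Seq'[OF 1 big_Inc']) (use assms d(3) symb_bit_le[of w] in auto)
qed

definition Copy_nat :: "nat \<Rightarrow> com" where
  "Copy_nat r = Seq (While r {2} (Seq (Emit True) (Seq (Inc r) (Seq (Cond r {2} (Emit True) (Emit False)) (Inc r)))))
     (Seq (Emit False) (Inc r))"

lemma big_Copy_nat:
  assumes "occurs w (s r) (delimited bs)" "s' = s(r := s r + length (delimited bs))"
  shows "big w (Copy_nat r) s (delimited bs) s'"
proof -
  note d = occurs_delimited[OF assms(1)]
  have le: "s r + 2 * j \<le> length w \<and> Suc (s r + 2 * j) \<le> length w" if "j < length bs" for j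
    using d(1,2)[OF that] symb_bit_le[of w] by metis
  have 1: "big w (While r {2} (Seq (Emit True) (Seq (Inc r) (Seq (Cond r {2} (Emit True) (Emit False)) (Inc r)))))
      s (concat (map (\<lambda>j. [True, bs ! j]) [0..<length bs])) (s(r := s r + 2 * length bs))"
  proof (rule big_iterate'[where n = "length bs" and out = "\<lambda>j. [True, bs ! j]" and S = "\<lambda>j. s(r := s r + 2 * j)"])
    fix j assume j: "j < length bs"
    show "symb w ((s(r := s r + 2 * j)) r) \<in> {2}" using d(1)[OF j] by simp
    let ?s = "s(r := Suc (s r + 2 * j))"
    have c: "big w (Cond r {2} (Emit True) (Emit False)) ?s [bs ! j] ?s"
      using d(2)[OF j] by (intro big_Cond_emit) simp
    show "big w (Seq (Emit True) (Seq (Inc r) (Seq (Cond r {2} (Emit True) (Emit False)) (Inc r))))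
       (s(r := s r + 2 * j)) [True, bs ! j] (s(r := s r + 2 * Suc j))"
      by (rule big_Seq'[OF big_Emit big_Seq'[OF big_Inc'[of _ _ _ ?s] big_Seq'[OF c big_Inc']]]) (use le[OF j] in auto)
  qed (use d(3) in auto)
  show ?thesis
    unfolding Copy_nat_def
    by (rule big_Seq'[OF 1 big_Seq'[OF big_Emit big_Inc' refl]])
       (use assms(2)[unfolded length_delimited] d(3) symb_bit_le[of w] delimited_conv[of bs] in simp_all)
qed

definition Copy_rat :: "nat \<Rightarrow> com" where
  "Copy_rat r = Seq (Cond r {2} (Emit True) (Emit False)) (Seq (Inc r) (Seq (Copy_nat r) (Copy_nat r)))"

lemma big_Copy_rat:
  assumes "occurs w (s r) (enc_rat q)" "s' = s(r := s r + length (enc_rat q))"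
  shows "big w (Copy_rat r) s (enc_rat q) s'"
proof -
  obtain a b where ab: "quotient_of q = (a, b)" by fastforce
  let ?u = "delimited (binary (nat \<bar>a\<bar>))" and ?v = "delimited (binary (nat b))"
  have e: "enc_rat q = (a < 0) # ?u @ ?v" by (simp add: enc_rat_def ab enc_nat_def)
  have oc: "symb w (s r) = (if a < 0 then 2 else 1)" "occurs w (Suc (s r)) ?u" "occurs w (Suc (s r) + length ?u) ?v"
    using assms(1) unfolding e by auto
  have 0: "big w (Cond r {2} (Emit True) (Emit False)) s [a < 0] s"
    using oc(1) by (intro big_Cond_emit) simp
  have 1: "big w (Inc r) s [] (s(r := Suc (s r)))"
    by (rule big_Inc') (use oc(1) symb_bit_le[of w "s r"] in auto)
  have 2: "big w (Copy_nat r) (s(r := Suc (s r))) ?u (s(r := Suc (s r) + length ?u))"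
    by (rule big_Copy_nat) (use oc(2) in auto)
  have 3: "big w (Copy_nat r) (s(r := Suc (s r) + length ?u)) ?v s'"
    by (rule big_Copy_nat) (use oc(3) assms(2) in \<open>auto simp: e\<close>)
  show ?thesis
    unfolding Copy_rat_def e by (rule big_Seq'[OF 0 big_Seq'[OF 1 big_Seq'[OF 2 3]]]) auto
qed

lemma length_binary: "k < 2 ^ length (binary k)"
  by (induction k rule: binary.induct) (subst binary.simps, auto)

lemma nth_binary: "i < length (binary k) \<Longrightarrow> binary k ! i = odd (k div 2 ^ i)"
proof (induction k arbitrary: i rule: binary.induct)
  case (1 k)
  show ?case
  proof (cases "k = 0")
    case True
    then show ?thesis using 1(2) by (simp add: binary.simps)
  next
    case False
    have b: "binary k = odd k # binary (k div 2)" using False by (subst binary.simps) simp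
    show ?thesis
    proof (cases i)
      case (Suc i')
      then show ?thesis using 1(1)[OF False, of i'] 1(2) b by (simp add: div_mult2_eq)
    qed (use b in simp)
  qed
qed

text \<open>The two conditions are the tests made by \<open>Nat_eq\<close>: the parities met during
  repeated halving agree with the bits, and nothing remains when the bits are used up.\<close>

lemma eq_binary_iff:
  "b = k \<longleftrightarrow> (\<forall>i<length (binary k). binary k ! i = odd (b div 2 ^ i)) \<and> b div 2 ^ length (binary k) = 0"
  (is "_ \<longleftrightarrow> ?R")
proof
  assume "b = k"
  then show ?R using length_binary[of k] by (simp add: nth_binary)
next
  assume R: ?R
  let ?n = "length (binary k)"
  have b: "b < 2 ^ ?n" using R by (simp add: div_eq_0_iff)
  show "b = k"
  proof (rule bit_eqI)
    fix i
    show "bit b i = bit k i"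
    proof (cases "i < ?n")
      case True
      then show ?thesis using R nth_binary[OF True] by (simp add: bit_iff_odd)
    next
      case False
      then have "(2::nat) ^ ?n \<le> 2 ^ i" by simp
      then have "b div 2 ^ i = 0" "k div 2 ^ i = 0"
        using less_le_trans[OF b] less_le_trans[OF length_binary[of k]] by auto
      then show ?thesis by (simp add: bit_iff_odd)
    qed
  qed
qed

definition Set_one :: "nat \<Rightarrow> com" where
  "Set_one r = Seq (Zero r) (Inc r)"

lemma big_Set_one: "s' = s(r := 1) \<Longrightarrow> big w (Set_one r) s [] s'"
  unfolding Set_one_def by (rule big_Seq'[OF big_Zero[OF refl] big_Inc']) auto

text \<open>Registers hold numbers in unary, as head positions, while the input holds them in binary
  and possibly beyond the range of a head. The comparison therefore halves the register along the
  bits instead of decoding the input.\<close>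

definition Nat_eq :: "nat \<Rightarrow> nat \<Rightarrow> nat \<Rightarrow> nat \<Rightarrow> nat \<Rightarrow> com" where
  "Nat_eq a b h g f = Seq (Zero f) (Seq (Zero h) (Seq (Zero g) (Seq
     (While a {2} (Seq (Inc a) (Seq (Halve b h g) (Seq
        (Cond a {2} (Cond g (- {3}) Skip (Set_one f)) (Cond g (- {3}) (Set_one f) Skip))
        (Seq (Zero g) (Inc a))))))
     (Seq (Inc a) (Seq (Cond b (- {3}) (Set_one f) Skip) (Zero b))))))"

lemma big_Nat_eq:
  assumes dist: "distinct [a, b, h, g, f]" and occ: "occurs w (s a) (enc_nat k)" and b: "s b \<le> Suc (length w)"
    and s': "s' = s(a := s a + length (enc_nat k), b := 0, h := 0, g := 0, f := if s b = k then 0 else 1)"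
  shows "big w (Nat_eq a b h g f) s [] s'"
proof -
  let ?bs = "binary k"
  let ?n = "length ?bs"
  note d = occurs_delimited[OF occ[unfolded enc_nat_def]]
  have le: "s a + 2 * j \<le> length w \<and> Suc (s a + 2 * j) \<le> length w" if "j < ?n" for j
    using d(1,2)[OF that] symb_bit_le[of w] by metis
  define E where "E j \<longleftrightarrow> (\<forall>i<j. ?bs ! i = odd (s b div 2 ^ i))" for j
  let ?S = "\<lambda>j. s(a := s a + 2 * j, b := s b div 2 ^ j, h := 0, g := 0, f := if E j then 0 else 1)"
  have 1: "big w (While a {2} (Seq (Inc a) (Seq (Halve b h g) (Seq
        (Cond a {2} (Cond g (- {3}) Skip (Set_one f)) (Cond g (- {3}) (Set_one f) Skip))
        (Seq (Zero g) (Inc a)))))) (s(f := 0, h := 0, g := 0)) [] (?S ?n)"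
  proof (rule big_iterate'[where n = ?n and out = "\<lambda>_. []" and S = ?S])
    fix j assume j: "j < ?n"
    show "symb w (?S j a) \<in> {2}" using d(1)[OF j] dist by simp
    let ?s1 = "(?S j)(a := Suc (s a + 2 * j))"
    have i1: "big w (Inc a) (?S j) [] ?s1"
      by (rule big_Inc') (use le[OF j] dist in auto)
    let ?s2 = "?s1(b := s b div 2 ^ Suc j, g := (s b div 2 ^ j) mod 2)"
    have "s b div 2 ^ j \<le> Suc (length w)" using b by (rule le_trans[OF div_le_dividend])
    then have i2: "big w (Halve b h g) ?s1 [] ?s2"
      by (intro big_Halve) (use dist b in \<open>auto simp: fun_eq_iff div_mult2_eq[symmetric] mult.commute\<close>)
    let ?s3 = "?s2(f := if E (Suc j) then 0 else 1)"
    have E: "E (Suc j) \<longleftrightarrow> E j \<and> (?bs ! j \<longleftrightarrow> odd (s b div 2 ^ j))"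
      by (auto simp: E_def less_Suc_eq)
    have i3: "big w (Cond a {2} (Cond g (- {3}) Skip (Set_one f)) (Cond g (- {3}) (Set_one f) Skip)) ?s2 [] ?s3"
    proof (cases "?bs ! j \<longleftrightarrow> odd (s b div 2 ^ j)")
      case True
      then have "?s3 = ?s2" using dist by (auto simp: E fun_eq_iff)
      moreover have "big w (Cond a {2} (Cond g (- {3}) Skip (Set_one f)) (Cond g (- {3}) (Set_one f) Skip)) ?s2 [] ?s2"
        by (intro big_Cond big_Skip) (use True d(2)[OF j] dist in
            \<open>simp_all add: even_iff_mod_2_eq_zero odd_iff_mod_2_eq_one split: if_splits\<close>)
      ultimately show ?thesis by simp
    next
      case False
      then have s3: "?s3 = ?s2(f := 1)" using dist by (auto simp: E fun_eq_iff)
      show ?thesis unfolding s3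
        by (intro big_Cond big_Set_one refl) (use False d(2)[OF j] dist in
            \<open>simp_all add: even_iff_mod_2_eq_zero odd_iff_mod_2_eq_one split: if_splits\<close>)
    qed
    have i4: "big w (Zero g) ?s3 [] (?s3(g := 0))" by (rule big_Zero) simp
    have i5: "big w (Inc a) (?s3(g := 0)) [] (?S (Suc j))"
      by (rule big_Inc') (use le[OF j] dist in \<open>auto simp: fun_eq_iff\<close>)
    show "big w (Seq (Inc a) (Seq (Halve b h g) (Seq
        (Cond a {2} (Cond g (- {3}) Skip (Set_one f)) (Cond g (- {3}) (Set_one f) Skip))
        (Seq (Zero g) (Inc a))))) (?S j) [] (?S (Suc j))"
      by (rule big_Seq'[OF i1 big_Seq'[OF i2 big_Seq'[OF i3 big_Seq'[OF i4 i5]]]]) auto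
  qed (use dist d(3) in \<open>auto simp: E_def fun_eq_iff\<close>)
  let ?t = "(?S ?n)(a := Suc (s a + 2 * ?n))"
  have 2: "big w (Inc a) (?S ?n) [] ?t"
    by (rule big_Inc') (use d(3) symb_bit_le[of w "s a + 2 * ?n"] dist in auto)
  have 3: "big w (Cond b (- {3}) (Set_one f) Skip) ?t [] (?t(f := if s b = k then 0 else 1))"
  proof (cases "s b div 2 ^ ?n = 0")
    case True
    then have "s b = k \<longleftrightarrow> E ?n" using eq_binary_iff[of "s b" k] by (simp add: E_def)
    then have "?t(f := if s b = k then 0 else 1) = ?t" using dist by (auto simp: fun_eq_iff)
    then show ?thesis using True dist by (auto intro!: big_CondF big_Skip)
  next
    case False
    then have "s b \<noteq> k" using eq_binary_iff[of "s b" k] by auto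
    then show ?thesis using False dist by (auto intro!: big_CondT big_Set_one)
  qed
  have 4: "big w (Zero b) (?t(f := if s b = k then 0 else 1)) [] s'"
    by (rule big_Zero) (use dist s' in \<open>auto simp: fun_eq_iff enc_nat_def\<close>)
  show ?thesis
    unfolding Nat_eq_def
    by (rule big_Seq'[OF big_Zero[OF refl] big_Seq'[OF big_Zero[OF refl] big_Seq'[OF big_Zero[OF refl]
          big_Seq'[OF 1 big_Seq'[OF 2 big_Seq'[OF 3 4]]]]]]) auto
qed

definition Emits :: "bool list \<Rightarrow> com" where
  "Emits us = foldr (\<lambda>b. Seq (Emit b)) us Skip"

lemma big_Emits: "big w (Emits us) s us s"
proof (induction us)
  case (Cons b us)
  then show ?case unfolding Emits_def by (auto intro: big_Seq'[OF big_Emit])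
qed (simp add: Emits_def big_Skip)

definition Seqs :: "com list \<Rightarrow> com" where
  "Seqs cs = foldr Seq cs Skip"

lemma big_Seqs:
  assumes "\<And>x. x \<in> set xs \<Longrightarrow> big w (f x) s (out x) s"
  shows "big w (Seqs (map f xs)) s (concat (map out xs)) s"
  using assms
proof (induction xs)
  case (Cons x xs)
  then show ?case unfolding Seqs_def by (auto intro!: big_Seq'[of w "f x" s "out x" s])
qed (simp add: Seqs_def big_Skip)

text \<open>Repeated halving yields the bits from the least significant one on, which is the order
  used by \<open>binary\<close>.\<close>

definition Emit_binary :: "nat \<Rightarrow> nat \<Rightarrow> nat \<Rightarrow> com" where
  "Emit_binary b h g = Seq (While b (- {3}) (Seq (Halve b h g) (Seq (Emit True)
      (Seq (Cond g (- {3}) (Emit True) (Emit False)) (Zero g))))) (Emit False)"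

lemma big_Emit_binary:
  assumes "distinct [b, h, g]" "s b \<le> Suc (length w)" "s h = 0" "s g = 0" "s' = s(b := 0)"
  shows "big w (Emit_binary b h g) s (enc_nat (s b)) s'"
proof -
  let ?c = "Seq (Halve b h g) (Seq (Emit True) (Seq (Cond g (- {3}) (Emit True) (Emit False)) (Zero g)))"
  have "big w (While b (- {3}) ?c) s (concat (map (\<lambda>u. [True, u]) (binary k))) (s(b := 0))"
    if "s b = k" "k \<le> Suc (length w)" "s h = 0" "s g = 0" for k s
    using that
  proof (induction k arbitrary: s rule: binary.induct)
    case (1 k)
    show ?case
    proof (cases "k = 0")
      case True
      then have "s(b := 0) = s" using 1 by auto
      then show ?thesis using True 1 by (simp add: binary.simps big_WhileF)
    next
      case False
      let ?s1 = "s(b := k div 2, g := k mod 2)"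
      have i1: "big w (Halve b h g) s [] ?s1"
        by (rule big_Halve) (use 1 assms(1) in \<open>auto simp: fun_eq_iff\<close>)
      have i2: "big w (Cond g (- {3}) (Emit True) (Emit False)) ?s1 [odd k] ?s1"
        by (intro big_Cond_emit) (simp add: odd_iff_mod_2_eq_one)
      have i3: "big w (Zero g) ?s1 [] (s(b := k div 2))"
        by (rule big_Zero) (use 1 assms(1) in \<open>auto simp: fun_eq_iff\<close>)
      have c: "big w ?c s [True, odd k] (s(b := k div 2))"
        by (rule big_Seq'[OF i1 big_Seq'[OF big_Emit big_Seq'[OF i2 i3]]]) auto
      have "big w (While b (- {3}) ?c) (s(b := k div 2)) (concat (map (\<lambda>u. [True, u]) (binary (k div 2))))
          ((s(b := k div 2))(b := 0))"
        by (rule 1(1)[OF False]) (use 1(2-) assms(1) in auto)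
      then have r: "big w (While b (- {3}) ?c) (s(b := k div 2)) (concat (map (\<lambda>u. [True, u]) (binary (k div 2)))) (s(b := 0))"
        by simp
      have b: "binary k = odd k # binary (k div 2)" using False by (subst binary.simps) simp
      have sb: "symb w (s b) \<in> - {3}" using False 1(2) by simp
      show ?thesis using big_WhileT[where r = b and s = s, OF sb c r] by (simp add: b del: fun_upd_apply)
    qed
  qed
  from this[of s "s b"] show ?thesis
    unfolding Emit_binary_def enc_nat_def delimited_def
    using assms by (auto intro: big_Seq'[OF _ big_Emit])
qed

section \<open>The reduction\<close>

text \<open>
  The instance has a block of \<open>2 ^ (N + r)\<close> nodes for each position \<open>p\<close> of the encoded Unique Games
  instance (counted from 1, and a block for 0); node \<open>c\<close> of block \<open>p\<close> is the vertex
  \<open>p * 2 ^ (N + r) + c\<close>. The number \<open>c\<close> stands for the tag \<open>c div 2 ^ N\<close> and for the point of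
  the cube given by its low bits. The vertex \<open>v\<close> of the Unique Games instance is represented
  by the nodes of tag 0 in block \<open>v\<close>, and an edge by the block at which its encoding starts. All other
  nodes are isolated. In an edge block the nodes of tag 0 are heavily tied to the cube of the first
  endpoint and all the other nodes to the cube of the second endpoint.
\<close>

definition pts :: "nat \<Rightarrow> nat \<Rightarrow> nat set" where
  "pts N c = {i. i < N \<and> bit c i}"

text \<open>The cubes with tags 0 and 1 carry their own edges; every tag from 1 on is a parallel
  copy joined pointwise to tag 0. One copy with cube edges suffices, since the heavy edges force all
  copies to be cut alike. The second clause is one-sided because \<open>link\<close> is read with
  the later node first.\<close>

definition adj :: "nat \<Rightarrow> nat \<Rightarrow> nat \<Rightarrow> bool" where
  "adj N c c' \<longleftrightarrow>
     (c div 2 ^ N = c' div 2 ^ N \<and> c div 2 ^ N \<le> 1 \<and> (\<exists>i<N. pts N c = sym_diff (pts N c') {i})) \<or>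
     (1 \<le> c div 2 ^ N \<and> c' div 2 ^ N = 0 \<and> pts N c = pts N c')"

definition anti :: "nat \<Rightarrow> nat \<Rightarrow> nat \<Rightarrow> bool" where
  "anti N c c' \<longleftrightarrow> c div 2 ^ N = 0 \<and> c' div 2 ^ N = 0 \<and> pts N c' = {..<N} - pts N c"

text \<open>Block \<open>p\<close> contains the later of the two nodes. The records of edges start
  beyond all vertex numbers, so every heavy edge is seen from the edge block. Points are pulled back
  along the bijection at the second endpoint, which turns the dictator of a label \<open>j\<close>
  into the dictator of \<open>ug_perm U e j\<close>.\<close>

definition link :: "nat \<Rightarrow> rat \<Rightarrow> ug \<Rightarrow> (nat \<times> nat) option \<Rightarrow> nat \<Rightarrow> nat \<Rightarrow> nat \<Rightarrow> nat \<Rightarrow> rat" where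
  "link N M U oe p c q c' = (case oe of None \<Rightarrow> 0 | Some e \<Rightarrow>
     if q = p then (if adj N c c' then ug_wt U e else 0)
     else if c div 2 ^ N = 0 then
       (if q = fst e \<and> c' div 2 ^ N = 0 \<and> pts N c' = pts N c then M else 0)
     else
       (if q = snd e \<and> c' div 2 ^ N = 0 \<and> pts N c' = {i. i < N \<and> ug_perm U e i \<in> pts N c} then M else 0))"

definition demand :: "nat \<Rightarrow> ug \<Rightarrow> (nat \<times> nat) option \<Rightarrow> nat \<Rightarrow> nat \<Rightarrow> nat \<Rightarrow> nat \<Rightarrow> rat" where
  "demand N U oe p c q c' = (case oe of None \<Rightarrow> 0 | Some e \<Rightarrow> if q = p \<and> anti N c c' then ug_wt U e else 0)"

definition enc_pair :: "nat \<Rightarrow> rat \<Rightarrow> ug \<Rightarrow> (nat \<times> nat) option \<Rightarrow> nat \<Rightarrow> nat \<Rightarrow> nat \<Rightarrow> nat \<Rightarrow> bool list" where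
  "enc_pair N M U oe p c q c' = enc_rat (link N M U oe p c q c') @ enc_rat (demand N U oe p c q c')"

definition enc_block :: "nat \<Rightarrow> nat \<Rightarrow> rat \<Rightarrow> ug \<Rightarrow> (nat \<times> nat) option \<Rightarrow> nat \<Rightarrow> bool list" where
  "enc_block N K M U oe p = concat (map (\<lambda>c.
     concat (map (\<lambda>q. concat (map (enc_pair N M U oe p c q) [0..<K])) [0..<p]) @
     concat (map (enc_pair N M U oe p c p) [0..<c])) [0..<K])"

definition enc_edge :: "nat \<Rightarrow> ug \<Rightarrow> nat \<times> nat \<Rightarrow> bool list" where
  "enc_edge N U e = enc_nat (fst e) @ enc_nat (snd e) @
     enc_list enc_nat (map (ug_perm U e) [0..<N]) @ enc_rat (ug_wt U e)"

text \<open>The summand 2 stands for the separator after the unary vertex count and for the counting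
  of positions from 1.\<close>

definition edge_starts :: "nat \<Rightarrow> ug \<Rightarrow> nat \<Rightarrow> nat" where
  "edge_starts N U i = ug_size U + 2 + length (enc_nat (length (ug_edges U))) +
     length (concat (map (enc_edge N U) (take i (ug_edges U))))"

definition edge_at :: "nat \<Rightarrow> ug \<Rightarrow> nat \<Rightarrow> (nat \<times> nat) option" where
  "edge_at N U p = (if \<exists>i<length (ug_edges U). edge_starts N U i = p
     then Some (ug_edges U ! (THE i. i < length (ug_edges U) \<and> edge_starts N U i = p)) else None)"

text \<open>The encoding of the constructed instance arranged by blocks, the order in which a
  pointer walking over the input can produce it.\<close>

definition enc_reduction :: "nat \<Rightarrow> nat \<Rightarrow> rat \<Rightarrow> rat \<Rightarrow> rat \<Rightarrow> ug \<Rightarrow> bool list" where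
  "enc_reduction N K M B \<alpha> U = enc_nat ((length (enc_ug N U) + 1) * K) @
     concat (map (\<lambda>p. enc_block N K M U (edge_at N U p) p) [0..<length (enc_ug N U) + 1]) @
     enc_rat B @ enc_rat \<alpha>"

section \<open>Positions of the edge records in the input\<close>

lemma enc_ug_conv: "enc_ug N U = replicate (ug_size U) True @ [False] @
   enc_nat (length (ug_edges U)) @ concat (map (enc_edge N U) (ug_edges U))"
  by (simp add: enc_ug_def enc_list_def enc_edge_def[abs_def])

lemma enc_edge_conv: "enc_edge N U e =
   concat (map enc_nat ([fst e, snd e, N] @ map (ug_perm U e) [0..<N])) @ enc_rat (ug_wt U e)"
  by (simp add: enc_edge_def enc_list_def)

lemma length_enc_nat_pos: "0 < length (enc_nat k)"
  by (simp add: enc_nat_def)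

lemma edge_starts_Suc:
  "i < length (ug_edges U) \<Longrightarrow> edge_starts N U (Suc i) = edge_starts N U i + length (enc_edge N U (ug_edges U ! i))"
  by (simp add: edge_starts_def take_Suc_conv_app_nth)

lemma length_enc_edge_pos: "0 < length (enc_edge N U e)"
  using length_enc_nat_pos[of "fst e"] by (simp add: enc_edge_def)

lemma edge_starts_mono:
  assumes "i < j" "j \<le> length (ug_edges U)"
  shows "edge_starts N U i < edge_starts N U j"
  using assms
proof (induction j)
  case (Suc j)
  then show ?case
    using edge_starts_Suc[of j U N] length_enc_edge_pos[of N U "ug_edges U ! j"]
    by (cases "i = j") auto
qed simp

lemma edge_starts_inj:
  "i < length (ug_edges U) \<Longrightarrow> j < length (ug_edges U) \<Longrightarrow> edge_starts N U i = edge_starts N U j \<Longrightarrow> i = j"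
  using edge_starts_mono[of i j U N] edge_starts_mono[of j i U N] by (cases i j rule: linorder_cases) auto

lemma edge_at_start:
  assumes "i < length (ug_edges U)"
  shows "edge_at N U (edge_starts N U i) = Some (ug_edges U ! i)"
proof -
  have "(THE j. j < length (ug_edges U) \<and> edge_starts N U j = edge_starts N U i) = i"
    using assms by (intro the_equality) (auto dest: edge_starts_inj)
  then show ?thesis using assms by (auto simp: edge_at_def)
qed

lemma edge_at_SomeD: "edge_at N U p = Some e \<Longrightarrow>
   \<exists>i<length (ug_edges U). edge_starts N U i = p \<and> e = ug_edges U ! i"
  by (metis edge_at_def edge_at_start option.distinct(1) option.inject)

lemma edge_at_inside:
  assumes "i < length (ug_edges U)" "edge_starts N U i < p" "p < edge_starts N U (Suc i)"
  shows "edge_at N U p = None"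
proof (rule ccontr)
  assume "edge_at N U p \<noteq> None"
  then obtain j where j: "j < length (ug_edges U)" "edge_starts N U j = p"
    using edge_at_SomeD by fastforce
  show False
  proof (cases "j \<le> i")
    case True
    then show ?thesis using edge_starts_mono[of j i U N] assms j by (cases "j = i") auto
  next
    case False
    then show ?thesis using edge_starts_mono[of "Suc i" j U N] assms j by (cases "j = Suc i") auto
  qed
qed

lemma edge_at_before:
  assumes "p < edge_starts N U 0"
  shows "edge_at N U p = None"
proof (rule ccontr)
  assume "edge_at N U p \<noteq> None"
  then obtain j where "j < length (ug_edges U)" "edge_starts N U j = p"
    using edge_at_SomeD by fastforce
  then show False using edge_starts_mono[of 0 j U N] assms by (cases j) auto
qed

section \<open>A pointer program for the reduction\<close>

text \<open>Roles of the registers: \<open>rP\<close> is the current block, \<open>rQ\<close> an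
  earlier block, \<open>rD\<close> the distance that \<open>rQ\<close> still has to go,
  \<open>rA\<close> a head inside the edge record, \<open>rB\<close> the number to be compared and
  \<open>rF\<close> the outcome of a comparison; \<open>rH\<close>, \<open>rG\<close> and
  \<open>rT\<close> are scratch.\<close>

abbreviation (input) "rP \<equiv> 0 :: nat"
abbreviation (input) "rQ \<equiv> 1 :: nat"
abbreviation (input) "rD \<equiv> 2 :: nat"
abbreviation (input) "rA \<equiv> 3 :: nat"
abbreviation (input) "rB \<equiv> 4 :: nat"
abbreviation (input) "rH \<equiv> 5 :: nat"
abbreviation (input) "rG \<equiv> 6 :: nat"
abbreviation (input) "rF \<equiv> 7 :: nat"
abbreviation (input) "rT \<equiv> 8 :: nat"

text \<open>Between commands all auxiliary registers are 0, so three positions describe the whole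
  state and tests can be nested.\<close>

definition st :: "nat \<Rightarrow> nat \<Rightarrow> nat \<Rightarrow> nat \<Rightarrow> nat" where
  "st p q d = (\<lambda>_. 0)(rP := p, rQ := q, rD := d)"

definition Test :: "nat \<Rightarrow> com \<Rightarrow> com \<Rightarrow> com" where
  "Test j c1 c2 = Seq (Copy rA rP rT) (Seq (Seqs (replicate j (Skip_nat rA)))
     (Seq (Nat_eq rA rB rH rG rF) (Seq (Zero rA) (Cond rF {3} c1 (Seq (Zero rF) c2)))))"

lemma big_Skip_nats:
  assumes "occurs w (s r) (concat (map enc_nat ns))"
  shows "big w (Seqs (replicate (length ns) (Skip_nat r))) s [] (s(r := s r + length (concat (map enc_nat ns))))"
  using assms
proof (induction ns arbitrary: s)
  case Nil
  then show ?case by (simp add: Seqs_def big_Skip)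
next
  case (Cons n ns)
  let ?s = "s(r := s r + length (enc_nat n))"
  have 1: "big w (Skip_nat r) s [] ?s"
    by (rule big_Skip_nat) (use Cons.prems in \<open>auto simp: enc_nat_def\<close>)
  have 2: "big w (Seqs (replicate (length ns) (Skip_nat r))) ?s []
      (?s(r := ?s r + length (concat (map enc_nat ns))))"
    by (rule Cons.IH) (use Cons.prems in auto)
  show ?case using big_Seq[OF 1 2] by (simp add: Seqs_def add.assoc fun_upd_same del: fun_upd_apply)
qed

lemma big_Test:
  assumes occ: "occurs w p (concat (map enc_nat ns))" and j: "j < length ns"
    and p: "p \<le> Suc (length w)" and b: "b \<le> Suc (length w)"
    and c1: "b = ns ! j \<Longrightarrow> big w c1 (st p q d) out (st p q d)"
    and c2: "b \<noteq> ns ! j \<Longrightarrow> big w c2 (st p q d) out (st p q d)"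
  shows "big w (Test j c1 c2) ((st p q d)(rB := b)) out (st p q d)"
proof -
  let ?s = "(st p q d)(rB := b)"
  let ?l = "length (concat (map enc_nat (take j ns)))"
  have ns: "ns = take j ns @ [ns ! j] @ drop (Suc j) ns" using j by (simp add: id_take_nth_drop)
  have "occurs w p (concat (map enc_nat (take j ns @ [ns ! j] @ drop (Suc j) ns)))"
    using occ ns by simp
  then have o: "occurs w p (concat (map enc_nat (take j ns)))" "occurs w (p + ?l) (enc_nat (ns ! j))"
    by auto
  have 1: "big w (Copy rA rP rT) ?s [] (?s(rA := p))"
    by (rule big_Copy) (use p in \<open>auto simp: st_def fun_eq_iff\<close>)
  have 2: "big w (Seqs (replicate j (Skip_nat rA))) (?s(rA := p)) [] (?s(rA := p + ?l))"
    using big_Skip_nats[of w "?s(rA := p)" rA "take j ns"] o(1) j by simp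
  let ?f = "if b = ns ! j then 0 else 1 :: nat"
  have 3: "big w (Nat_eq rA rB rH rG rF) (?s(rA := p + ?l)) []
      ((st p q d)(rA := p + ?l + length (enc_nat (ns ! j)), rF := ?f))"
    by (rule big_Nat_eq) (use o(2) b in \<open>auto simp: st_def fun_eq_iff\<close>)
  have 4: "big w (Zero rA) ((st p q d)(rA := p + ?l + length (enc_nat (ns ! j)), rF := ?f)) [] ((st p q d)(rF := ?f))"
    by (rule big_Zero) (auto simp: st_def fun_eq_iff)
  have 5: "big w (Cond rF {3} c1 (Seq (Zero rF) c2)) ((st p q d)(rF := ?f)) out (st p q d)"
  proof (cases "b = ns ! j")
    case True
    then have "(st p q d)(rF := ?f) = st p q d" by (auto simp: st_def fun_eq_iff)
    then show ?thesis using c1[OF True] by (auto intro!: big_CondT simp: st_def)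
  next
    case False
    have "big w (Zero rF) ((st p q d)(rF := ?f)) [] (st p q d)"
      by (rule big_Zero) (auto simp: st_def fun_eq_iff)
    from big_Seq[OF this c2[OF False]] show ?thesis using False by (auto intro!: big_CondF)
  qed
  show ?thesis unfolding Test_def
    by (rule big_Seq'[OF 1 big_Seq'[OF 2 big_Seq'[OF 3 big_Seq'[OF 4 5]]]]) auto
qed

definition Test_reg :: "nat \<Rightarrow> com \<Rightarrow> com \<Rightarrow> com" where
  "Test_reg j c1 c2 = Seq (Copy rB rQ rT) (Test j c1 c2)"

lemma big_Test_reg:
  assumes "occurs w p (concat (map enc_nat ns))" "j < length ns" "p \<le> Suc (length w)" "q \<le> Suc (length w)"
    "q = ns ! j \<Longrightarrow> big w c1 (st p q d) out (st p q d)"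
    "q \<noteq> ns ! j \<Longrightarrow> big w c2 (st p q d) out (st p q d)"
  shows "big w (Test_reg j c1 c2) (st p q d) out (st p q d)"
proof -
  have 1: "big w (Copy rB rQ rT) (st p q d) [] ((st p q d)(rB := q))"
    by (rule big_Copy) (use assms(4) in \<open>auto simp: st_def fun_eq_iff\<close>)
  show ?thesis unfolding Test_reg_def
    by (rule big_Seq'[OF 1 big_Test[OF assms]]) auto
qed

definition Test_const :: "nat \<Rightarrow> nat \<Rightarrow> com \<Rightarrow> com \<Rightarrow> com" where
  "Test_const k j c1 c2 = Seq (Seqs (replicate k (Inc rB))) (Test j c1 c2)"

lemma big_Incs:
  assumes "s r + k \<le> Suc (length w)"
  shows "big w (Seqs (replicate k (Inc r))) s [] (s(r := s r + k))"
  using assms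
proof (induction k arbitrary: s)
  case 0
  then show ?case by (simp add: Seqs_def big_Skip)
next
  case (Suc k)
  have 1: "big w (Inc r) s [] (s(r := Suc (s r)))" by (rule big_Inc') (use Suc.prems in auto)
  have 2: "big w (Seqs (replicate k (Inc r))) (s(r := Suc (s r))) [] (s(r := s r + Suc k))"
    using Suc.IH[of "s(r := Suc (s r))"] Suc.prems
    by (simp only: fun_upd_same fun_upd_upd add_Suc add_Suc_right)
  show ?case using big_Seq[OF 1 2] by (simp add: Seqs_def del: fun_upd_apply)
qed

lemma big_Test_const:
  assumes "occurs w p (concat (map enc_nat ns))" "j < length ns" "p \<le> Suc (length w)" "k \<le> Suc (length w)"
    "k = ns ! j \<Longrightarrow> big w c1 (st p q d) out (st p q d)"
    "k \<noteq> ns ! j \<Longrightarrow> big w c2 (st p q d) out (st p q d)"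
  shows "big w (Test_const k j c1 c2) (st p q d) out (st p q d)"
proof -
  have 1: "big w (Seqs (replicate k (Inc rB))) (st p q d) [] ((st p q d)(rB := k))"
    using big_Incs[of "st p q d" rB k w] assms(4) by (simp add: st_def)
  show ?thesis unfolding Test_const_def
    by (rule big_Seq'[OF 1 big_Test[OF assms]]) auto
qed

text \<open>The list contains the pairs \<open>(k, j)\<close> such that the number with index \<open>j\<close> must not be \<open>k\<close>.\<close>

fun Test_none :: "(nat \<times> nat) list \<Rightarrow> com \<Rightarrow> com \<Rightarrow> com" where
  "Test_none [] c1 c2 = c1"
| "Test_none ((k, j) # xs) c1 c2 = Test_const k j c2 (Test_none xs c1 c2)"

lemma big_Test_none:
  assumes "occurs w p (concat (map enc_nat ns))" "p \<le> Suc (length w)"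
    "\<And>k j. (k, j) \<in> set xs \<Longrightarrow> j < length ns \<and> k \<le> Suc (length w)"
    "\<forall>(k, j)\<in>set xs. ns ! j \<noteq> k \<Longrightarrow> big w c1 (st p q d) out (st p q d)"
    "\<not> (\<forall>(k, j)\<in>set xs. ns ! j \<noteq> k) \<Longrightarrow> big w c2 (st p q d) out (st p q d)"
  shows "big w (Test_none xs c1 c2) (st p q d) out (st p q d)"
  using assms(3-)
proof (induction xs)
  case (Cons kj xs)
  obtain k j where kj: "kj = (k, j)" by fastforce
  show ?case unfolding kj Test_none.simps
    by (rule big_Test_const[OF assms(1) _ assms(2)]) (use Cons kj in auto)
qed simp

definition Copy_weight :: "nat \<Rightarrow> com" where
  "Copy_weight n = Seq (Copy rA rP rT) (Seq (Seqs (replicate n (Skip_nat rA))) (Seq (Copy_rat rA) (Zero rA)))"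

lemma big_Copy_weight:
  assumes "occurs w p (concat (map enc_nat ns) @ enc_rat x)" "n = length ns" "p \<le> Suc (length w)"
  shows "big w (Copy_weight n) (st p q d) (enc_rat x) (st p q d)"
proof -
  let ?s = "st p q d" and ?l = "length (concat (map enc_nat ns))"
  have 1: "big w (Copy rA rP rT) ?s [] (?s(rA := p))"
    by (rule big_Copy) (use assms in \<open>auto simp: st_def fun_eq_iff\<close>)
  have 2: "big w (Seqs (replicate n (Skip_nat rA))) (?s(rA := p)) [] (?s(rA := p + ?l))"
    using big_Skip_nats[of w "?s(rA := p)" rA ns] assms by simp
  have 3: "big w (Copy_rat rA) (?s(rA := p + ?l)) (enc_rat x) (?s(rA := p + ?l + length (enc_rat x)))"
    by (rule big_Copy_rat) (use assms in auto)
  have 4: "big w (Zero rA) (?s(rA := p + ?l + length (enc_rat x))) [] ?s"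
    by (rule big_Zero) (auto simp: st_def fun_eq_iff)
  show ?thesis unfolding Copy_weight_def
    by (rule big_Seq'[OF 1 big_Seq'[OF 2 big_Seq'[OF 3 4]]]) auto
qed

text \<open>The number of nodes in a block is a constant, so the loop over \<open>c\<close> is
  unrolled into the program text. The loop over the earlier blocks depends on the input and counts
  \<open>rD\<close> down while \<open>rQ\<close> goes up.\<close>

definition Block :: "nat \<Rightarrow> (nat \<Rightarrow> com) \<Rightarrow> (nat \<Rightarrow> com) \<Rightarrow> com" where
  "Block K f g = Seqs (map (\<lambda>c. Seq (Copy rD rP rT) (Seq
     (While rD (- {3}) (Seq (f c) (Seq (Dec rD) (Inc rQ)))) (Seq (Zero rQ) (g c)))) [0..<K])"

lemma big_Block:
  assumes p: "p \<le> Suc (length w)"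
    and f: "\<And>c j. c < K \<Longrightarrow> j < p \<Longrightarrow> big w (f c) (st p j (p - j)) (fo c j) (st p j (p - j))"
    and g: "\<And>c. c < K \<Longrightarrow> big w (g c) (st p 0 0) (go c) (st p 0 0)"
  shows "big w (Block K f g) (st p 0 0) (concat (map (\<lambda>c. concat (map (fo c) [0..<p]) @ go c) [0..<K])) (st p 0 0)"
  unfolding Block_def
proof (rule big_Seqs)
  fix c assume "c \<in> set [0..<K]"
  then have c: "c < K" by simp
  have 1: "big w (Copy rD rP rT) (st p 0 0) [] (st p 0 p)"
    by (rule big_Copy) (use p in \<open>auto simp: st_def fun_eq_iff\<close>)
  have 2: "big w (While rD (- {3}) (Seq (f c) (Seq (Dec rD) (Inc rQ)))) (st p 0 p) (concat (map (fo c) [0..<p])) (st p p 0)"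
  proof (rule big_iterate'[where n = p and S = "\<lambda>j. st p j (p - j)" and out = "fo c"])
    fix j assume j: "j < p"
    show "symb w (st p j (p - j) rD) \<in> - {3}" using j by (simp add: st_def)
    have "big w (Dec rD) (st p j (p - j)) [] (st p j (p - Suc j))"
      "big w (Inc rQ) (st p j (p - Suc j)) [] (st p (Suc j) (p - Suc j))"
      using j p by (auto intro!: big_Dec' big_Inc' simp: st_def fun_eq_iff)
    from big_Seq[OF f[OF c j] big_Seq[OF this]]
    show "big w (Seq (f c) (Seq (Dec rD) (Inc rQ))) (st p j (p - j)) (fo c j) (st p (Suc j) (p - Suc j))" by simp
  qed (auto simp: st_def)
  have 3: "big w (Zero rQ) (st p p 0) [] (st p 0 0)"
    by (rule big_Zero) (auto simp: st_def fun_eq_iff)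
  show "big w (Seq (Copy rD rP rT) (Seq (While rD (- {3}) (Seq (f c) (Seq (Dec rD) (Inc rQ))))
      (Seq (Zero rQ) (g c)))) (st p 0 0) (concat (map (fo c) [0..<p]) @ go c) (st p 0 0)"
    by (rule big_Seq'[OF 1 big_Seq'[OF 2 big_Seq'[OF 3 g[OF c]]]]) auto
qed

definition zero_pair :: "bool list" where
  "zero_pair = enc_rat 0 @ enc_rat 0"

definition Zero_block :: "nat \<Rightarrow> com" where
  "Zero_block K = Seq (Block K (\<lambda>_. Emits (concat (replicate K zero_pair))) (\<lambda>c. Emits (concat (replicate c zero_pair)))) (Inc rP)"

lemma big_Zero_block:
  assumes "p \<le> length w"
  shows "big w (Zero_block K) (st p 0 0) (enc_block N K M U None p) (st (Suc p) 0 0)"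
proof -
  have z: "map (enc_pair N M U None p c q) [0..<n] = replicate n zero_pair" for c q n
    by (rule nth_equalityI) (auto simp: enc_pair_def link_def demand_def zero_pair_def)
  have "big w (Block K (\<lambda>_. Emits (concat (replicate K zero_pair))) (\<lambda>c. Emits (concat (replicate c zero_pair))))
     (st p 0 0) (enc_block N K M U None p) (st p 0 0)"
    unfolding enc_block_def z by (rule big_Block) (use assms in \<open>auto intro: big_Emits\<close>)
  moreover have "big w (Inc rP) (st p 0 0) [] (st (Suc p) 0 0)"
    by (rule big_Inc') (use assms in \<open>auto simp: st_def fun_eq_iff\<close>)
  ultimately show ?thesis unfolding Zero_block_def by (rule big_Seq') simp
qed

text \<open>In the record the numbers with index 0 and 1 are the endpoints, index 2 is the length of
  the table of the bijection, and index \<open>3 + i\<close> is the image of \<open>i\<close>. The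
  point of \<open>c'\<close> is the preimage of the point of \<open>c\<close> exactly if no
  \<open>i\<close> is mapped to a \<open>k\<close> for which the two memberships differ.\<close>

definition Edge_other :: "nat \<Rightarrow> nat \<Rightarrow> rat \<Rightarrow> nat \<Rightarrow> com" where
  "Edge_other N K M c = (if c div 2 ^ N = 0
     then Test_reg 0
       (Emits (concat (map (\<lambda>c'. if c' div 2 ^ N = 0 \<and> pts N c' = pts N c then enc_rat M @ enc_rat 0 else zero_pair) [0..<K])))
       (Emits (concat (replicate K zero_pair)))
     else Test_reg 1
       (Seqs (map (\<lambda>c'. if c' div 2 ^ N = 0
          then Test_none [(k, 3 + i). i \<leftarrow> [0..<N], k \<leftarrow> [0..<N], (i \<in> pts N c') \<noteq> (k \<in> pts N c)]
                 (Emits (enc_rat M @ enc_rat 0)) (Emits zero_pair)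
          else Emits zero_pair) [0..<K]))
       (Emits (concat (replicate K zero_pair))))"

definition Edge_own :: "nat \<Rightarrow> nat \<Rightarrow> com" where
  "Edge_own N c = Seqs (map (\<lambda>c'. Seq (if adj N c c' then Copy_weight (3 + N) else Emits (enc_rat 0))
     (if anti N c c' then Copy_weight (3 + N) else Emits (enc_rat 0))) [0..<c])"

definition Edge_block :: "nat \<Rightarrow> nat \<Rightarrow> rat \<Rightarrow> com" where
  "Edge_block N K M = Seq (Block K (Edge_other N K M) (Edge_own N)) (Inc rP)"

lemma big_Edge_block:
  assumes p: "p \<le> length w" and occ: "occurs w p (enc_edge N U e)"
    and perm: "\<And>i. i < N \<Longrightarrow> ug_perm U e i < N" and N: "N \<le> Suc (length w)" and e: "fst e < p" "snd e < p"
  shows "big w (Edge_block N K M) (st p 0 0) (enc_block N K M U (Some e) p) (st (Suc p) 0 0)"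
proof -
  define ns where "ns = [fst e, snd e, N] @ map (ug_perm U e) [0..<N]"
  have occ': "occurs w p (concat (map enc_nat ns) @ enc_rat (ug_wt U e))"
    using occ by (simp add: enc_edge_conv ns_def)
  then have occ1: "occurs w p (concat (map enc_nat ns))" by simp
  have len: "length ns = 3 + N" by (simp add: ns_def)
  have nth: "ns ! 0 = fst e" "ns ! 1 = snd e" "\<And>i. i < N \<Longrightarrow> ns ! (3 + i) = ug_perm U e i"
    by (auto simp: ns_def)
  have z: "concat (map (enc_pair N M U (Some e) p c q) [0..<n]) = concat (replicate n zero_pair)"
    if "\<And>c'. c' < n \<Longrightarrow> link N M U (Some e) p c q c' = 0" "q \<noteq> p" for c q n
    by (rule arg_cong[of _ _ concat], rule nth_equalityI)
       (use that in \<open>auto simp: enc_pair_def demand_def zero_pair_def\<close>)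
  have other: "big w (Edge_other N K M c) (st p q d) (concat (map (enc_pair N M U (Some e) p c q) [0..<K])) (st p q d)"
    if q: "q < p" for c q d
  proof (cases "c div 2 ^ N = 0")
    case True
    have "big w (Test_reg 0
       (Emits (concat (map (\<lambda>c'. if c' div 2 ^ N = 0 \<and> pts N c' = pts N c then enc_rat M @ enc_rat 0 else zero_pair) [0..<K])))
       (Emits (concat (replicate K zero_pair)))) (st p q d) (concat (map (enc_pair N M U (Some e) p c q) [0..<K])) (st p q d)"
    proof (rule big_Test_reg[OF occ1])
      assume "q = ns ! 0"
      then have "map (enc_pair N M U (Some e) p c q) [0..<K] =
         map (\<lambda>c'. if c' div 2 ^ N = 0 \<and> pts N c' = pts N c then enc_rat M @ enc_rat 0 else zero_pair) [0..<K]"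
        using True q nth by (auto simp: enc_pair_def link_def demand_def zero_pair_def)
      then show "big w (Emits (concat (map (\<lambda>c'. if c' div 2 ^ N = 0 \<and> pts N c' = pts N c then enc_rat M @ enc_rat 0 else zero_pair) [0..<K])))
         (st p q d) (concat (map (enc_pair N M U (Some e) p c q) [0..<K])) (st p q d)"
        by (simp only: big_Emits)
    next
      assume "q \<noteq> ns ! 0"
      then show "big w (Emits (concat (replicate K zero_pair)))
         (st p q d) (concat (map (enc_pair N M U (Some e) p c q) [0..<K])) (st p q d)"
        using True q nth by (subst z) (auto simp: link_def big_Emits)
    qed (use p q len in auto)
    then show ?thesis using True by (simp add: Edge_other_def)
  next
    case False
    have "big w (Test_reg 1
       (Seqs (map (\<lambda>c'. if c' div 2 ^ N = 0
          then Test_none [(k, 3 + i). i \<leftarrow> [0..<N], k \<leftarrow> [0..<N], (i \<in> pts N c') \<noteq> (k \<in> pts N c)]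
                 (Emits (enc_rat M @ enc_rat 0)) (Emits zero_pair)
          else Emits zero_pair) [0..<K]))
       (Emits (concat (replicate K zero_pair)))) (st p q d) (concat (map (enc_pair N M U (Some e) p c q) [0..<K])) (st p q d)"
    proof (rule big_Test_reg[OF occ1])
      assume qe: "q = ns ! 1"
      show "big w (Seqs (map (\<lambda>c'. if c' div 2 ^ N = 0
          then Test_none [(k, 3 + i). i \<leftarrow> [0..<N], k \<leftarrow> [0..<N], (i \<in> pts N c') \<noteq> (k \<in> pts N c)]
                 (Emits (enc_rat M @ enc_rat 0)) (Emits zero_pair)
          else Emits zero_pair) [0..<K])) (st p q d) (concat (map (enc_pair N M U (Some e) p c q) [0..<K])) (st p q d)"
      proof (rule big_Seqs)
        fix c'
        let ?xs = "[(k, 3 + i). i \<leftarrow> [0..<N], k \<leftarrow> [0..<N], (i \<in> pts N c') \<noteq> (k \<in> pts N c)]"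
        have "(\<forall>(k, j)\<in>set ?xs. ns ! j \<noteq> k) \<longleftrightarrow>
            (\<forall>i<N. \<forall>k<N. (i \<in> pts N c') \<noteq> (k \<in> pts N c) \<longrightarrow> ug_perm U e i \<noteq> k)"
          using nth(3) by fastforce
        \<comment> \<open>The image of \<open>i\<close> is itself one of the tested values
          \<open>k\<close>, so excluding all mismatches forces agreement.\<close>
        also have "\<dots> \<longleftrightarrow> (\<forall>i<N. i \<in> pts N c' \<longleftrightarrow> ug_perm U e i \<in> pts N c)"
          using perm by blast
        also have "\<dots> \<longleftrightarrow> pts N c' = {i. i < N \<and> ug_perm U e i \<in> pts N c}"
          by (auto simp: pts_def)
        finally have iff: "(\<forall>(k, j)\<in>set ?xs. ns ! j \<noteq> k) \<longleftrightarrow> pts N c' = {i. i < N \<and> ug_perm U e i \<in> pts N c}" .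
        have pair: "enc_pair N M U (Some e) p c q c' = (if c' div 2 ^ N = 0 \<and>
           pts N c' = {i. i < N \<and> ug_perm U e i \<in> pts N c} then enc_rat M @ enc_rat 0 else zero_pair)"
          using False q qe nth by (auto simp: enc_pair_def link_def demand_def zero_pair_def)
        show "big w (if c' div 2 ^ N = 0 then Test_none ?xs (Emits (enc_rat M @ enc_rat 0)) (Emits zero_pair)
          else Emits zero_pair) (st p q d) (enc_pair N M U (Some e) p c q c') (st p q d)"
        proof (cases "c' div 2 ^ N = 0")
          case True
          have "big w (Test_none ?xs (Emits (enc_rat M @ enc_rat 0)) (Emits zero_pair)) (st p q d)
             (enc_pair N M U (Some e) p c q c') (st p q d)"
            by (rule big_Test_none[OF occ1]; (unfold iff)?) (use p N len True pair in \<open>auto simp: big_Emits\<close>)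
          then show ?thesis using True by simp
        next
          case False
          then show ?thesis using pair by (simp add: big_Emits)
        qed
      qed
    next
      assume "q \<noteq> ns ! 1"
      then show "big w (Emits (concat (replicate K zero_pair)))
         (st p q d) (concat (map (enc_pair N M U (Some e) p c q) [0..<K])) (st p q d)"
        using False q nth by (subst z) (auto simp: link_def big_Emits)
    qed (use p q len in auto)
    then show ?thesis using False by (simp add: Edge_other_def)
  qed
  have cw: "big w (Copy_weight (3 + N)) (st p 0 0) (enc_rat (ug_wt U e)) (st p 0 0)"
    by (rule big_Copy_weight[OF occ']) (use p len in auto)
  have own: "big w (Edge_own N c) (st p 0 0) (concat (map (enc_pair N M U (Some e) p c p) [0..<c])) (st p 0 0)" for c
    unfolding Edge_own_def
  proof (rule big_Seqs)
    fix c'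
    show "big w (Seq (if adj N c c' then Copy_weight (3 + N) else Emits (enc_rat 0))
     (if anti N c c' then Copy_weight (3 + N) else Emits (enc_rat 0))) (st p 0 0) (enc_pair N M U (Some e) p c p c') (st p 0 0)"
      unfolding enc_pair_def link_def demand_def
      using cw by (intro big_Seq) (auto simp: big_Emits)
  qed
  have "big w (Block K (Edge_other N K M) (Edge_own N)) (st p 0 0) (enc_block N K M U (Some e) p) (st p 0 0)"
    unfolding enc_block_def by (rule big_Block) (use p other own in auto)
  moreover have "big w (Inc rP) (st p 0 0) [] (st (Suc p) 0 0)"
    by (rule big_Inc') (use p in \<open>auto simp: st_def fun_eq_iff\<close>)
  ultimately show ?thesis unfolding Edge_block_def by (rule big_Seq') simp
qed

text \<open>Meant for numbers inside which no record starts: each position passed yields a zero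
  block.\<close>

definition Skip_nat_blocks :: "nat \<Rightarrow> com" where
  "Skip_nat_blocks K = Seq (While rP {2} (Seq (Zero_block K) (Zero_block K))) (Zero_block K)"

text \<open>The edge block is emitted at the first position of the record, which is also the first
  bit of an encoded number. The case distinction resumes that number in the middle: a bit
  \<open>False\<close> ends it, a bit \<open>True\<close> is followed by a data bit and the rest.
  After it come \<open>2 + N\<close> more numbers, the sign bit and the two parts of the rational
  weight.\<close>

definition Edge_blocks :: "nat \<Rightarrow> nat \<Rightarrow> rat \<Rightarrow> com" where
  "Edge_blocks N K M = Seq
     (Cond rP {2} (Seq (Edge_block N K M) (Seq (Zero_block K) (Skip_nat_blocks K))) (Edge_block N K M))
     (Seq (Seqs (replicate (2 + N) (Skip_nat_blocks K)))
     (Seq (Zero_block K) (Seq (Skip_nat_blocks K) (Skip_nat_blocks K))))"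

text \<open>The vertex count is \<open>length w + 1\<close> times a power of two. Codes start with
  the least significant bit, so its code consists of \<open>k\<close> fixed pairs followed by the
  code of \<open>length w + 1\<close>. That number is the position of the blank after the input,
  where \<open>rB\<close> stops.\<close>

definition Reduction :: "nat \<Rightarrow> nat \<Rightarrow> rat \<Rightarrow> rat \<Rightarrow> rat \<Rightarrow> com" where
  "Reduction N k M B \<alpha> =
     Seq (While rB (- {0}) (Inc rB)) (Seq (Emits (concat (replicate k [True, False])))
     (Seq (Emit_binary rB rH rG) (Seq (Zero_block (2 ^ k)) (Seq (While rP {2} (Zero_block (2 ^ k)))
     (Seq (Zero_block (2 ^ k)) (Seq (Skip_nat_blocks (2 ^ k)) (Seq (While rP (- {0}) (Edge_blocks N (2 ^ k) M))
     (Emits (enc_rat B @ enc_rat \<alpha>)))))))))"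

section \<open>Correctness of the program on encoded instances\<close>

locale output_blocks =
  fixes N K :: nat and M :: rat and U :: ug and w :: "bool list" and oe :: "nat \<Rightarrow> (nat \<times> nat) option"
begin

definition rows :: "nat \<Rightarrow> nat \<Rightarrow> bool list" where
  "rows a b = concat (map (\<lambda>p. enc_block N K M U (oe p) p) [a..<b])"

text \<open>The output is determined by the positions passed, so a run can be followed through
  \<open>rP\<close> alone.\<close>

definition adv :: "com \<Rightarrow> nat \<Rightarrow> nat \<Rightarrow> bool" where
  "adv c p p' \<longleftrightarrow> p \<le> p' \<and> big w c (st p 0 0) (rows p p') (st p' 0 0)"

lemma rows_append: "a \<le> b \<Longrightarrow> b \<le> c \<Longrightarrow> rows a b @ rows b c = rows a c"
  using upt_add_eq_append[of a b "c - b"] by (simp add: rows_def flip: concat_append map_append)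

lemma rows_iterate:
  assumes "\<And>j. j < n \<Longrightarrow> f j \<le> f (Suc j)"
  shows "concat (map (\<lambda>j. rows (f j) (f (Suc j))) [0..<n]) = rows (f 0) (f n) \<and> f 0 \<le> f n"
  using assms
proof (induction n)
  case 0
  then show ?case by (simp add: rows_def)
next
  case (Suc n)
  then have "f 0 \<le> f n" "f n \<le> f (Suc n)" by auto
  then show ?case using Suc rows_append[of "f 0" "f n" "f (Suc n)"] le_trans[of "f 0" "f n" "f (Suc n)"] by auto
qed

lemma adv_Seq: "adv c p p' \<Longrightarrow> adv d p' p'' \<Longrightarrow> adv (Seq c d) p p''"
  by (auto simp: adv_def rows_append intro!: big_Seq'[of w c _ "rows p p'"])

lemma adv_While:
  assumes "\<And>j. j < n \<Longrightarrow> symb w (f j) \<in> A \<and> adv c (f j) (f (Suc j))" "symb w (f n) \<notin> A"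
  shows "adv (While rP A c) (f 0) (f n)"
proof -
  have "big w (While rP A c) (st (f 0) 0 0) (concat (map (\<lambda>j. rows (f j) (f (Suc j))) [0..<n])) (st (f n) 0 0)"
    by (rule big_iterate'[where S = "\<lambda>j. st (f j) 0 0"]) (use assms in \<open>auto simp: st_def adv_def\<close>)
  moreover have "concat (map (\<lambda>j. rows (f j) (f (Suc j))) [0..<n]) = rows (f 0) (f n) \<and> f 0 \<le> f n"
    by (rule rows_iterate) (use assms in \<open>auto simp: adv_def\<close>)
  ultimately show ?thesis by (simp add: adv_def)
qed

lemma adv_Zero_block: "p \<le> length w \<Longrightarrow> oe p = None \<Longrightarrow> adv (Zero_block K) p (Suc p)"
  using big_Zero_block[of p w K N M U] by (simp add: adv_def rows_def)

lemma adv_Skip_nat_blocks: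
  assumes occ: "occurs w p (delimited bs)" and none: "\<And>i. p \<le> i \<Longrightarrow> i < p + length (delimited bs) \<Longrightarrow> oe i = None"
  shows "adv (Skip_nat_blocks K) p (p + length (delimited bs))"
proof -
  note d = occurs_delimited[OF occ]
  have le: "p + 2 * j \<le> length w \<and> Suc (p + 2 * j) \<le> length w" if "j < length bs" for j
    using d(1,2)[OF that] symb_bit_le[of w] by metis
  have "adv (While rP {2} (Seq (Zero_block K) (Zero_block K))) (p + 2 * 0) (p + 2 * length bs)"
  proof (rule adv_While)
    fix j assume j: "j < length bs"
    have "adv (Zero_block K) (p + 2 * j) (Suc (p + 2 * j))"
      "adv (Zero_block K) (Suc (p + 2 * j)) (Suc (Suc (p + 2 * j)))"
      using le[OF j] j by (auto intro!: adv_Zero_block none)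
    then show "symb w (p + 2 * j) \<in> {2} \<and> adv (Seq (Zero_block K) (Zero_block K)) (p + 2 * j) (p + 2 * Suc j)"
      using d(1)[OF j] adv_Seq by simp
  qed (use d(3) in simp)
  moreover have "adv (Zero_block K) (p + 2 * length bs) (Suc (p + 2 * length bs))"
    using d(3) symb_bit_le[of w "p + 2 * length bs"] by (auto intro!: adv_Zero_block none)
  ultimately show ?thesis unfolding Skip_nat_blocks_def using adv_Seq by simp
qed

lemma adv_Skip_nats:
  assumes "occurs w p (concat (map enc_nat ns))"
    "\<And>i. p \<le> i \<Longrightarrow> i < p + length (concat (map enc_nat ns)) \<Longrightarrow> oe i = None"
  shows "adv (Seqs (replicate (length ns) (Skip_nat_blocks K))) p (p + length (concat (map enc_nat ns)))"
  using assms
proof (induction ns arbitrary: p)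
  case Nil
  then show ?case by (simp add: Seqs_def adv_def rows_def big_Skip)
next
  case (Cons n ns)
  have 1: "adv (Skip_nat_blocks K) p (p + length (enc_nat n))"
    unfolding enc_nat_def by (rule adv_Skip_nat_blocks) (use Cons.prems in \<open>auto simp: enc_nat_def\<close>)
  have 2: "adv (Seqs (replicate (length ns) (Skip_nat_blocks K))) (p + length (enc_nat n))
      (p + length (enc_nat n) + length (concat (map enc_nat ns)))"
    by (rule Cons.IH) (use Cons.prems in auto)
  show ?case using adv_Seq[OF 1 2] by (simp add: Seqs_def add.assoc)
qed

lemma adv_Edge_blocks:
  assumes occ: "occurs w p (enc_edge N U e)" and e: "oe p = Some e"
    and none: "\<And>i. p < i \<Longrightarrow> i < p + length (enc_edge N U e) \<Longrightarrow> oe i = None"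
    and perm: "\<And>i. i < N \<Longrightarrow> ug_perm U e i < N" and N: "N \<le> Suc (length w)" and ends: "fst e < p" "snd e < p"
  shows "adv (Edge_blocks N K M) p (p + length (enc_edge N U e))"
proof -
  let ?ns = "[snd e, N] @ map (ug_perm U e) [0..<N]"
  let ?l1 = "length (enc_nat (fst e))" and ?l2 = "length (concat (map enc_nat ?ns))"
  obtain a b where ab: "quotient_of (ug_wt U e) = (a, b)" by fastforce
  let ?u = "delimited (binary (nat \<bar>a\<bar>))" and ?v = "delimited (binary (nat b))"
  have conv: "enc_edge N U e = enc_nat (fst e) @ concat (map enc_nat ?ns) @ [a < 0] @ ?u @ ?v"
    by (simp add: enc_edge_conv enc_rat_def ab enc_nat_def)
  have oc: "occurs w p (enc_nat (fst e))" "occurs w (p + ?l1) (concat (map enc_nat ?ns))"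
    "occurs w (p + ?l1 + ?l2) [a < 0]" "occurs w (Suc (p + ?l1 + ?l2)) ?u"
    "occurs w (Suc (p + ?l1 + ?l2) + length ?u) ?v"
    using occ unfolding conv occurs_append by (auto simp only: length_append list.size add.assoc add_Suc_right add_Suc add_0 add_0_right)
  have len: "length (enc_edge N U e) = ?l1 + ?l2 + 1 + length ?u + length ?v"
    unfolding conv by (simp only: length_append list.size)
  have le: "p \<le> length w"
    using oc(1) symb_bit_le[of w p] length_enc_nat_pos[of "fst e"]
    by (cases "enc_nat (fst e)") (auto split: if_splits)
  have eb: "adv (Edge_block N K M) p (Suc p)"
    using big_Edge_block[OF le occ perm N ends, of K M] e by (simp add: adv_def rows_def)
  have 1: "adv (Cond rP {2} (Seq (Edge_block N K M) (Seq (Zero_block K) (Skip_nat_blocks K))) (Edge_block N K M)) p (p + ?l1)"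
  proof (cases "binary (fst e)")
    case Nil
    then have "symb w p \<notin> {2}" "?l1 = 1" using oc(1) by (auto simp: enc_nat_def)
    then show ?thesis using eb by (auto simp: adv_def st_def intro!: big_CondF)
  next
    case (Cons b bs)
    then have en: "enc_nat (fst e) = True # b # delimited bs" by (simp add: enc_nat_def)
    have "Suc p \<le> length w" using oc(1) symb_bit_le[of w "Suc p"] en by (auto split: if_splits)
    then have "adv (Zero_block K) (Suc p) (Suc (Suc p))"
      by (intro adv_Zero_block none) (auto simp: len en)
    moreover have "adv (Skip_nat_blocks K) (Suc (Suc p)) (Suc (Suc p) + length (delimited bs))"
      by (rule adv_Skip_nat_blocks) (use oc(1) len in \<open>auto simp: en intro!: none\<close>)
    ultimately have "adv (Seq (Edge_block N K M) (Seq (Zero_block K) (Skip_nat_blocks K))) p (p + ?l1)"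
      using adv_Seq[OF eb adv_Seq] by (simp add: en)
    moreover have "symb w p \<in> {2}" using oc(1) en by auto
    ultimately show ?thesis by (auto simp: adv_def st_def intro!: big_CondT)
  qed
  have "adv (Seqs (replicate (length ?ns) (Skip_nat_blocks K))) (p + ?l1) (p + ?l1 + ?l2)"
  proof (rule adv_Skip_nats[OF oc(2)])
    fix i assume "p + ?l1 \<le> i" "i < p + ?l1 + ?l2"
    then show "oe i = None" using len length_enc_nat_pos[of "fst e"] by (intro none) linarith+
  qed
  then have 2: "adv (Seqs (replicate (2 + N) (Skip_nat_blocks K))) (p + ?l1) (p + ?l1 + ?l2)"
    by simp
  have 3: "adv (Zero_block K) (p + ?l1 + ?l2) (Suc (p + ?l1 + ?l2))"
    by (rule adv_Zero_block; (rule none)?)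
       (use oc(3) symb_bit_le[of w "p + ?l1 + ?l2"] len length_enc_nat_pos[of "fst e"] in \<open>auto split: if_splits\<close>)
  have 4: "adv (Skip_nat_blocks K) (Suc (p + ?l1 + ?l2)) (Suc (p + ?l1 + ?l2) + length ?u)"
    by (rule adv_Skip_nat_blocks[OF oc(4)], rule none) (use len in auto)
  have 5: "adv (Skip_nat_blocks K) (Suc (p + ?l1 + ?l2) + length ?u) (Suc (p + ?l1 + ?l2) + length ?u + length ?v)"
    by (rule adv_Skip_nat_blocks[OF oc(5)], rule none) (use len in auto)
  have "p + length (enc_edge N U e) = Suc (p + ?l1 + ?l2) + length ?u + length ?v"
    unfolding len by linarith
  then show ?thesis unfolding Edge_blocks_def
    using adv_Seq[OF 1 adv_Seq[OF 2 adv_Seq[OF 3 adv_Seq[OF 4 5]]]] by (simp only:)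
qed

end

lemma enc_nat_double: "0 < n \<Longrightarrow> enc_nat (2 * n) = [True, False] @ enc_nat n"
  by (simp add: enc_nat_def binary.simps[of "2 * n"])

lemma enc_nat_pow2: "0 < n \<Longrightarrow> enc_nat (n * 2 ^ k) = concat (replicate k [True, False]) @ enc_nat n"
proof (induction k)
  case (Suc k)
  then show ?case using enc_nat_double[of "n * 2 ^ k"] by (simp add: mult_ac)
qed simp

lemma occurs_edges:
  assumes "occurs w p (concat (map f xs))" "i < length xs"
  shows "occurs w (p + length (concat (map f (take i xs)))) (f (xs ! i))"
proof -
  have "xs = take i xs @ [xs ! i] @ drop (Suc i) xs" using assms(2) by (simp add: id_take_nth_drop)
  then have "map f xs = map f (take i xs) @ [f (xs ! i)] @ map f (drop (Suc i) xs)"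
    by (metis list.simps(8,9) map_append)
  then have "concat (map f xs) = concat (map f (take i xs)) @ f (xs ! i) @ concat (map f (drop (Suc i) xs))"
    by (simp only: concat_append concat.simps append_Nil2)
  then show ?thesis using assms(1) by (simp only: occurs_append)
qed

lemma length_concat_ge: "(\<And>x. x \<in> set xs \<Longrightarrow> 0 < length (f x)) \<Longrightarrow> length xs \<le> length (concat (map f xs))"
proof (induction xs)
  case (Cons x xs)
  have "0 < length (f x)" "length xs \<le> length (concat (map f xs))" using Cons by auto
  then show ?case by (simp only: list.map concat.simps length_append list.size)
qed simp

lemma big_Reduction:
  assumes wf: "wf_ug N U"
  shows "\<exists>s'. big (enc_ug N U) (Reduction N k M B \<alpha>) (\<lambda>_. 0) (enc_reduction N (2 ^ k) M B \<alpha> U) s'"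
proof -
  let ?w = "enc_ug N U" and ?n = "ug_size U" and ?es = "ug_edges U"
  interpret output_blocks N "2 ^ k" M U ?w "edge_at N U" .
  let ?m = "enc_nat (length ?es)"
  have "occurs ?w 1 (replicate ?n True @ [False] @ ?m @ concat (map (enc_edge N U) ?es))"
    using occurs_self[of ?w] by (simp only: enc_ug_conv[symmetric])
  then have oc: "occurs ?w 1 (replicate ?n True)" "occurs ?w (Suc ?n) [False]" "occurs ?w (Suc (Suc ?n)) ?m"
     "occurs ?w (Suc (Suc ?n) + length ?m) (concat (map (enc_edge N U) ?es))"
    unfolding occurs_append by (auto simp: add.commute)
  have unary: "symb ?w (Suc j) = 2" if "j < ?n" for j
    using oc(1) that by (auto simp: occurs_def)
  have s0: "edge_starts N U 0 = Suc (Suc ?n) + length ?m" by (simp add: edge_starts_def)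
  \<comment> \<open>The last record ends where the blank begins, and this blank stops the loop over
    the records.\<close>
  have send: "edge_starts N U (length ?es) = Suc (length ?w)"
    by (simp add: edge_starts_def enc_ug_conv)
  have none: "edge_at N U p = None" if "p < Suc (Suc ?n) + length ?m" for p
    using that s0 by (intro edge_at_before) simp
  have st0: "(\<lambda>_. 0) = st 0 0 0" by (auto simp: st_def)
  have 1: "big ?w (While rB (- {0}) (Inc rB)) (\<lambda>_. 0) [] ((st 0 0 0)(rB := Suc (length ?w)))"
    unfolding st0
    by (rule big_iterate'[where n = "Suc (length ?w)" and S = "\<lambda>j. (st 0 0 0)(rB := j)" and out = "\<lambda>_. []"])
       (auto simp: symb_eq_0 st_def fun_eq_iff intro!: big_Inc')
  have 2: "big ?w (Emit_binary rB rH rG) ((st 0 0 0)(rB := Suc (length ?w))) (enc_nat (Suc (length ?w))) (st 0 0 0)"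
    using big_Emit_binary[of rB rH rG "(st 0 0 0)(rB := Suc (length ?w))" ?w "st 0 0 0"]
    by (simp add: st_def fun_eq_iff)
  have 3: "adv (Zero_block (2 ^ k)) 0 (Suc 0)"
    by (rule adv_Zero_block) (auto intro: none)
  have 4: "adv (While rP {2} (Zero_block (2 ^ k))) (Suc 0) (Suc ?n)"
  proof (rule adv_While[of ?n Suc])
    fix j assume j: "j < ?n"
    then show "symb ?w (Suc j) \<in> {2} \<and> adv (Zero_block (2 ^ k)) (Suc j) (Suc (Suc j))"
      using unary[OF j] symb_bit_le[of ?w "Suc j"] by (auto intro!: adv_Zero_block none)
  qed (use oc(2) in auto)
  have 5: "adv (Zero_block (2 ^ k)) (Suc ?n) (Suc (Suc ?n))"
    by (rule adv_Zero_block) (use oc(2) symb_bit_le[of ?w "Suc ?n"] in \<open>auto intro!: none\<close>)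
  have 6: "adv (Skip_nat_blocks (2 ^ k)) (Suc (Suc ?n)) (edge_starts N U 0)"
    unfolding s0 enc_nat_def
    by (rule adv_Skip_nat_blocks) (use oc(3) in \<open>auto simp: enc_nat_def intro!: none\<close>)
  have 7: "adv (While rP (- {0}) (Edge_blocks N (2 ^ k) M)) (edge_starts N U 0) (edge_starts N U (length ?es))"
  proof (rule adv_While)
    fix i assume i: "i < length ?es"
    let ?e = "?es ! i" and ?p = "edge_starts N U i"
    have e: "?e \<in> set ?es" using i by simp
    have oe: "occurs ?w ?p (enc_edge N U ?e)"
      using occurs_edges[OF oc(4) i] by (simp add: edge_starts_def)
    have "\<forall>x\<in>set ?es. fst x < ug_size U \<and> snd x < ug_size U"
      using wf by (auto simp: wf_ug_def)
    moreover have "ug_size U < ?p" by (simp add: edge_starts_def)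
    ultimately have ends: "fst ?e < ?p" "snd ?e < ?p" using e by fastforce+
    have "bij_betw (ug_perm U ?e) {..<N} {..<N}" using wf e by (simp add: wf_ug_def)
    then have perm: "ug_perm U ?e j < N" if "j < N" for j
      using that bij_betwE by fastforce
    have "?p + length (enc_edge N U ?e) \<le> Suc (length ?w)"
      using edge_starts_Suc[OF i] send edge_starts_mono[of "Suc i" "length ?es" U N] i
      by (cases "Suc i = length ?es") auto
    moreover have "N \<le> length (enc_edge N U ?e)"
      using length_concat_ge[of "map (ug_perm U ?e) [0..<N]" enc_nat] length_enc_nat_pos
      by (simp add: enc_edge_conv)
    ultimately have N: "N \<le> Suc (length ?w)" and lt: "?p \<le> length ?w"
      using length_enc_edge_pos[of N U ?e] by linarith+
    have "adv (Edge_blocks N (2 ^ k) M) ?p (?p + length (enc_edge N U ?e))"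
      by (rule adv_Edge_blocks[OF oe edge_at_start[OF i] _ perm N ends], rule edge_at_inside[OF i])
         (use edge_starts_Suc[OF i] in auto)
    then show "symb ?w ?p \<in> - {0} \<and> adv (Edge_blocks N (2 ^ k) M) ?p (edge_starts N U (Suc i))"
      using edge_starts_Suc[OF i] lt by (simp add: symb_eq_0)
  qed (simp add: send symb_eq_0)
  have B: "big ?w (Seq c d) s (o1 @ o2) s2" if "adv c p p'" "big ?w d (st p' 0 0) o2 s2" "s = st p 0 0" "o1 = rows p p'"
    for c d s s2 p p' o1 o2
    using that by (auto simp: adv_def intro: big_Seq)
  let ?t = "enc_rat B @ enc_rat \<alpha>"
  have "big ?w (Reduction N k M B \<alpha>) (\<lambda>_. 0) ([] @ concat (replicate k [True, False]) @ enc_nat (Suc (length ?w)) @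
     rows 0 (Suc 0) @ rows (Suc 0) (Suc ?n) @ rows (Suc ?n) (Suc (Suc ?n)) @ rows (Suc (Suc ?n)) (edge_starts N U 0) @
     rows (edge_starts N U 0) (edge_starts N U (length ?es)) @ ?t) (st (edge_starts N U (length ?es)) 0 0)"
    unfolding Reduction_def
    by (intro big_Seq[OF 1] big_Seq[OF big_Emits] big_Seq[OF 2] B[OF 3] B[OF 4] B[OF 5] B[OF 6] B[OF 7] big_Emits refl)
  also have "rows 0 (Suc 0) @ rows (Suc 0) (Suc ?n) @ rows (Suc ?n) (Suc (Suc ?n)) @ rows (Suc (Suc ?n)) (edge_starts N U 0) @
     rows (edge_starts N U 0) (edge_starts N U (length ?es)) @ ?t = rows 0 (Suc (length ?w)) @ ?t"
    using 3 4 5 6 7 by (simp add: rows_append adv_def send flip: append_assoc)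
  finally have "big ?w (Reduction N k M B \<alpha>) (\<lambda>_. 0) (enc_reduction N (2 ^ k) M B \<alpha> U) (st (edge_starts N U (length ?es)) 0 0)"
    by (simp add: enc_reduction_def rows_def enc_nat_pow2 del: upt_Suc mult_Suc)
  then show ?thesis by blast
qed

section \<open>Boolean functions of bounded total influence\<close>

definition avg :: "nat \<Rightarrow> (nat set \<Rightarrow> real) \<Rightarrow> real" where
  "avg n f = (\<Sum>x\<in>Pow {..<n}. f x) / 2 ^ n"

definition chi :: "nat set \<Rightarrow> nat set \<Rightarrow> real" where
  "chi S x = (- 1) ^ card (S \<inter> x)"

definition low_poly :: "nat \<Rightarrow> nat \<Rightarrow> (nat set \<Rightarrow> real) \<Rightarrow> nat set \<Rightarrow> real" where
  "low_poly n d c x = (\<Sum>S | S \<subseteq> {..<n} \<and> card S \<le> d. c S * chi S x)"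

lemma avg_cong: "(\<And>x. x \<subseteq> {..<n} \<Longrightarrow> f x = g x) \<Longrightarrow> avg n f = avg n g"
  unfolding avg_def by (auto intro!: arg_cong2[where f="(/)"] sum.cong)

lemma avg_mono: "(\<And>x. x \<subseteq> {..<n} \<Longrightarrow> f x \<le> g x) \<Longrightarrow> avg n f \<le> avg n g"
  unfolding avg_def by (auto intro!: divide_right_mono sum_mono)

lemma avg_add: "avg n (\<lambda>x. f x + g x) = avg n f + avg n g"
  by (simp add: avg_def sum.distrib add_divide_distrib)

lemma avg_diff: "avg n (\<lambda>x. f x - g x) = avg n f - avg n g"
  by (simp add: avg_def sum_subtractf diff_divide_distrib)

lemma avg_cmult: "avg n (\<lambda>x. c * f x) = c * avg n f"
  by (simp add: avg_def sum_distrib_left[symmetric])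

lemma avg_halve: "(avg n f + avg n g) / 2 = avg n (\<lambda>x. (f x + g x) / 2)"
  by (simp add: avg_def sum_divide_distrib sum.distrib add_divide_distrib mult.commute)

lemma avg_sum: "avg n (\<lambda>x. \<Sum>i\<in>I. f i x) = (\<Sum>i\<in>I. avg n (f i))"
  by (simp add: avg_def sum_divide_distrib[symmetric] sum.swap[of _ I])

lemma avg_const: "avg n (\<lambda>_. c) = c"
  by (simp add: avg_def card_Pow)

lemma avg_nonneg: "(\<And>x. 0 \<le> f x) \<Longrightarrow> 0 \<le> avg n f"
  by (simp add: avg_def sum_nonneg)

lemma avg_Cauchy_Schwarz: "(avg n (\<lambda>x. f x * g x))\<^sup>2 \<le> avg n (\<lambda>x. (f x)\<^sup>2) * avg n (\<lambda>x. (g x)\<^sup>2)"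
proof -
  have "(\<Sum>x\<in>Pow {..<n}. f x * g x)\<^sup>2 \<le> (\<Sum>x\<in>Pow {..<n}. (f x)\<^sup>2) * (\<Sum>x\<in>Pow {..<n}. (g x)\<^sup>2)"
    by (rule Cauchy_Schwarz_ineq_sum)
  then show ?thesis
    unfolding avg_def by (simp add: power_divide divide_right_mono flip: power2_eq_square)
qed

lemma sum_Pow_Suc:
  "(\<Sum>x\<in>Pow {..<Suc n}. f x) = (\<Sum>x\<in>Pow {..<n}. f x) + (\<Sum>x\<in>Pow {..<n}. f (insert n x))"
    for f :: "nat set \<Rightarrow> 'a::comm_monoid_add"
proof -
  have "inj_on (insert n) (Pow {..<n})"
    by (rule inj_onI) (metis Diff_insert_absorb Pow_iff lessThan_iff nless_le subsetD)
  moreover have "Pow {..<n} \<inter> insert n ` Pow {..<n} = {}"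
    by auto
  ultimately show ?thesis
    by (simp add: lessThan_Suc Pow_insert sum.union_disjoint sum.reindex)
qed

lemma avg_Suc: "avg (Suc n) f = (avg n f + avg n (\<lambda>x. f (insert n x))) / 2"
  by (simp only: avg_def sum_Pow_Suc) (simp add: add_divide_distrib)

section \<open>Hypercontractivity for polynomials of low degree\<close>

lemma low_poly_0: "low_poly n 0 c x = c {}"
proof -
  have "{S. S \<subseteq> {..<n} \<and> card S \<le> 0} = {{}}"
    by (auto dest: finite_subset)
  then show ?thesis by (simp add: low_poly_def chi_def)
qed

lemma low_poly_base: "low_poly 0 d c x = c {}"
proof -
  have "{S. S \<subseteq> {..<0::nat} \<and> card S \<le> d} = {{}}" by auto
  then show ?thesis by (simp add: low_poly_def chi_def)
qed

lemma finite_low: "finite {S. S \<subseteq> {..<n::nat} \<and> card S \<le> d}"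
  by (rule finite_subset[of _ "Pow {..<n}"]) auto

text \<open>A character that involves the new coordinate changes sign with it and has smaller degree
  in the others. This is the decomposition for induction on the dimension.\<close>

lemma low_poly_Suc:
  assumes x: "x \<subseteq> {..<n}"
  shows "low_poly (Suc n) (Suc d) c x = low_poly n (Suc d) c x + low_poly n d (\<lambda>S. c (insert n S)) x"
    and "low_poly (Suc n) (Suc d) c (insert n x) = low_poly n (Suc d) c x - low_poly n d (\<lambda>S. c (insert n S)) x"
proof -
  let ?A = "{S. S \<subseteq> {..<n} \<and> card S \<le> Suc d}" and ?B = "{S. S \<subseteq> {..<n} \<and> card S \<le> d}"
  have split: "{S. S \<subseteq> {..<Suc n} \<and> card S \<le> Suc d} = ?A \<union> insert n ` ?B" (is "?L = ?R")
  proof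
    show "?L \<subseteq> ?R"
    proof
      fix S assume S: "S \<in> ?L"
      show "S \<in> ?R"
      proof (cases "n \<in> S")
        case True
        have "S = insert n (S - {n})" using True by auto
        moreover have "S - {n} \<in> ?B" using S True
          by (auto simp: lessThan_Suc card_Diff_singleton finite_subset)
        ultimately show ?thesis by blast
      next
        case False
        then show ?thesis using S by (auto simp: lessThan_Suc)
      qed
    qed
    show "?R \<subseteq> ?L"
      by (auto simp: lessThan_Suc) (metis card_insert_le_m1 diff_Suc_1 zero_less_Suc finite_lessThan finite_subset)
  qed
  have inj: "inj_on (insert n) ?B"
    by (rule inj_onI) (metis (mono_tags, lifting) Diff_insert_absorb lessThan_iff mem_Collect_eq nless_le subsetD)
  have disj: "?A \<inter> insert n ` ?B = {}" by auto
  have eq: "low_poly (Suc n) (Suc d) c y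
      = (\<Sum>S\<in>?A. c S * chi S y) + (\<Sum>S\<in>?B. c (insert n S) * chi (insert n S) y)" for y
    unfolding low_poly_def split
    using inj disj by (subst sum.union_disjoint) (auto simp: finite_low sum.reindex)
  have n: "n \<notin> x" "n \<notin> S" if "S \<subseteq> {..<n}" for S using x that by auto
  have fin: "finite S" if "S \<subseteq> {..<n}" for S :: "nat set" using that by (rule finite_subset) simp
  have 1: "chi (insert n S) x = chi S x" "chi S (insert n x) = chi S x"
     "chi (insert n S) (insert n x) = - chi S x" if "S \<subseteq> {..<n}" for S
    using n[OF that] fin[OF that] by (auto simp: chi_def)
  show "low_poly (Suc n) (Suc d) c x = low_poly n (Suc d) c x + low_poly n d (\<lambda>S. c (insert n S)) x"
    unfolding eq unfolding low_poly_def by (auto intro!: arg_cong2[where f="(+)"] sum.cong simp: 1)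
  show "low_poly (Suc n) (Suc d) c (insert n x) = low_poly n (Suc d) c x - low_poly n d (\<lambda>S. c (insert n S)) x"
    unfolding eq unfolding low_poly_def
    by (simp add: sum_negf[symmetric] diff_conv_add_uminus del: add_uminus_conv_diff)
       (auto intro!: arg_cong2[where f="(+)"] sum.cong simp: 1)
qed

text \<open>Splitting off the last coordinate writes the polynomial as \<open>h + g\<close> on one
  half of the cube and \<open>h - g\<close> on the other, with \<open>g\<close> of smaller degree.
  The odd mixed moments cancel, and the remaining mixed moment is bounded by the Cauchy-Schwarz
  inequality and both induction hypotheses.\<close>

lemma Bonami:
  "avg n (\<lambda>x. (low_poly n d c x) ^ 4) \<le> 9 ^ d * (avg n (\<lambda>x. (low_poly n d c x)\<^sup>2))\<^sup>2"
proof (induction n arbitrary: d c)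
  case 0
  show ?case
    by (simp add: low_poly_base avg_const flip: power_mult)
       (metis mult_right_mono one_le_power one_le_numeral mult_1 zero_le_power_eq even_numeral)
next
  case (Suc n)
  show ?case
  proof (cases d)
    case 0
    then show ?thesis by (simp add: low_poly_0 avg_const flip: power_mult)
  next
    case (Suc e)
    define h where "h = low_poly n (Suc e) c"
    define g where "g = low_poly n e (\<lambda>S. c (insert n S))"
    define a where "a = avg n (\<lambda>x. (h x)\<^sup>2)"
    define b where "b = avg n (\<lambda>x. (g x)\<^sup>2)"
    have p: "avg (Suc n) (\<lambda>x. F (low_poly (Suc n) d c x)) = (avg n (\<lambda>x. F (h x + g x)) + avg n (\<lambda>x. F (h x - g x))) / 2"
      for F :: "real \<Rightarrow> real"
      unfolding avg_Suc Suc h_def g_def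
      by (auto intro!: arg_cong2[where f="(+)"] avg_cong simp: low_poly_Suc)
    have h4: "avg n (\<lambda>x. (h x) ^ 4) \<le> 9 ^ Suc e * a\<^sup>2" and g4: "avg n (\<lambda>x. (g x) ^ 4) \<le> 9 ^ e * b\<^sup>2"
      unfolding h_def g_def a_def b_def by (rule Suc.IH)+
    have nn: "0 \<le> a" "0 \<le> b" unfolding a_def b_def by (auto intro!: avg_nonneg)
    define m where "m = avg n (\<lambda>x. (h x)\<^sup>2 * (g x)\<^sup>2)"
    have "m\<^sup>2 \<le> avg n (\<lambda>x. (h x) ^ 4) * avg n (\<lambda>x. (g x) ^ 4)"
      using avg_Cauchy_Schwarz[of n "\<lambda>x. (h x)\<^sup>2" "\<lambda>x. (g x)\<^sup>2"] by (simp add: m_def flip: power_mult)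
    also have "\<dots> \<le> (9 ^ Suc e * a\<^sup>2) * (9 ^ e * b\<^sup>2)"
      by (intro mult_mono h4 g4) (auto intro!: avg_nonneg)
    also have "\<dots> = (3 * 9 ^ e * a * b)\<^sup>2"
      by (simp add: power2_eq_square)
    finally have m: "m \<le> 3 * 9 ^ e * a * b"
      by (rule power2_le_imp_le) (use nn in auto)
    have "avg (Suc n) (\<lambda>x. (low_poly (Suc n) d c x) ^ 4)
        = avg n (\<lambda>x. ((h x + g x)^4 + (h x - g x)^4) / 2)"
      unfolding p[of "\<lambda>z. z ^ 4"] by (simp add: avg_halve)
    also have "\<dots> = avg n (\<lambda>x. (h x)^4 + (6 * ((h x)\<^sup>2 * (g x)\<^sup>2) + (g x)^4))"
      by (intro avg_cong) (simp add: field_simps power4_eq_xxxx power2_eq_square)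
    also have "\<dots> = avg n (\<lambda>x. (h x)^4) + (6 * m + avg n (\<lambda>x. (g x)^4))"
      by (simp only: avg_add avg_cmult m_def)
    also have "\<dots> \<le> 9 ^ Suc e * a\<^sup>2 + (6 * (3 * 9 ^ e * a * b) + 9 ^ e * b\<^sup>2)"
      using m by (intro add_mono mult_left_mono h4 g4) simp_all
    \<comment> \<open>The mixed term has coefficient \<open>18 * 9 ^ e\<close> on both sides; the
      slack lies in the term with \<open>b\<^sup>2\<close>.\<close>
    also have "\<dots> \<le> 9 ^ Suc e * (a + b)\<^sup>2"
    proof -
      have "0 \<le> 9 ^ e * b\<^sup>2" by simp
      then show ?thesis by (simp add: power2_eq_square algebra_simps)
    qed
    also have "a + b = avg (Suc n) (\<lambda>x. (low_poly (Suc n) d c x)\<^sup>2)"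
    proof -
      have "avg (Suc n) (\<lambda>x. (low_poly (Suc n) d c x)\<^sup>2)
        = avg n (\<lambda>x. ((h x + g x)\<^sup>2 + (h x - g x)\<^sup>2) / 2)"
        unfolding p[of "\<lambda>z. z\<^sup>2"] by (simp add: avg_halve)
      also have "\<dots> = avg n (\<lambda>x. (h x)\<^sup>2 + (g x)\<^sup>2)"
        by (intro avg_cong) (simp add: field_simps power2_eq_square)
      finally show ?thesis by (simp add: avg_add a_def b_def)
    qed
    finally show ?thesis by (simp add: Suc)
  qed
qed

section \<open>Characters and the Fourier expansion\<close>

lemma chi_commute: "chi S x = chi x S"
  by (simp add: chi_def Int_commute)

lemma chi_mult:
  assumes "finite x" "finite y"
  shows "chi S x * chi S y = chi S (sym_diff x y)"
proof -
  have "S \<inter> sym_diff x y = ((S \<inter> x) - (S \<inter> y)) \<union> ((S \<inter> y) - (S \<inter> x))" by auto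
  moreover have "card (((S \<inter> x) - (S \<inter> y)) \<union> ((S \<inter> y) - (S \<inter> x))) =
     card ((S \<inter> x) - (S \<inter> y)) + card ((S \<inter> y) - (S \<inter> x))"
    using assms by (intro card_Un_disjoint) auto
  moreover have "card (S \<inter> x) = card ((S \<inter> x) - (S \<inter> y)) + card (S \<inter> x \<inter> (S \<inter> y))"
    "card (S \<inter> y) = card ((S \<inter> y) - (S \<inter> x)) + card (S \<inter> x \<inter> (S \<inter> y))"
    using assms card_Diff_subset_Int[of "S \<inter> x" "S \<inter> y"] card_Diff_subset_Int[of "S \<inter> y" "S \<inter> x"]
    by (auto simp: Int_commute intro!: le_add_diff_inverse2[symmetric] card_mono)
  ultimately show ?thesis
    by (simp add: chi_def power_add mult.assoc)
qed

text \<open>An element of a nonempty \<open>z\<close> pairs the sets \<open>S\<close> with and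
  without it, and their signs are opposite.\<close>

lemma sum_chi:
  assumes "z \<subseteq> {..<n}"
  shows "(\<Sum>S\<in>Pow {..<n}. chi S z) = (if z = {} then 2 ^ n else 0)"
  using assms
proof (induction n arbitrary: z)
  case 0
  then show ?case by (simp add: chi_def)
next
  case (Suc n)
  have fin: "finite S" if "S \<subseteq> {..<n}" for S :: "nat set" using that by (rule finite_subset) simp
  show ?case
  proof (cases "n \<in> z")
    case True
    have "chi (insert n S) z = - chi S z" if "S \<subseteq> {..<n}" for S
    proof -
      have "n \<notin> S" using that by auto
      then show ?thesis using True fin[OF that] by (simp add: chi_def)
    qed
    then show ?thesis using True by (auto simp: sum_Pow_Suc sum_negf)
  next
    case False
    then have z: "z \<subseteq> {..<n}" using Suc.prems by (auto simp: lessThan_Suc)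
    show ?thesis using Suc.IH[OF z] False by (simp add: sum_Pow_Suc chi_def)
  qed
qed

definition fourier :: "nat \<Rightarrow> (nat set \<Rightarrow> real) \<Rightarrow> nat set \<Rightarrow> real" where
  "fourier n f S = avg n (\<lambda>x. f x * chi S x)"

lemma fourier_inversion:
  assumes x: "x \<subseteq> {..<n}"
  shows "f x = (\<Sum>S\<in>Pow {..<n}. fourier n f S * chi S x)"
proof -
  have fin: "finite S" if "S \<subseteq> {..<n}" for S :: "nat set" using that by (rule finite_subset) simp
  have "(\<Sum>S\<in>Pow {..<n}. fourier n f S * chi S x)
      = (\<Sum>S\<in>Pow {..<n}. \<Sum>y\<in>Pow {..<n}. f y * (chi S y * chi S x)) / 2 ^ n"
    by (simp add: fourier_def avg_def sum_divide_distrib sum_distrib_right mult.assoc)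
  also have "\<dots> = (\<Sum>y\<in>Pow {..<n}. f y * (\<Sum>S\<in>Pow {..<n}. chi S y * chi S x)) / 2 ^ n"
    by (subst sum.swap) (simp add: sum_distrib_left)
  also have "(\<Sum>y\<in>Pow {..<n}. f y * (\<Sum>S\<in>Pow {..<n}. chi S y * chi S x))
     = (\<Sum>y\<in>Pow {..<n}. if y = x then f y * 2 ^ n else 0)"
  proof (rule sum.cong[OF refl])
    fix y assume y: "y \<in> Pow {..<n}"
    have "(\<Sum>S\<in>Pow {..<n}. chi S y * chi S x) = (\<Sum>S\<in>Pow {..<n}. chi S (sym_diff y x))"
      using x y by (intro sum.cong refl chi_mult) (auto simp: fin)
    also have "\<dots> = (if y = x then 2 ^ n else 0)"
      using x y by (subst sum_chi) auto
    finally show "f y * (\<Sum>S\<in>Pow {..<n}. chi S y * chi S x) = (if y = x then f y * 2 ^ n else 0)"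
      by simp
  qed
  also have "\<dots> = f x * 2 ^ n"
    using x by (subst sum.delta) auto
  finally show ?thesis by simp
qed

lemma Parseval: "avg n (\<lambda>x. f x * g x) = (\<Sum>S\<in>Pow {..<n}. fourier n f S * fourier n g S)"
proof -
  have "avg n (\<lambda>x. f x * g x) = avg n (\<lambda>x. f x * (\<Sum>S\<in>Pow {..<n}. fourier n g S * chi S x))"
    by (rule avg_cong) (subst (1) fourier_inversion[of _ n g], auto)
  also have "\<dots> = avg n (\<lambda>x. (\<Sum>S\<in>Pow {..<n}. fourier n g S * (f x * chi S x)))"
    by (simp add: sum_distrib_left mult_ac)
  also have "\<dots> = (\<Sum>S\<in>Pow {..<n}. fourier n g S * fourier n f S)"
    by (simp add: avg_sum avg_cmult fourier_def)
  finally show ?thesis by (simp add: mult.commute)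
qed

lemma fourier_low_poly:
  assumes "S \<subseteq> {..<n}"
  shows "fourier n (low_poly n d c) S = (if card S \<le> d then c S else 0)"
proof -
  have fin: "finite S" if "S \<subseteq> {..<n}" for S :: "nat set" using that by (rule finite_subset) simp
  have "fourier n (low_poly n d c) S
     = (\<Sum>T | T \<subseteq> {..<n} \<and> card T \<le> d. c T * avg n (\<lambda>x. chi T x * chi S x))"
    by (simp add: fourier_def low_poly_def sum_distrib_right mult.assoc avg_sum avg_cmult)
  also have "\<dots> = (\<Sum>T | T \<subseteq> {..<n} \<and> card T \<le> d. if T = S then c T else 0)"
  proof (rule sum.cong[OF refl])
    fix T assume T: "T \<in> {T. T \<subseteq> {..<n} \<and> card T \<le> d}"
    have "avg n (\<lambda>x. chi T x * chi S x) = avg n (\<lambda>x. chi x (sym_diff T S))"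
      using T assms by (intro avg_cong) (subst chi_mult[symmetric], auto simp: fin chi_commute)
    also have "\<dots> = (if T = S then 1 else 0)"
      unfolding avg_def using T assms by (subst sum_chi) auto
    finally show "c T * avg n (\<lambda>x. chi T x * chi S x) = (if T = S then c T else 0)" by simp
  qed
  also have "\<dots> = (if card S \<le> d then c S else 0)"
    using assms by (subst sum.delta) (auto simp: finite_low)
  finally show ?thesis .
qed

text \<open>The weight W on the left is both the correlation of \<open>g\<close> with its low-degree
  part \<open>p\<close> and the second moment of \<open>p\<close>. Since \<open>g\<close> equals its
  own cube, two applications of the Cauchy-Schwarz inequality and the fourth moment bound give W^4
  \<le> I^3 9^d W^2, where I is the second moment of \<open>g\<close>. The gain over Parseval is the
  exponent 3/2 of I.\<close>

lemma low_degree_weight: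
  assumes g: "\<And>x. x \<subseteq> {..<n} \<Longrightarrow> g x \<in> {-1, 0, 1}"
  shows "(\<Sum>S | S \<subseteq> {..<n} \<and> card S \<le> d. (fourier n g S)\<^sup>2)
     \<le> 3 ^ d * (avg n (\<lambda>x. (g x)\<^sup>2) * sqrt (avg n (\<lambda>x. (g x)\<^sup>2)))"
proof -
  define p where "p = low_poly n d (fourier n g)"
  define I where "I = avg n (\<lambda>x. (g x)\<^sup>2)"
  define W where "W = (\<Sum>S | S \<subseteq> {..<n} \<and> card S \<le> d. (fourier n g S)\<^sup>2)"
  have I0: "0 \<le> I" unfolding I_def by (rule avg_nonneg) simp
  have W0: "0 \<le> W" unfolding W_def by (rule sum_nonneg) simp
  have restrict: "(\<Sum>S\<in>Pow {..<n}. if card S \<le> d then F S else 0) = (\<Sum>S | S \<subseteq> {..<n} \<and> card S \<le> d. F S)"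
    for F :: "nat set \<Rightarrow> real"
    by (subst sum.inter_filter[symmetric]) (auto intro!: sum.cong)
  have gp: "avg n (\<lambda>x. g x * p x) = W"
    unfolding Parseval W_def restrict[symmetric]
    by (auto intro!: sum.cong simp: fourier_low_poly p_def power2_eq_square)
  have pp: "avg n (\<lambda>x. (p x)\<^sup>2) = W"
    unfolding Parseval W_def restrict[symmetric] power2_eq_square
    by (auto intro!: sum.cong simp: fourier_low_poly p_def power2_eq_square)
  have p4: "avg n (\<lambda>x. (p x) ^ 4) \<le> 9 ^ d * W\<^sup>2"
    using Bonami[of n d "fourier n g"] pp by (simp add: p_def)
  have g3: "(g x) ^ 3 = g x" "(g x) ^ 4 = (g x)\<^sup>2" if "x \<subseteq> {..<n}" for x
    using g[OF that] by auto
  define J where "J = avg n (\<lambda>x. (g x)\<^sup>2 * (p x)\<^sup>2)"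
  have "W = avg n (\<lambda>x. (g x)\<^sup>2 * (g x * p x))"
    unfolding gp[symmetric]
    by (rule avg_cong) (metis g3(1) mult.assoc power3_eq_cube power2_eq_square)
  then have "W\<^sup>2 = (avg n (\<lambda>x. g x * (g x * (g x * p x))))\<^sup>2"
    by (simp add: power2_eq_square mult.assoc)
  also have "\<dots> = (avg n (\<lambda>x. g x * (g x * p x * g x)))\<^sup>2"
    by (simp add: mult_ac)
  also have "\<dots> \<le> I * avg n (\<lambda>x. (g x * p x * g x)\<^sup>2)"
    unfolding I_def by (rule avg_Cauchy_Schwarz)
  also have "avg n (\<lambda>x. (g x * p x * g x)\<^sup>2) = J"
    unfolding J_def
  proof (rule avg_cong)
    fix x assume "x \<subseteq> {..<n}"
    have "(g x * p x * g x)\<^sup>2 = (g x) ^ 4 * (p x)\<^sup>2"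
      by (simp add: power4_eq_xxxx power2_eq_square)
    then show "(g x * p x * g x)\<^sup>2 = (g x)\<^sup>2 * (p x)\<^sup>2"
      using g3(2)[OF \<open>x \<subseteq> {..<n}\<close>] by simp
  qed
  finally have W2: "W\<^sup>2 \<le> I * J" .
  have "J\<^sup>2 \<le> avg n (\<lambda>x. ((g x)\<^sup>2)\<^sup>2) * avg n (\<lambda>x. ((p x)\<^sup>2)\<^sup>2)"
    unfolding J_def by (rule avg_Cauchy_Schwarz)
  also have "avg n (\<lambda>x. ((g x)\<^sup>2)\<^sup>2) = I"
    unfolding I_def by (rule avg_cong) (simp add: g3(2) flip: power_mult)
  also have "avg n (\<lambda>x. ((p x)\<^sup>2)\<^sup>2) = avg n (\<lambda>x. (p x) ^ 4)"
    by (simp flip: power_mult)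
  also have "I * \<dots> \<le> I * (9 ^ d * W\<^sup>2)"
    by (rule mult_left_mono[OF p4 I0])
  finally have J2: "J\<^sup>2 \<le> I * (9 ^ d * W\<^sup>2)" .
  have J0: "0 \<le> J" unfolding J_def by (rule avg_nonneg) simp
  have "W ^ 4 = (W\<^sup>2)\<^sup>2" by (simp flip: power_mult)
  also have "\<dots> \<le> (I * J)\<^sup>2" by (rule power_mono[OF W2]) simp
  also have "\<dots> = I\<^sup>2 * J\<^sup>2" by (simp add: power_mult_distrib)
  also have "\<dots> \<le> I\<^sup>2 * (I * (9 ^ d * W\<^sup>2))" by (rule mult_left_mono[OF J2]) simp
  finally have *: "W\<^sup>2 * W\<^sup>2 \<le> (I ^ 3 * 9 ^ d) * W\<^sup>2"
    by (simp add: power2_eq_square power4_eq_xxxx power3_eq_cube mult_ac)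
  have "W\<^sup>2 \<le> I ^ 3 * 9 ^ d"
  proof (cases "W = 0")
    case True
    then show ?thesis using I0 by simp
  next
    case False
    then have "0 < W\<^sup>2" by simp
    with * show ?thesis by (rule mult_right_le_imp_le)
  qed
  also have "\<dots> = (3 ^ d * (I * sqrt I))\<^sup>2"
  proof -
    have "(3::real) ^ d * 3 ^ d = 9 ^ d" by (simp flip: power_mult_distrib)
    moreover have "(sqrt I)\<^sup>2 = I" using I0 by simp
    ultimately show ?thesis
      by (simp add: power_mult_distrib power3_eq_cube flip: power_mult)
         (simp add: power_mult power2_eq_square mult_ac flip: power_mult_distrib)
  qed
  finally have "W \<le> 3 ^ d * (I * sqrt I)"
    by (rule power2_le_imp_le) (use I0 in simp)
  then show ?thesis by (simp add: W_def I_def)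
qed

section \<open>Influences and antipodal pairs\<close>

definition flip :: "nat \<Rightarrow> nat set \<Rightarrow> nat set" where
  "flip i x = sym_diff x {i}"

definition influence :: "nat \<Rightarrow> (nat set \<Rightarrow> bool) \<Rightarrow> nat \<Rightarrow> real" where
  "influence n f i = avg n (\<lambda>x. of_bool (f x \<noteq> f (flip i x)))"

definition antipodal :: "nat \<Rightarrow> (nat set \<Rightarrow> bool) \<Rightarrow> real" where
  "antipodal n f = avg n (\<lambda>x. of_bool (f x \<noteq> f ({..<n} - x)))"

lemma flip_flip [simp]: "flip i (flip i x) = x"
  by (auto simp: flip_def)

lemma flip_subset: "i < n \<Longrightarrow> flip i x \<subseteq> {..<n} \<longleftrightarrow> x \<subseteq> {..<n}"
  by (auto simp: flip_def)

lemma avg_flip: "i < n \<Longrightarrow> avg n (\<lambda>x. h (flip i x)) = avg n h"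
  unfolding avg_def
  by (intro arg_cong2[where f="(/)"] refl sum.reindex_bij_witness[of _ "flip i" "flip i"])
     (auto simp: flip_subset)

lemma avg_compl: "avg n (\<lambda>x. h ({..<n} - x)) = avg n h"
  unfolding avg_def
  by (intro arg_cong2[where f="(/)"] refl
        sum.reindex_bij_witness[of _ "\<lambda>x. {..<n} - x" "\<lambda>x. {..<n} - x"]) auto

text \<open>Flipping \<open>i\<close> changes the sign of the character of \<open>S\<close> exactly
  if \<open>i\<close> is in \<open>S\<close>, so the difference keeps these coefficients and kills
  the others.\<close>

lemma fourier_derivative:
  assumes "i < n" "S \<subseteq> {..<n}"
  shows "fourier n (\<lambda>x. (f x - f (flip i x)) / 2) S = (if i \<in> S then fourier n f S else 0)"
proof -
  have fin: "finite x" if "x \<subseteq> {..<n}" for x :: "nat set" using that by (rule finite_subset) simp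
  have "avg n (\<lambda>x. f (flip i x) * chi S x) = avg n (\<lambda>x. f x * chi S (flip i x))"
    using avg_flip[OF assms(1), of "\<lambda>x. f x * chi S (flip i x)"] by simp
  also have "\<dots> = avg n (\<lambda>x. chi S {i} * (f x * chi S x))"
    by (rule avg_cong) (simp add: flip_def chi_mult[symmetric] fin)
  also have "\<dots> = chi S {i} * fourier n f S"
    by (simp add: avg_cmult fourier_def)
  finally have "avg n (\<lambda>x. f (flip i x) * chi S x) = chi S {i} * fourier n f S" .
  moreover have "fourier n (\<lambda>x. (f x - f (flip i x)) / 2) S
     = (1/2) * (fourier n f S - avg n (\<lambda>x. f (flip i x) * chi S x))"
    unfolding fourier_def avg_diff[symmetric] avg_cmult[symmetric]
    by (rule avg_cong) (simp add: algebra_simps diff_divide_distrib)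
  ultimately show ?thesis
    by (auto simp: chi_def)
qed

text \<open>For values 1 and -1, the sum of the values at a point and at its antipode is 0 where
  they differ and has square 4 elsewhere. Its mean is twice the mean of the function, and the square
  of a mean is at most the mean of the square.\<close>

lemma antipodal_le_variance:
  "antipodal n f \<le> 1 - (fourier n (\<lambda>x. of_bool (f x) - of_bool (\<not> f x)) {})\<^sup>2"
proof -
  let ?F = "\<lambda>x. of_bool (f x) - of_bool (\<not> f x) :: real"
  define m where "m = avg n ?F"
  have "(2 * m)\<^sup>2 = (avg n (\<lambda>x. 1 * (?F x + ?F ({..<n} - x))))\<^sup>2"
    using avg_compl[of n ?F] by (simp only: m_def mult_1 avg_add mult_2)
  also have "\<dots> \<le> avg n (\<lambda>_. 1\<^sup>2) * avg n (\<lambda>x. (?F x + ?F ({..<n} - x))\<^sup>2)"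
    by (rule avg_Cauchy_Schwarz)
  also have "\<dots> = avg n (\<lambda>x. 4 - 4 * of_bool (f x \<noteq> f ({..<n} - x)))"
    by (simp only: avg_const power_one mult_1) (rule avg_cong, auto)
  also have "\<dots> = 4 - 4 * antipodal n f"
    by (simp add: avg_diff avg_const avg_cmult antipodal_def)
  finally show ?thesis by (simp add: m_def fourier_def chi_def power_mult_distrib)
qed

text \<open>If all influences were at most \<tau>, the variance would be too small. The total
  influence is the sum of \<open>card S * c S\<close>, so degrees above \<open>d\<close> carry
  weight at most \<open>K / (d + 1)\<close>. For lower degrees \<open>card S * c S\<close> counts
  \<open>S\<close> once for each derivative that retains it, and the low-degree weight of a
  derivative is at most \<open>3 ^ d\<close> times the power 3/2 of the influence.\<close>

lemma influential_coordinate: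
  assumes total: "(\<Sum>i<n. influence n f i) \<le> K"
    and anti: "K / (real d + 1) + 3 ^ d * sqrt \<tau> * K < antipodal n f"
    and "0 \<le> \<tau>"
  shows "\<exists>i<n. \<tau> < influence n f i"
proof (rule ccontr)
  assume "\<not> ?thesis"
  then have le: "influence n f i \<le> \<tau>" if "i < n" for i using that by auto
  let ?F = "\<lambda>x. of_bool (f x) - of_bool (\<not> f x) :: real"
  define c where "c S = (fourier n ?F S)\<^sup>2" for S
  have c0: "0 \<le> c S" for S by (simp add: c_def)
  let ?D = "\<lambda>i x. (?F x - ?F (flip i x)) / 2"
  let ?L = "{S. S \<subseteq> {..<n} \<and> card S \<le> d}"
  have fin: "finite S" if "S \<subseteq> {..<n}" for S :: "nat set" using that by (rule finite_subset) simp
  have D2: "avg n (\<lambda>x. (?D i x)\<^sup>2) = influence n f i" for i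
    unfolding influence_def by (rule avg_cong) auto
  have fd: "fourier n (?D i) S = (if i \<in> S then fourier n ?F S else 0)" if "i < n" "S \<subseteq> {..<n}" for i S
    using that by (rule fourier_derivative)
  have inf: "influence n f i = (\<Sum>S\<in>Pow {..<n}. if i \<in> S then c S else 0)" if "i < n" for i
    unfolding D2[symmetric] power2_eq_square Parseval
    using that by (intro sum.cong refl) (subst (1 2) fd, auto simp: c_def power2_eq_square)
  have count: "(\<Sum>i<n. \<Sum>S\<in>A. if i \<in> S then c S else 0) = (\<Sum>S\<in>A. card S * c S)"
    if "A \<subseteq> Pow {..<n}" for A
  proof -
    have "(\<Sum>i<n. if i \<in> S then c S else 0) = card S * c S" if "S \<subseteq> {..<n}" for S
      using that by (simp add: sum.If_cases Int_absorb2 Int_commute)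
    then show ?thesis using that by (subst sum.swap) (auto intro!: sum.cong)
  qed
  have total': "(\<Sum>S\<in>Pow {..<n}. card S * c S) \<le> K"
    using total inf count[OF subset_refl] by simp
  have low: "(\<Sum>S\<in>?L. if i \<in> S then c S else 0) \<le> 3 ^ d * sqrt \<tau> * influence n f i" if i: "i < n" for i
  proof -
    have "(\<Sum>S\<in>?L. if i \<in> S then c S else 0) = (\<Sum>S\<in>?L. (fourier n (?D i) S)\<^sup>2)"
      using i by (intro sum.cong refl) (subst fd, auto simp: c_def)
    also have "\<dots> \<le> 3 ^ d * (influence n f i * sqrt (influence n f i))"
      unfolding D2[symmetric] by (rule low_degree_weight) auto
    also have "\<dots> \<le> 3 ^ d * (influence n f i * sqrt \<tau>)"
      using le[OF i] by (intro mult_left_mono) (auto simp: influence_def intro!: avg_nonneg)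
    finally show ?thesis by (simp add: mult_ac)
  qed
  have "(\<Sum>S\<in>?L. card S * c S) \<le> (\<Sum>i<n. 3 ^ d * sqrt \<tau> * influence n f i)"
    using low by (subst count[symmetric]) (auto intro!: sum_mono)
  also have "\<dots> \<le> 3 ^ d * sqrt \<tau> * K"
    using total \<open>0 \<le> \<tau>\<close> by (simp add: sum_distrib_left[symmetric] mult_left_mono)
  finally have low': "(\<Sum>S\<in>?L. card S * c S) \<le> 3 ^ d * sqrt \<tau> * K" .
  have "avg n (\<lambda>x. ?F x * ?F x) = avg n (\<lambda>_. 1)"
    by (rule avg_cong) auto
  then have one: "(\<Sum>S\<in>Pow {..<n}. c S) = 1"
    by (simp add: Parseval avg_const c_def power2_eq_square)
  have "antipodal n f \<le> 1 - c {}"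
    unfolding c_def by (rule antipodal_le_variance)
  also have "\<dots> = (\<Sum>S\<in>Pow {..<n} - {{}}. c S)"
    by (subst sum_diff1) (auto simp: one)
  \<comment> \<open>Every nonempty \<open>S\<close> is paid for by one of the two summands, since
    \<open>card S\<close> is at least \<open>d + 1\<close> or, failing that, at least 1.\<close>
  also have "\<dots> \<le> (\<Sum>S\<in>Pow {..<n} - {{}}. card S * c S / (real d + 1) + (if card S \<le> d then card S * c S else 0))"
  proof (rule sum_mono)
    fix S assume S: "S \<in> Pow {..<n} - {{}}"
    then have "1 \<le> card S" using fin by (auto simp: Suc_le_eq card_gt_0_iff)
    show "c S \<le> card S * c S / (real d + 1) + (if card S \<le> d then card S * c S else 0)"
    proof (cases "card S \<le> d")
      case True
      have "1 * c S \<le> card S * c S" using \<open>1 \<le> card S\<close> c0 by (intro mult_right_mono) auto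
      moreover have "0 \<le> card S * c S / (real d + 1)" using c0 by simp
      ultimately show ?thesis using True by simp
    next
      case False
      have "(real d + 1) * c S \<le> card S * c S" using False c0 by (intro mult_right_mono) auto
      then show ?thesis using False by (simp add: field_simps)
    qed
  qed
  also have "\<dots> \<le> (\<Sum>S\<in>Pow {..<n}. card S * c S / (real d + 1) + (if card S \<le> d then card S * c S else 0))"
    by (rule sum_mono2) (auto simp: c0)
  also have "\<dots> = (\<Sum>S\<in>Pow {..<n}. card S * c S) / (real d + 1) + (\<Sum>S\<in>?L. card S * c S)"
    by (simp add: sum.distrib sum_divide_distrib sum.inter_filter[symmetric])
  also have "\<dots> \<le> K / (real d + 1) + 3 ^ d * sqrt \<tau> * K"
    using total' low' by (intro add_mono divide_right_mono) auto
  finally show False using anti by simp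
qed

section \<open>The balanced edge-separator instance\<close>

definition bes_of :: "nat \<Rightarrow> nat \<Rightarrow> rat \<Rightarrow> rat \<Rightarrow> ug \<Rightarrow> bes" where
  "bes_of N K M B U = \<lparr>bes_size = (length (enc_ug N U) + 1) * K,
     bes_wt = (\<lambda>e. link N M U (edge_at N U (Max e div K)) (Max e div K) (Max e mod K) (Min e div K) (Min e mod K)),
     bes_dem = (\<lambda>e. demand N U (edge_at N U (Max e div K)) (Max e div K) (Max e mod K) (Min e div K) (Min e mod K)),
     bes_bal = B\<rparr>"

lemma upt_add_conv: "[0..<a + c] = [0..<a] @ map (\<lambda>i. a + i) [0..<c]"
  by (induction c) auto

lemma upt_blocks: "[0..<n * K] = concat (map (\<lambda>p. map (\<lambda>c. p * K + c) [0..<K]) [0..<n])"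
  by (induction n) (simp_all add: upt_add_conv add.commute[of K])

lemma concat_concat_map: "concat (concat xss) = concat (map concat xss)"
  by (induction xss) auto

text \<open>The larger node of a pair determines the row. Grouping the rows by the block of that
  node and cutting each row at the block boundaries turns one listing into the other.\<close>

lemma enc_bes_of:
  assumes K: "0 < K"
  shows "enc_bes (bes_of N K M B U) @ enc_rat \<alpha> = enc_reduction N K M B \<alpha> U"
proof -
  define g where "g v u = enc_pair N M U (edge_at N U (v div K)) (v div K) (v mod K) (u div K) (u mod K)" for v u
  have mm: "Max {u, v} = v \<and> Min {u, v} = u" if "u < v" for u v :: nat using that by auto
  let ?I = "bes_of N K M B U" and ?n = "length (enc_ug N U) + 1"
  have "concat [enc_rat (bes_wt ?I {u, v}) @ enc_rat (bes_dem ?I {u, v}). v \<leftarrow> [0..<bes_size ?I], u \<leftarrow> [0..<v]]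
     = concat (map (\<lambda>v. concat (map (g v) [0..<v])) [0..<?n * K])"
  proof -
    have m1: "map (\<lambda>u. enc_rat (bes_wt ?I {u, v}) @ enc_rat (bes_dem ?I {u, v})) [0..<v] = map (g v) [0..<v]" for v
      by (rule map_cong[OF refl]) (simp only: bes_of_def g_def enc_pair_def bes.simps mm set_upt atLeastLessThan_iff)
    have m2: "concat (concat (map f xs)) = concat (map (\<lambda>v. concat (f v)) xs)" for f :: "nat \<Rightarrow> bool list list" and xs
      by (induction xs) auto
    show ?thesis unfolding m1 m2 by (simp only: bes_of_def bes.simps)
  qed
  also have "\<dots> = concat (map (\<lambda>p. enc_block N K M U (edge_at N U p) p) [0..<?n])"
  proof -
    have row: "concat (map (g (p * K + c)) [0..<p * K + c]) =
       concat (map (\<lambda>q. concat (map (enc_pair N M U (edge_at N U p) p c q) [0..<K])) [0..<p]) @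
       concat (map (enc_pair N M U (edge_at N U p) p c p) [0..<c])" if c: "c < K" for p c
    proof -
      have own: "map (\<lambda>i. g (p * K + c) (p * K + i)) [0..<c] = map (enc_pair N M U (edge_at N U p) p c p) [0..<c]"
        using c K by (simp add: g_def)
      have other: "map (\<lambda>c'. g (p * K + c) (q * K + c')) [0..<K] = map (enc_pair N M U (edge_at N U p) p c q) [0..<K]" for q
        using c K by (simp add: g_def)
      show ?thesis
        unfolding upt_add_conv[of "p * K"] upt_blocks map_append concat_append
        by (simp add: map_concat concat_concat_map o_def own other)
    qed
    have "concat (map (\<lambda>v. concat (map (g v) [0..<v])) [0..<?n * K]) =
      concat (map (\<lambda>p. concat (map (\<lambda>c. concat (map (g (p * K + c)) [0..<p * K + c])) [0..<K])) [0..<?n])"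
      unfolding upt_blocks[of ?n] by (simp add: map_concat concat_concat_map o_def)
    also have "\<dots> = concat (map (\<lambda>p. enc_block N K M U (edge_at N U p) p) [0..<?n])"
      unfolding enc_block_def
      by (intro arg_cong[of _ _ concat] map_cong refl row) simp
    finally show ?thesis .
  qed
  finally show ?thesis
    by (simp add: enc_bes_def enc_reduction_def bes_of_def)
qed

section \<open>Sums over pairs of nodes\<close>

lemma sum_upto_add: "(\<Sum>u<a + c. f u) = (\<Sum>u<a. f u) + (\<Sum>i<c. f (a + i))" for f :: "nat \<Rightarrow> 'a::comm_monoid_add"
  by (induction c) (auto simp: add.assoc)

lemma sum_blocks: "(\<Sum>v<n * K. f v) = (\<Sum>p<n. \<Sum>c<K. f (p * K + c))" for f :: "nat \<Rightarrow> 'a::comm_monoid_add"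
  by (induction n) (simp_all add: sum_upto_add add.commute[of K])

lemma sum_edges:
  fixes f :: "nat set \<Rightarrow> 'a::comm_monoid_add"
  shows "(\<Sum>e\<in>bes_edges I. f e) = (\<Sum>v<bes_size I. \<Sum>u<v. f {u, v})"
proof -
  let ?A = "Sigma {..<bes_size I} (\<lambda>v. {..<v})"
  have "bij_betw (\<lambda>(v, u). {u, v}) ?A (bes_edges I)"
  proof (rule bij_betwI')
    fix x y assume "x \<in> ?A" "y \<in> ?A"
    then show "((case x of (v, u) \<Rightarrow> {u, v}) = (case y of (v, u) \<Rightarrow> {u, v})) = (x = y)"
      by (auto simp: doubleton_eq_iff)
  next
    fix x assume "x \<in> ?A"
    then show "(case x of (v, u) \<Rightarrow> {u, v}) \<in> bes_edges I" by (auto simp: bes_edges_def)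
  next
    fix e assume e: "e \<in> bes_edges I"
    then obtain a b where ab: "e = {a, b}" "a \<noteq> b" by (auto simp: bes_edges_def card_2_iff)
    then have "a < bes_size I" "b < bes_size I" using e by (auto simp: bes_edges_def)
    then have "(if a < b then (b, a) else (a, b)) \<in> ?A" using ab by auto
    then show "\<exists>x\<in>?A. e = (case x of (v, u) \<Rightarrow> {u, v})" using ab by (rule_tac bexI) auto
  qed
  from sum.reindex_bij_betw[OF this, of f] show ?thesis
    by (simp add: sum.Sigma case_prod_unfold)
qed

lemma sum_cut_edges:
  fixes f :: "nat set \<Rightarrow> 'a::comm_monoid_add"
  shows "(\<Sum>e\<in>cut_edges I S. f e) = (\<Sum>v<bes_size I. \<Sum>u<v. if (u \<in> S) \<noteq> (v \<in> S) then f {u, v} else 0)"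
proof -
  have fin: "finite (bes_edges I)" by (rule finite_subset[of _ "Pow {..<bes_size I}"]) (auto simp: bes_edges_def)
  have c: "card ({u, v} \<inter> S) = 1 \<longleftrightarrow> (u \<in> S) \<noteq> (v \<in> S)" if "u < v" for u v :: nat
    using that by (cases "u \<in> S"; cases "v \<in> S") (simp_all add: Int_insert_left)
  have "(\<Sum>e\<in>cut_edges I S. f e) = (\<Sum>e\<in>bes_edges I. if card (e \<inter> S) = 1 then f e else 0)"
    unfolding cut_edges_def using fin by (rule sum.inter_filter)
  also have "\<dots> = (\<Sum>v<bes_size I. \<Sum>u<v. if card ({u, v} \<inter> S) = 1 then f {u, v} else 0)"
    by (rule sum_edges)
  also have "\<dots> = (\<Sum>v<bes_size I. \<Sum>u<v. if (u \<in> S) \<noteq> (v \<in> S) then f {u, v} else 0)"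
    by (intro sum.cong refl if_cong c) simp
  finally show ?thesis .
qed

lemma sum_below_diagonal:
  fixes g :: "nat \<Rightarrow> nat \<Rightarrow> real"
  assumes "\<And>a b. g a b = g b a" "\<And>a. g a a = 0"
  shows "(\<Sum>a<n. \<Sum>b<a. g a b) = (\<Sum>a<n. \<Sum>b<n. g a b) / 2"
proof (induction n)
  case (Suc n)
  have "(\<Sum>a<n. g a n) = (\<Sum>b<n. g n b)" by (rule sum.cong) (auto simp: assms(1))
  then show ?case using Suc by (simp add: sum.distrib assms(2) field_simps)
qed simp

section \<open>Points of the cube\<close>

text \<open>Inverse to taking the tag and the point of a node number; it turns sums over node
  numbers into sums over tags and subsets.\<close>

definition node :: "nat \<Rightarrow> nat \<Rightarrow> nat set \<Rightarrow> nat" where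
  "node N t X = t * 2 ^ N + set_encode X"

lemma pts_conv: "pts N c = set_decode (c mod 2 ^ N)"
  by (auto simp: pts_def set_decode_def bit_take_bit_iff simp flip: take_bit_eq_mod bit_iff_odd)

lemma pts_subset: "pts N c \<subseteq> {..<N}"
  by (auto simp: pts_def)

lemma bij_set_encode: "bij_betw set_encode (Pow {..<N}) {..<2 ^ N}"
proof (rule bij_betw_imageI)
  show "inj_on set_encode (Pow {..<N})"
    by (rule inj_on_subset[OF inj_on_set_encode]) (auto intro: finite_subset)
  have "x \<in> set_encode ` Pow {..<N}" if "x < 2 ^ N" for x
    using that pts_subset[of N x] by (intro image_eqI[of _ _ "pts N x"]) (auto simp: pts_conv)
  moreover have "set_encode X < 2 ^ N" if "X \<subseteq> {..<N}" for X
  proof -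
    have "set_encode X \<le> set_encode {..<N}"
      unfolding set_encode_def using that by (intro sum_mono2) auto
    also have "set_encode {..<N} < 2 ^ N"
      by (induction N) (auto simp: set_encode_def)
    finally show ?thesis .
  qed
  ultimately show "set_encode ` Pow {..<N} = {..<2 ^ N}" by auto
qed

lemma set_encode_less: "X \<subseteq> {..<N} \<Longrightarrow> set_encode X < 2 ^ N"
  using bij_betwE[OF bij_set_encode, of N] by auto

lemma tag_node [simp]: "X \<subseteq> {..<N} \<Longrightarrow> node N t X div 2 ^ N = t"
  using set_encode_less[of X N] by (simp add: node_def)

lemma pts_node [simp]: "X \<subseteq> {..<N} \<Longrightarrow> pts N (node N t X) = X"
  using set_encode_less[of X N] finite_subset[of X "{..<N}"] by (simp add: node_def pts_conv)

lemma node_less: "X \<subseteq> {..<N} \<Longrightarrow> t < 2 ^ r \<Longrightarrow> node N t X < 2 ^ (N + r)"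
proof -
  assume X: "X \<subseteq> {..<N}" and t: "t < 2 ^ r"
  have "node N t X < (t + 1) * 2 ^ N" using set_encode_less[OF X] by (simp add: node_def)
  also have "\<dots> \<le> 2 ^ r * 2 ^ N" using t by (intro mult_right_mono) auto
  finally show ?thesis by (simp add: power_add mult.commute)
qed

lemma sum_nodes: "(\<Sum>c<2 ^ (N + r). f c) = (\<Sum>t<(2::nat) ^ r. \<Sum>X\<in>Pow {..<N}. f (node N t X))"
  for f :: "nat \<Rightarrow> 'a::comm_monoid_add"
proof -
  have "(\<Sum>c<2 ^ (N + r). f c) = (\<Sum>t<(2::nat) ^ r. \<Sum>x<2 ^ N. f (t * 2 ^ N + x))"
    using sum_blocks[of f "2 ^ r" "2 ^ N"] by (simp add: power_add mult.commute)
  also have "\<dots> = (\<Sum>t<(2::nat) ^ r. \<Sum>X\<in>Pow {..<N}. f (node N t X))"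
    unfolding node_def by (rule sum.cong[OF refl], rule sum.reindex_bij_betw[OF bij_set_encode, symmetric])
  finally show ?thesis .
qed

lemma anti_node:
  assumes "X \<subseteq> {..<N}" "Y \<subseteq> {..<N}"
  shows "anti N (node N t X) (node N u Y) \<longleftrightarrow> t = 0 \<and> u = 0 \<and> Y = {..<N} - X"
  using assms by (simp add: anti_def)

text \<open>Below, \<open>b c\<close> is the side of the node \<open>c\<close> of an edge block in a cut.\<close>

lemma sum_single: "finite A \<Longrightarrow> z \<in> A \<Longrightarrow> (\<Sum>y\<in>A. if y = z then f y else 0) = f z"
  for f :: "'b \<Rightarrow> 'a::comm_monoid_add"
  by simp

lemma sum_if_const: "(\<Sum>y\<in>A. if P then f y else 0) = (if P then \<Sum>y\<in>A. f y else 0)"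
  for f :: "'b \<Rightarrow> 'a::comm_monoid_add"
  by simp

text \<open>Ordered pairs count every antipodal pair twice, and each of the \<open>2 ^ N\<close>
  points with tag 0 has exactly one antipode.\<close>

lemma cut_anti_count:
  assumes N: "1 \<le> N"
  shows "(\<Sum>c<2 ^ (N + r). \<Sum>c'<c. if anti N c c' \<and> b c \<noteq> b c' then 1 else 0 :: real) =
    2 ^ N / 2 * antipodal N (\<lambda>X. b (node N 0 X))"
proof -
  have fin: "finite (Pow {..<N})" "finite {..<(2::nat) ^ r}" "0 \<in> {..<(2::nat) ^ r}" "{..<N} - X \<in> Pow {..<N}" for X
    by auto
  define g where "g c c' = (if anti N c c' \<and> b c \<noteq> b c' then 1 else 0 :: real)" for c c'
  have "(\<Sum>c<2 ^ (N + r). \<Sum>c'<c. g c c') = (\<Sum>c<2 ^ (N + r). \<Sum>c'<2 ^ (N + r). g c c') / 2"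
  proof (rule sum_below_diagonal)
    show "g c c' = g c' c" for c c'
      using pts_subset[of N c] pts_subset[of N c'] by (auto simp: g_def anti_def)
  qed (simp add: g_def)
  also have "(\<Sum>c<2 ^ (N + r). \<Sum>c'<2 ^ (N + r). g c c') =
     (\<Sum>t<(2::nat) ^ r. \<Sum>X\<in>Pow {..<N}. \<Sum>u<2 ^ r. \<Sum>Y\<in>Pow {..<N}. g (node N t X) (node N u Y))"
    by (simp only: sum_nodes)
  also have "\<dots> = (\<Sum>t<(2::nat) ^ r. \<Sum>X\<in>Pow {..<N}. if t = 0 then of_bool (b (node N 0 X) \<noteq> b (node N 0 ({..<N} - X))) else 0)"
  proof (intro sum.cong refl)
    fix t X assume "X \<in> Pow {..<N}"
    then have X: "X \<subseteq> {..<N}" by simp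
    have "(\<Sum>u<(2::nat) ^ r. \<Sum>Y\<in>Pow {..<N}. g (node N t X) (node N u Y)) =
       (\<Sum>u<(2::nat) ^ r. \<Sum>Y\<in>Pow {..<N}. if u = 0 then (if Y = {..<N} - X then
          (if t = 0 then of_bool (b (node N 0 X) \<noteq> b (node N 0 Y)) else 0) else 0) else 0 :: real)"
      using X by (intro sum.cong refl) (auto simp: g_def anti_node)
    also have "\<dots> = (if t = 0 then of_bool (b (node N 0 X) \<noteq> b (node N 0 ({..<N} - X))) else 0)"
      by (simp only: sum_if_const sum_single fin)
    finally show "(\<Sum>u<(2::nat) ^ r. \<Sum>Y\<in>Pow {..<N}. g (node N t X) (node N u Y)) = \<dots>" .
  qed
  also have "\<dots> = (\<Sum>t<(2::nat) ^ r. if t = 0 then (\<Sum>X\<in>Pow {..<N}. of_bool (b (node N 0 X) \<noteq> b (node N 0 ({..<N} - X)))) else 0)"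
    by (intro sum.cong refl) auto
  also have "\<dots> = 2 ^ N * antipodal N (\<lambda>X. b (node N 0 X))"
    by (simp add: sum.delta antipodal_def avg_def)
  finally show ?thesis by (simp add: g_def)
qed

definition total_influence :: "nat \<Rightarrow> (nat set \<Rightarrow> bool) \<Rightarrow> real" where
  "total_influence n f = (\<Sum>i<n. influence n f i)"

lemma flip_eq_iff: "flip i X = flip j X \<longleftrightarrow> i = j"
  by (auto simp: flip_def)

text \<open>Cube edges are symmetric and amount to half of the ordered pairs, hence the halved total
  influences. Each tag from 1 on adds its probability of disagreement with tag 0.\<close>

lemma cut_adj_count:
  assumes r: "1 \<le> r"
  shows "(\<Sum>c<2 ^ (N + r). \<Sum>c'<c. if adj N c c' \<and> b c \<noteq> b c' then 1 else 0 :: real) =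
    2 ^ N * ((total_influence N (\<lambda>X. b (node N 0 X)) + total_influence N (\<lambda>X. b (node N 1 X))) / 2 +
      (\<Sum>t=1..<2 ^ r. avg N (\<lambda>X. of_bool (b (node N t X) \<noteq> b (node N 0 X)))))"
proof -
  let ?K = "2 ^ (N + r) :: nat" and ?P = "Pow {..<N}"
  have fin: "finite (Pow {..<N})" "finite {..<(2::nat) ^ r}" "0 \<in> {..<(2::nat) ^ r}"
    by auto
  define H where "H c c' \<longleftrightarrow> c div 2 ^ N = c' div 2 ^ N \<and> c div 2 ^ N \<le> 1 \<and> (\<exists>i<N. pts N c' = flip i (pts N c))" for c c'
  define V where "V c c' \<longleftrightarrow> 1 \<le> c div 2 ^ N \<and> c' div 2 ^ N = 0 \<and> pts N c' = pts N c" for c c'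
  define g where "g c c' = (if H c c' \<and> b c \<noteq> b c' then 1 else 0 :: real)" for c c'
  define v where "v c c' = (if V c c' \<and> b c \<noteq> b c' then 1 else 0 :: real)" for c c'
  have adj: "(if adj N c c' \<and> b c \<noteq> b c' then 1 else 0 :: real) = g c c' + v c c'" for c c'
  proof -
    have "adj N c c' \<longleftrightarrow> H c c' \<or> V c c'" "\<not> (H c c' \<and> V c c')"
      by (auto simp: adj_def H_def V_def flip_def)
    then show ?thesis by (auto simp: g_def v_def)
  qed
  have "(\<Sum>c<?K. \<Sum>c'<c. if adj N c c' \<and> b c \<noteq> b c' then 1 else 0 :: real) =
     (\<Sum>c<?K. \<Sum>c'<c. g c c') + (\<Sum>c<?K. \<Sum>c'<c. v c c')"
    by (simp only: adj sum.distrib)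
  \<comment> \<open>The node with tag 0 is always the smaller one in this one-sided relation, so
    nothing is added above the diagonal.\<close>
  also have "(\<Sum>c<?K. \<Sum>c'<c. v c c') = (\<Sum>c<?K. \<Sum>c'<?K. v c c')"
  proof (rule sum.cong[OF refl], rule sum.mono_neutral_left)
    fix c assume "c \<in> {..<?K}"
    then show "{..<c} \<subseteq> {..<?K}" by auto
    show "\<forall>c'\<in>{..<?K} - {..<c}. v c c' = 0"
    proof
      fix c' assume "c' \<in> {..<?K} - {..<c}"
      then have "c div 2 ^ N \<le> c' div 2 ^ N" by (simp add: div_le_mono)
      then show "v c c' = 0" by (auto simp: v_def V_def)
    qed
  qed auto
  also have "(\<Sum>c<?K. \<Sum>c'<?K. v c c') = (\<Sum>t<(2::nat) ^ r. \<Sum>X\<in>?P. \<Sum>u<2 ^ r. \<Sum>Y\<in>?P. v (node N t X) (node N u Y))"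
    by (simp only: sum_nodes)
  also have "\<dots> = (\<Sum>t<(2::nat) ^ r. if 1 \<le> t then 2 ^ N * avg N (\<lambda>X. of_bool (b (node N t X) \<noteq> b (node N 0 X))) else 0)"
  proof (intro sum.cong refl)
    fix t
    have "(\<Sum>u<(2::nat) ^ r. \<Sum>Y\<in>?P. v (node N t X) (node N u Y)) =
        (if 1 \<le> t then of_bool (b (node N t X) \<noteq> b (node N 0 X)) else 0)" if "X \<in> ?P" for X
    proof -
      have "(\<Sum>u<(2::nat) ^ r. \<Sum>Y\<in>?P. v (node N t X) (node N u Y)) =
        (\<Sum>u<(2::nat) ^ r. \<Sum>Y\<in>?P. if u = 0 then (if Y = X then
          (if 1 \<le> t then of_bool (b (node N t X) \<noteq> b (node N 0 Y)) else 0) else 0) else 0 :: real)"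
        using that by (intro sum.cong refl) (auto simp: v_def V_def)
      also have "\<dots> = (if 1 \<le> t then of_bool (b (node N t X) \<noteq> b (node N 0 X)) else 0)"
        using that by (simp only: sum_if_const sum_single fin)
      finally show ?thesis .
    qed
    then have "(\<Sum>X\<in>?P. \<Sum>u<2 ^ r. \<Sum>Y\<in>?P. v (node N t X) (node N u Y)) =
       (\<Sum>X\<in>?P. if 1 \<le> t then of_bool (b (node N t X) \<noteq> b (node N 0 X)) else 0)"
      by (rule sum.cong[OF refl])
    then show "(\<Sum>X\<in>?P. \<Sum>u<2 ^ r. \<Sum>Y\<in>?P. v (node N t X) (node N u Y)) =
       (if 1 \<le> t then 2 ^ N * avg N (\<lambda>X. of_bool (b (node N t X) \<noteq> b (node N 0 X))) else 0)"
      by (simp add: avg_def)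
  qed
  also have "\<dots> = 2 ^ N * (\<Sum>t=1..<2 ^ r. avg N (\<lambda>X. of_bool (b (node N t X) \<noteq> b (node N 0 X))))"
    unfolding sum_distrib_left
    by (rule sum.mono_neutral_cong_right) auto
  also have "(\<Sum>c<?K. \<Sum>c'<c. g c c') = (\<Sum>c<?K. \<Sum>c'<?K. g c c') / 2"
  proof (rule sum_below_diagonal)
    have "H c c' \<Longrightarrow> H c' c" for c c'
      by (auto simp: H_def)
    then show "g c c' = g c' c" for c c' by (auto simp: g_def)
  qed (simp add: g_def)
  also have "(\<Sum>c<?K. \<Sum>c'<?K. g c c') = (\<Sum>t<(2::nat) ^ r. \<Sum>X\<in>?P. \<Sum>u<2 ^ r. \<Sum>Y\<in>?P. g (node N t X) (node N u Y))"
    by (simp only: sum_nodes)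
  also have "\<dots> = (\<Sum>t<(2::nat) ^ r. if t \<le> 1 then 2 ^ N * total_influence N (\<lambda>X. b (node N t X)) else 0)"
  proof (intro sum.cong refl)
    fix t assume t: "t \<in> {..<2 ^ r :: nat}"
    have "(\<Sum>u<(2::nat) ^ r. \<Sum>Y\<in>?P. g (node N t X) (node N u Y)) =
        (if t \<le> 1 then (\<Sum>i<N. of_bool (b (node N t X) \<noteq> b (node N t (flip i X)))) else 0)" if X: "X \<in> ?P" for X
    proof -
      have "(\<Sum>u<(2::nat) ^ r. \<Sum>Y\<in>?P. g (node N t X) (node N u Y)) =
        (\<Sum>u<(2::nat) ^ r. \<Sum>Y\<in>?P. if u = t then (if \<exists>i<N. Y = flip i X then
          (if t \<le> 1 then of_bool (b (node N t X) \<noteq> b (node N t Y)) else 0) else 0) else 0 :: real)"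
        using X by (intro sum.cong refl) (auto simp: g_def H_def)
      also have "\<dots> = (\<Sum>Y\<in>?P. if \<exists>i<N. Y = flip i X then
          (if t \<le> 1 then of_bool (b (node N t X) \<noteq> b (node N t Y)) else 0) else 0)"
        using t by (simp only: sum_if_const sum_single fin)
      also have "\<dots> = (\<Sum>Y\<in>(\<lambda>i. flip i X) ` {..<N}. if t \<le> 1 then of_bool (b (node N t X) \<noteq> b (node N t Y)) else 0)"
      proof (rule sum.mono_neutral_cong_right)
        show "(\<lambda>i. flip i X) ` {..<N} \<subseteq> ?P" using X by (auto simp: flip_def)
      qed auto
      also have "\<dots> = (\<Sum>i<N. if t \<le> 1 then of_bool (b (node N t X) \<noteq> b (node N t (flip i X))) else 0)"
        by (subst sum.reindex) (auto simp: inj_on_def flip_eq_iff)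
      finally show ?thesis by simp
    qed
    then have "(\<Sum>X\<in>?P. \<Sum>u<2 ^ r. \<Sum>Y\<in>?P. g (node N t X) (node N u Y)) =
       (\<Sum>X\<in>?P. if t \<le> 1 then (\<Sum>i<N. of_bool (b (node N t X) \<noteq> b (node N t (flip i X)))) else 0)"
      by (rule sum.cong[OF refl])
    then have "(\<Sum>X\<in>?P. \<Sum>u<2 ^ r. \<Sum>Y\<in>?P. g (node N t X) (node N u Y)) =
       (if t \<le> 1 then (\<Sum>X\<in>?P. \<Sum>i<N. of_bool (b (node N t X) \<noteq> b (node N t (flip i X)))) else 0)"
      by (simp only: sum_if_const)
    also have "(\<Sum>X\<in>?P. \<Sum>i<N. of_bool (b (node N t X) \<noteq> b (node N t (flip i X)))) =
       2 ^ N * total_influence N (\<lambda>X. b (node N t X))"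
      by (subst sum.swap) (simp add: total_influence_def influence_def avg_def sum_distrib_left)
    finally show "(\<Sum>X\<in>?P. \<Sum>u<2 ^ r. \<Sum>Y\<in>?P. g (node N t X) (node N u Y)) =
       (if t \<le> 1 then 2 ^ N * total_influence N (\<lambda>X. b (node N t X)) else 0)" .
  qed
  also have "\<dots> = (\<Sum>t\<in>{0, 1}. 2 ^ N * total_influence N (\<lambda>X. b (node N t X)))"
  proof (rule sum.mono_neutral_cong_right)
    have "(2::nat) ^ 1 \<le> 2 ^ r" using r by (rule power_increasing) simp
    then show "{0, 1} \<subseteq> {..<2 ^ r :: nat}" by auto
  qed auto
  finally show ?thesis by (simp add: algebra_simps add_divide_distrib)
qed

lemma sum_pairs_blocks:
  fixes h :: "nat \<Rightarrow> nat \<Rightarrow> nat \<Rightarrow> nat \<Rightarrow> 'a::comm_monoid_add"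
  shows "(\<Sum>v<n * K. \<Sum>u<v. h (v div K) (v mod K) (u div K) (u mod K)) =
    (\<Sum>p<n. \<Sum>c<K. (\<Sum>q<p. \<Sum>c'<K. h p c q c') + (\<Sum>c'<c. h p c p c'))"
  unfolding sum_blocks[of _ n] sum_upto_add sum_blocks
  by (intro sum.cong refl arg_cong2[where f = "(+)"]) auto

lemma avg_dictator: "i < n \<Longrightarrow> avg n (\<lambda>X. of_bool ((i \<in> X) \<noteq> (j \<in> X))) \<le> (if i = j then 0 else 1)"
proof -
  have "avg n (\<lambda>X. of_bool ((i \<in> X) \<noteq> (j \<in> X))) \<le> avg n (\<lambda>_. if i = j then 0 else 1)"
    by (rule avg_mono) auto
  then show ?thesis by (simp add: avg_const)
qed

lemma total_influence_dictator: "i < n \<Longrightarrow> total_influence n (\<lambda>X. i \<in> X) = 1"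
proof -
  assume i: "i < n"
  have "influence n (\<lambda>X. i \<in> X) j = (if j = i then 1 else 0)" for j
  proof -
    have "of_bool ((i \<in> X) \<noteq> (i \<in> flip j X)) = (if j = i then 1 else 0 :: real)" for X
      by (auto simp: flip_def)
    then show ?thesis unfolding influence_def by (simp add: avg_const)
  qed
  then show ?thesis using i by (simp add: total_influence_def)
qed

lemma antipodal_dictator: "i < n \<Longrightarrow> antipodal n (\<lambda>X. i \<in> X) = 1"
proof -
  assume i: "i < n"
  have "antipodal n (\<lambda>X. i \<in> X) = avg n (\<lambda>_. 1)"
    unfolding antipodal_def by (rule avg_cong) (use i in auto)
  then show ?thesis by (simp add: avg_const)
qed

lemma node_of: "node N (c div 2 ^ N) (pts N c) = c"
  by (simp add: node_def pts_conv div_mult_mod_eq)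

section \<open>Weight and demand of a cut, edge by edge\<close>

locale reduction =
  fixes N r :: nat and M B :: rat and U :: ug
  assumes wf: "wf_ug N U" and N: "1 \<le> N" and r: "1 \<le> r" and M: "0 \<le> M"
begin

abbreviation "K \<equiv> 2 ^ (N + r) :: nat"
abbreviation "edges \<equiv> set (ug_edges U)"
abbreviation "inst \<equiv> bes_of N K M B U"
abbreviation "wt e \<equiv> real_of_rat (ug_wt U e)"

definition pos :: "nat \<times> nat \<Rightarrow> nat" where
  "pos e = edge_starts N U (THE i. i < length (ug_edges U) \<and> ug_edges U ! i = e)"

definition pull :: "nat \<times> nat \<Rightarrow> nat set \<Rightarrow> nat set" where
  "pull e X = {i. i < N \<and> ug_perm U e i \<in> X}"

definition side :: "nat set \<Rightarrow> nat \<Rightarrow> nat \<Rightarrow> bool" where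
  "side S p c \<longleftrightarrow> p * K + c \<in> S"

text \<open>The earlier node lies outside the block of \<open>e\<close>, so exactly the heavy edges
  are covered. The light ones are counted by \<open>inner_cut\<close>, without the factor
  \<open>wt e\<close>.\<close>

definition ties :: "nat set \<Rightarrow> nat \<times> nat \<Rightarrow> real" where
  "ties S e = (\<Sum>c<K. \<Sum>q<pos e. \<Sum>c'<K. if side S q c' \<noteq> side S (pos e) c
      then real_of_rat (link N M U (Some e) (pos e) c q c') else 0)"

definition inner_cut :: "nat set \<Rightarrow> nat \<times> nat \<Rightarrow> real" where
  "inner_cut S e = (\<Sum>c<K. \<Sum>c'<c. if adj N c c' \<and> side S (pos e) c \<noteq> side S (pos e) c' then 1 else 0)"

lemma distinct: "distinct (ug_edges U)"
  using wf by (simp add: wf_ug_def)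

lemma wt_pos: "e \<in> edges \<Longrightarrow> 0 < wt e"
  using wf by (simp add: wf_ug_def)

lemma sum_wt: "(\<Sum>e\<in>edges. wt e) = 1"
proof -
  have "(\<Sum>e\<in>edges. wt e) = real_of_rat (\<Sum>e\<in>edges. ug_wt U e)" by (simp add: of_rat_sum)
  then show ?thesis using wf by (simp add: wf_ug_def)
qed

lemma perm: "e \<in> edges \<Longrightarrow> bij_betw (ug_perm U e) {..<N} {..<N}"
  using wf by (simp add: wf_ug_def)

lemma ends: "e \<in> edges \<Longrightarrow> fst e < ug_size U \<and> snd e < ug_size U \<and> fst e \<noteq> snd e"
  using wf by (auto simp: wf_ug_def)

lemma pos_nth: "i < length (ug_edges U) \<Longrightarrow> pos (ug_edges U ! i) = edge_starts N U i"
proof -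
  assume i: "i < length (ug_edges U)"
  have "(THE j. j < length (ug_edges U) \<and> ug_edges U ! j = ug_edges U ! i) = i"
    using i distinct by (intro the_equality) (auto simp: nth_eq_iff_index_eq)
  then show ?thesis by (simp add: pos_def)
qed

lemma edge_at_pos: "e \<in> edges \<Longrightarrow> edge_at N U (pos e) = Some e"
  by (metis edge_at_start in_set_conv_nth pos_nth)

lemma edge_at_iff: "edge_at N U p = Some e \<longleftrightarrow> e \<in> edges \<and> p = pos e"
  using edge_at_pos edge_at_SomeD pos_nth nth_mem by metis

lemma size_less_pos: "e \<in> edges \<Longrightarrow> ug_size U < pos e"
  by (auto simp: in_set_conv_nth pos_nth edge_starts_def)

lemma pos_less: "e \<in> edges \<Longrightarrow> pos e < length (enc_ug N U) + 1"
proof -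
  assume "e \<in> edges"
  then obtain i where i: "i < length (ug_edges U)" "pos e = edge_starts N U i"
    by (metis in_set_conv_nth pos_nth)
  moreover have "edge_starts N U (length (ug_edges U)) = length (enc_ug N U) + 1"
    by (simp add: edge_starts_def enc_ug_conv)
  ultimately show ?thesis using edge_starts_mono[of i "length (ug_edges U)" U N] by simp
qed

lemma inj_pos: "inj_on pos edges"
  by (rule inj_onI) (metis edge_at_pos option.inject)

lemma sum_edge_at:
  fixes G :: "nat \<times> nat \<Rightarrow> nat \<Rightarrow> 'a::comm_monoid_add"
  shows "(\<Sum>p<length (enc_ug N U) + 1. case edge_at N U p of None \<Rightarrow> 0 | Some e \<Rightarrow> G e p) = (\<Sum>e\<in>edges. G e (pos e))"
proof -
  let ?F = "\<lambda>p. case edge_at N U p of None \<Rightarrow> 0 | Some e \<Rightarrow> G e p"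
  have "(\<Sum>p<length (enc_ug N U) + 1. ?F p) = (\<Sum>p\<in>pos ` edges. ?F p)"
  proof (rule sum.mono_neutral_right)
    show "\<forall>p\<in>{..<length (enc_ug N U) + 1} - pos ` edges. ?F p = 0"
    proof
      fix p assume "p \<in> {..<length (enc_ug N U) + 1} - pos ` edges"
      then have "edge_at N U p = None" using edge_at_iff[of p] by (cases "edge_at N U p") auto
      then show "?F p = 0" by simp
    qed
  qed (use pos_less in auto)
  also have "\<dots> = (\<Sum>e\<in>edges. ?F (pos e))" by (simp add: sum.reindex[OF inj_pos])
  also have "\<dots> = (\<Sum>e\<in>edges. G e (pos e))" by (rule sum.cong) (auto simp: edge_at_pos)
  finally show ?thesis .
qed

text \<open>A pair has weight or demand only if its later node lies in the block of an edge, so sums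
  over all pairs collapse to sums over constraints. The parameter \<open>P\<close> covers both the
  pairs separated by a cut and all pairs.\<close>

lemma sum_inst:
  fixes h :: "(nat \<times> nat) option \<Rightarrow> nat \<Rightarrow> nat \<Rightarrow> nat \<Rightarrow> nat \<Rightarrow> rat" and P :: "nat \<Rightarrow> nat \<Rightarrow> bool"
  assumes f: "\<And>u v. u < v \<Longrightarrow> f {u, v} = h (edge_at N U (v div K)) (v div K) (v mod K) (u div K) (u mod K)"
    and none: "\<And>p c q c'. h None p c q c' = 0"
  shows "real_of_rat (\<Sum>v<bes_size inst. \<Sum>u<v. if P u v then f {u, v} else 0) =
    (\<Sum>e\<in>edges. \<Sum>c<K. (\<Sum>q<pos e. \<Sum>c'<K. if P (q * K + c') (pos e * K + c) then real_of_rat (h (Some e) (pos e) c q c') else 0)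
      + (\<Sum>c'<c. if P (pos e * K + c') (pos e * K + c) then real_of_rat (h (Some e) (pos e) c (pos e) c') else 0))"
proof -
  define H where "H p c q c' = (if P (q * K + c') (p * K + c) then real_of_rat (h (edge_at N U p) p c q c') else 0)" for p c q c'
  have size: "bes_size inst = (length (enc_ug N U) + 1) * K" by (simp add: bes_of_def)
  have "real_of_rat (\<Sum>v<bes_size inst. \<Sum>u<v. if P u v then f {u, v} else 0) =
    (\<Sum>v<bes_size inst. \<Sum>u<v. H (v div K) (v mod K) (u div K) (u mod K))"
    unfolding of_rat_sum by (intro sum.cong refl) (auto simp: H_def f div_mult_mod_eq)
  also have "\<dots> = (\<Sum>p<length (enc_ug N U) + 1. \<Sum>c<K. (\<Sum>q<p. \<Sum>c'<K. H p c q c') + (\<Sum>c'<c. H p c p c'))"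
    unfolding size by (rule sum_pairs_blocks)
  also have "\<dots> = (\<Sum>p<length (enc_ug N U) + 1. case edge_at N U p of None \<Rightarrow> 0 | Some e \<Rightarrow>
     \<Sum>c<K. (\<Sum>q<p. \<Sum>c'<K. if P (q * K + c') (p * K + c) then real_of_rat (h (Some e) p c q c') else 0)
      + (\<Sum>c'<c. if P (p * K + c') (p * K + c) then real_of_rat (h (Some e) p c p c') else 0))"
    by (rule sum.cong[OF refl]) (auto simp: H_def none cong: if_cong split: option.split)
  finally show ?thesis by (simp only: sum_edge_at)
qed

lemma link_inst: "u < v \<Longrightarrow> bes_wt inst {u, v} = link N M U (edge_at N U (v div K)) (v div K) (v mod K) (u div K) (u mod K)"
  by (simp add: bes_of_def max_absorb2 min_absorb1)

lemma demand_inst: "u < v \<Longrightarrow> bes_dem inst {u, v} = demand N U (edge_at N U (v div K)) (v div K) (v mod K) (u div K) (u mod K)"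
  by (simp add: bes_of_def max_absorb2 min_absorb1)

lemma cut_weight_eq: "real_of_rat (cut_weight inst S) = (\<Sum>e\<in>edges. ties S e + wt e * inner_cut S e)"
proof -
  have own: "(if side S (pos e) c' \<noteq> side S (pos e) c then real_of_rat (link N M U (Some e) (pos e) c (pos e) c') else 0)
     = wt e * (if adj N c c' \<and> side S (pos e) c \<noteq> side S (pos e) c' then 1 else 0)" for e c c'
    by (auto simp: link_def)
  have "real_of_rat (cut_weight inst S) = (\<Sum>e\<in>edges. \<Sum>c<K. (\<Sum>q<pos e. \<Sum>c'<K.
       if side S q c' \<noteq> side S (pos e) c then real_of_rat (link N M U (Some e) (pos e) c q c') else 0)
      + (\<Sum>c'<c. if side S (pos e) c' \<noteq> side S (pos e) c then real_of_rat (link N M U (Some e) (pos e) c (pos e) c') else 0))"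
    unfolding cut_weight_def sum_cut_edges side_def
    by (rule sum_inst) (auto simp: link_inst, simp add: link_def)
  also have "\<dots> = (\<Sum>e\<in>edges. ties S e + wt e * inner_cut S e)"
    unfolding own ties_def inner_cut_def sum.distrib sum_distrib_left ..
  finally show ?thesis .
qed

lemma cut_demand_eq: "real_of_rat (\<Sum>e\<in>cut_edges inst S. bes_dem inst e) =
  2 ^ N / 2 * (\<Sum>e\<in>edges. wt e * antipodal N (\<lambda>X. side S (pos e) (node N 0 X)))"
proof -
  have other: "(\<Sum>q<pos e. \<Sum>c'<K. if Q q c' then real_of_rat (demand N U (Some e) (pos e) c q c') else 0) = 0" for e c Q
    by (intro sum.neutral ballI) (simp add: demand_def)
  have own: "(if side S (pos e) c' \<noteq> side S (pos e) c then real_of_rat (demand N U (Some e) (pos e) c (pos e) c') else 0)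
     = wt e * (if anti N c c' \<and> side S (pos e) c \<noteq> side S (pos e) c' then 1 else 0)" for e c c'
    by (auto simp: demand_def)
  have "real_of_rat (\<Sum>e\<in>cut_edges inst S. bes_dem inst e) = (\<Sum>e\<in>edges. \<Sum>c<K. (\<Sum>q<pos e. \<Sum>c'<K.
       if side S q c' \<noteq> side S (pos e) c then real_of_rat (demand N U (Some e) (pos e) c q c') else 0)
      + (\<Sum>c'<c. if side S (pos e) c' \<noteq> side S (pos e) c then real_of_rat (demand N U (Some e) (pos e) c (pos e) c') else 0))"
    unfolding sum_cut_edges side_def
    by (rule sum_inst) (auto simp: demand_inst, simp add: demand_def)
  also have "\<dots> = (\<Sum>e\<in>edges. wt e * (\<Sum>c<K. \<Sum>c'<c. if anti N c c' \<and> side S (pos e) c \<noteq> side S (pos e) c' then 1 else 0))"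
    unfolding own other sum_distrib_left by simp
  also have "\<dots> = 2 ^ N / 2 * (\<Sum>e\<in>edges. wt e * antipodal N (\<lambda>X. side S (pos e) (node N 0 X)))"
    unfolding cut_anti_count[OF N] sum_distrib_left by (simp add: mult_ac)
  finally show ?thesis .
qed

text \<open>The dictator cut of coordinate 0 separates every antipodal pair, so the count of
  separated pairs also gives the total.\<close>

lemma total_demand_eq: "real_of_rat (bes_total_dem inst) = 2 ^ N / 2"
proof -
  have other: "(\<Sum>q<pos e. \<Sum>c'<K. real_of_rat (demand N U (Some e) (pos e) c q c')) = 0" for e c
    by (intro sum.neutral ballI) (simp add: demand_def)
  have "anti N c c' \<Longrightarrow> (0 \<in> pts N c) \<noteq> (0 \<in> pts N c')" for c c'
    using N by (auto simp: anti_def)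
  then have own: "real_of_rat (demand N U (Some e) (pos e) c (pos e) c')
     = wt e * (if anti N c c' \<and> (0 \<in> pts N c) \<noteq> (0 \<in> pts N c') then 1 else 0)" for e c c'
    by (auto simp: demand_def)
  have "real_of_rat (bes_total_dem inst) = (\<Sum>e\<in>edges. \<Sum>c<K. (\<Sum>q<pos e. \<Sum>c'<K.
       real_of_rat (demand N U (Some e) (pos e) c q c'))
      + (\<Sum>c'<c. real_of_rat (demand N U (Some e) (pos e) c (pos e) c')))"
    unfolding bes_total_dem_def sum_edges
    using sum_inst[of "bes_dem inst" "demand N U" "\<lambda>_ _. True"] by (simp add: demand_inst demand_def)
  also have "\<dots> = (\<Sum>e\<in>edges. wt e * (\<Sum>c<K. \<Sum>c'<c. if anti N c c' \<and> (0 \<in> pts N c) \<noteq> (0 \<in> pts N c') then 1 else 0))"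
    unfolding own other sum_distrib_left by simp
  also have "\<dots> = (\<Sum>e\<in>edges. wt e * (2 ^ N / 2 * antipodal N (\<lambda>X. 0 \<in> pts N (node N 0 X))))"
    unfolding cut_anti_count[OF N] ..
  also have "antipodal N (\<lambda>X. 0 \<in> pts N (node N 0 X)) = antipodal N (\<lambda>X. 0 \<in> X)"
    unfolding antipodal_def by (rule avg_cong) simp
  also have "\<dots> = 1" by (rule antipodal_dictator) (use N in simp)
  finally show ?thesis by (simp add: sum_wt flip: sum_divide_distrib sum_distrib_right)
qed

lemma wf_inst:
  assumes "B = bes_total_dem inst / 2"
  shows "wf_bes inst"
proof -
  have "0 \<le> link N M U (edge_at N U p) p c q c' \<and> 0 \<le> demand N U (edge_at N U p) p c q c'" for p c q c'
  proof (cases "edge_at N U p")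
    case (Some e)
    then have "0 < ug_wt U e" using wf edge_at_iff[of p e] by (simp add: wf_ug_def)
    then show ?thesis using M Some by (simp add: link_def demand_def)
  qed (simp add: link_def demand_def)
  moreover have "0 \<le> bes_total_dem inst"
    using total_demand_eq by (metis divide_nonneg_pos of_rat_0 of_rat_less_eq zero_le_numeral zero_le_power zero_less_numeral)
  ultimately show ?thesis using assms by (simp add: wf_bes_def bes_of_def)
qed

lemma ties_nonneg: "0 \<le> ties S e"
proof -
  have "0 \<le> link N M U (Some e) (pos e) c q c'" if "q \<noteq> pos e" for c q c'
    using M that by (simp add: link_def)
  then show ?thesis unfolding ties_def by (intro sum_nonneg) auto
qed

text \<open>In other words, no pair joined by a heavy edge of \<open>e\<close> is separated.\<close>

definition tied :: "nat set \<Rightarrow> nat \<times> nat \<Rightarrow> bool" where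
  "tied S e \<longleftrightarrow> (\<forall>X\<subseteq>{..<N}. side S (pos e) (node N 0 X) = side S (fst e) (node N 0 X)) \<and>
    (\<forall>t X. 1 \<le> t \<longrightarrow> t < 2 ^ r \<longrightarrow> X \<subseteq> {..<N} \<longrightarrow>
       side S (pos e) (node N t X) = side S (snd e) (node N 0 (pull e X)))"

lemma pull_subset: "pull e X \<subseteq> {..<N}"
  by (auto simp: pull_def)

lemma ties_eq_0:
  assumes "tied S e"
  shows "ties S e = 0"
  unfolding ties_def
proof (intro sum.neutral ballI)
  fix c q c' assume c: "c \<in> {..<K}" and q: "q \<in> {..<pos e}" and c': "c' \<in> {..<K}"
  have t: "c div 2 ^ N < 2 ^ r" using c by (simp add: power_add less_mult_imp_div_less mult.commute)
  show "(if side S q c' \<noteq> side S (pos e) c then real_of_rat (link N M U (Some e) (pos e) c q c') else 0) = 0"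
  proof (cases "c div 2 ^ N = 0")
    case True
    have "side S (pos e) c = side S (fst e) c"
      using assms pts_subset[of N c] node_of[of N c] True unfolding tied_def by metis
    moreover have "c' = c" if "c' div 2 ^ N = 0" "pts N c' = pts N c"
      using that True node_of[of N c] node_of[of N c'] by metis
    ultimately show ?thesis using q True by (auto simp: link_def)
  next
    case False
    have "side S (pos e) c = side S (snd e) (node N 0 (pull e (pts N c)))"
      using assms pts_subset[of N c] node_of[of N c] False t unfolding tied_def
      by (metis Suc_leI One_nat_def gr0I)
    moreover have "c' = node N 0 (pull e (pts N c))"
      if "c' div 2 ^ N = 0" "pts N c' = {i. i < N \<and> ug_perm U e i \<in> pts N c}"
      using that node_of[of N c'] by (simp add: pull_def)
    ultimately show ?thesis using q False by (auto simp: link_def)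
  qed
qed

text \<open>The summands of \<open>ties\<close> are nonnegative, and a single separated heavy edge
  already costs \<open>M\<close>.\<close>

lemma tied_if:
  assumes e: "e \<in> edges" and less: "ties S e < real_of_rat M"
  shows "tied S e"
proof -
  define g where "g c q c' = (if side S q c' \<noteq> side S (pos e) c
      then real_of_rat (link N M U (Some e) (pos e) c q c') else 0)" for c q c'
  have g0: "0 \<le> g c q c'" if "q < pos e" for c q c'
    using M that by (simp add: g_def link_def)
  have g: "g c q c' \<le> ties S e" if "c < K" "q < pos e" "c' < K" for c q c'
  proof -
    have "g c q c' \<le> (\<Sum>c'<K. g c q c')" by (rule member_le_sum) (use that g0 in auto)
    also have "\<dots> \<le> (\<Sum>q<pos e. \<Sum>c'<K. g c q c')"
      by (rule member_le_sum[where f = "\<lambda>q. \<Sum>c'<K. g c q c'"]) (use that g0 in \<open>auto intro!: sum_nonneg\<close>)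
    also have "\<dots> \<le> (\<Sum>c<K. \<Sum>q<pos e. \<Sum>c'<K. g c q c')"
      by (rule member_le_sum[where f = "\<lambda>c. \<Sum>q<pos e. \<Sum>c'<K. g c q c'"]) (use that g0 in \<open>auto intro!: sum_nonneg\<close>)
    finally show ?thesis by (simp add: ties_def g_def)
  qed
  have q: "fst e < pos e" "snd e < pos e" using ends[OF e] size_less_pos[OF e] by auto
  have "side S (pos e) (node N 0 X) = side S (fst e) (node N 0 X)" if X: "X \<subseteq> {..<N}" for X
  proof (rule ccontr)
    assume "\<not> ?thesis"
    then have "g (node N 0 X) (fst e) (node N 0 X) = real_of_rat M"
      using X q by (simp add: g_def link_def)
    moreover have "node N 0 X < K" by (rule node_less[OF X]) simp
    ultimately show False using g[of "node N 0 X" "fst e" "node N 0 X"] q less by simp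
  qed
  moreover have "side S (pos e) (node N t X) = side S (snd e) (node N 0 (pull e X))"
    if X: "X \<subseteq> {..<N}" and t: "1 \<le> t" "t < 2 ^ r" for t X
  proof (rule ccontr)
    assume "\<not> ?thesis"
    then have "g (node N t X) (snd e) (node N 0 (pull e X)) = real_of_rat M"
      using X q t pull_subset[of e X] by (simp add: g_def link_def) (simp add: pull_def)
    moreover have "node N t X < K" "node N 0 (pull e X) < K"
      using node_less X t pull_subset by auto
    ultimately show False using g[of "node N t X" "snd e" "node N 0 (pull e X)"] q less by simp
  qed
  ultimately show ?thesis by (simp add: tied_def)
qed

lemma inner_cut_tied:
  assumes "tied S e"
  shows "inner_cut S e = 2 ^ N * ((total_influence N (\<lambda>X. side S (fst e) (node N 0 X)) +
      total_influence N (\<lambda>X. side S (snd e) (node N 0 (pull e X)))) / 2 +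
      (2 ^ r - 1) * avg N (\<lambda>X. of_bool (side S (snd e) (node N 0 (pull e X)) \<noteq> side S (fst e) (node N 0 X))))"
proof -
  have r2: "(1::nat) < 2 ^ r" using r by (intro one_less_power) auto
  have t0: "side S (pos e) (node N 0 X) = side S (fst e) (node N 0 X)" if "X \<subseteq> {..<N}" for X
    using assms that by (simp add: tied_def)
  have t1: "side S (pos e) (node N t X) = side S (snd e) (node N 0 (pull e X))"
    if "X \<subseteq> {..<N}" "1 \<le> t" "t < 2 ^ r" for t X
    using assms that by (simp add: tied_def)
  have ti: "total_influence N f = total_influence N g" if "\<And>X. X \<subseteq> {..<N} \<Longrightarrow> f X = g X" for f g
    unfolding total_influence_def influence_def
    by (intro sum.cong refl avg_cong) (use that flip_subset in auto)
  have "(\<Sum>t=1..<2 ^ r. avg N (\<lambda>X. of_bool (side S (pos e) (node N t X) \<noteq> side S (pos e) (node N 0 X)))) =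
    (\<Sum>t=1..<2 ^ r :: nat. avg N (\<lambda>X. of_bool (side S (snd e) (node N 0 (pull e X)) \<noteq> side S (fst e) (node N 0 X))))"
    by (intro sum.cong refl avg_cong) (simp add: t0 t1)
  also have "\<dots> = (2 ^ r - 1) * avg N (\<lambda>X. of_bool (side S (snd e) (node N 0 (pull e X)) \<noteq> side S (fst e) (node N 0 X)))"
    using r2 by (simp add: of_nat_diff)
  finally show ?thesis
    unfolding inner_cut_def cut_adj_count[OF r]
    using ti[OF t0] ti[OF t1[OF _ _ r2]] by simp
qed

end

section \<open>Perturbation of influences and random choices\<close>

lemma influence_nonneg: "0 \<le> influence n f i"
  unfolding influence_def by (rule avg_nonneg) simp

lemma total_influence_nonneg: "0 \<le> total_influence n f"
  unfolding total_influence_def by (rule sum_nonneg) (simp add: influence_nonneg)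

lemma antipodal_le_1: "antipodal n f \<le> 1"
  unfolding antipodal_def using avg_mono[of n _ "\<lambda>_. 1"] by (simp add: avg_const)

lemma total_influence_cong:
  assumes "\<And>X. X \<subseteq> {..<n} \<Longrightarrow> f X = g X"
  shows "total_influence n f = total_influence n g"
  unfolding total_influence_def influence_def
  by (intro sum.cong refl avg_cong) (use assms flip_subset in auto)

lemma antipodal_cong:
  assumes "\<And>X. X \<subseteq> {..<n} \<Longrightarrow> f X = g X"
  shows "antipodal n f = antipodal n g"
  unfolding antipodal_def by (rule avg_cong) (use assms in auto)

text \<open>If \<open>f\<close> changes in direction \<open>i\<close> and \<open>g\<close> does not,
  the two functions differ at one of the two ends; each end is uniformly distributed, hence the
  factor 2.\<close>

lemma influence_perturb:
  assumes i: "i < n"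
  shows "influence n f i \<le> influence n g i + 2 * avg n (\<lambda>x. of_bool (g x \<noteq> f x))"
proof -
  let ?d = "\<lambda>x. of_bool (g x \<noteq> f x) :: real"
  have "influence n f i \<le> avg n (\<lambda>x. of_bool (g x \<noteq> g (flip i x)) + (?d x + ?d (flip i x)))"
    unfolding influence_def by (rule avg_mono) auto
  then show ?thesis unfolding avg_add avg_flip[OF i, of ?d] by (simp add: influence_def)
qed

text \<open>The factor \<open>m * m\<close> on the left avoids the exponent
  \<open>n - 2\<close>.\<close>

lemma card_PiE_two:
  fixes v w n m :: nat
  assumes "v < n" "w < n" "v \<noteq> w" "a < m" "b < m"
  shows "card {j \<in> {..<n} \<rightarrow>\<^sub>E {..<m}. j v = a \<and> j w = b} * (m * m) = m ^ n"
proof -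
  let ?F = "\<lambda>u. if u = v then {a} else if u = w then {b} else {..<m}"
  have "{j \<in> {..<n} \<rightarrow>\<^sub>E {..<m}. j v = a \<and> j w = b} = Pi\<^sub>E {..<n} ?F"
  proof (intro set_eqI iffI)
    fix j assume "j \<in> Pi\<^sub>E {..<n} ?F"
    then have j: "\<And>u. u < n \<Longrightarrow> j u \<in> ?F u" "j \<in> extensional {..<n}" by (auto simp: PiE_iff)
    have "j v = a" "j w = b" using j(1)[of v] j(1)[of w] assms by auto
    moreover have "j u < m" if "u < n" for u using j(1)[OF that] assms(4,5) by (auto split: if_splits)
    ultimately show "j \<in> {j \<in> {..<n} \<rightarrow>\<^sub>E {..<m}. j v = a \<and> j w = b}" using j(2) by (auto simp: PiE_iff)
  qed (use assms in \<open>auto simp: PiE_iff\<close>)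
  then have "card {j \<in> {..<n} \<rightarrow>\<^sub>E {..<m}. j v = a \<and> j w = b} = (\<Prod>u<n. card (?F u))"
    by (simp add: card_PiE)
  also have "\<dots> = (\<Prod>u<n. if u = v \<or> u = w then 1 else m)"
    by (rule prod.cong) auto
  finally have c: "card {j \<in> {..<n} \<rightarrow>\<^sub>E {..<m}. j v = a \<and> j w = b} = (\<Prod>u<n. if u = v \<or> u = w then 1 else m)" .
  have mm: "m * m = (\<Prod>u<n. if u = v then m else 1) * (\<Prod>u<n. if u = w then m else 1)"
    using assms by (simp add: prod.delta)
  have "(\<Prod>u<n. if u = v \<or> u = w then 1 else m) * (m * m) = (\<Prod>u<n. m)"
    unfolding mm prod.distrib[symmetric] using assms(3) by (intro prod.cong) auto
  then show ?thesis by (simp add: c)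
qed

text \<open>A uniformly random choice agrees with both prescriptions of an edge with probability \<open>1 / m\<^sup>2\<close>.\<close>

lemma exists_good_choice:
  fixes w :: "nat \<times> nat \<Rightarrow> real"
  assumes G: "finite G" "\<And>e. e \<in> G \<Longrightarrow> 0 \<le> w e \<and> fst e < n \<and> snd e < n \<and> fst e \<noteq> snd e \<and> \<alpha> e < m \<and> \<beta> e < m"
    and m: "0 < m"
  obtains j where "j \<in> {..<n} \<rightarrow>\<^sub>E {..<m}"
    "(\<Sum>e\<in>G. w e) / (real m)\<^sup>2 \<le> (\<Sum>e | e \<in> G \<and> j (fst e) = \<alpha> e \<and> j (snd e) = \<beta> e. w e)"
proof -
  let ?J = "{..<n} \<rightarrow>\<^sub>E {..<m}"
  let ?v = "\<lambda>j. \<Sum>e | e \<in> G \<and> j (fst e) = \<alpha> e \<and> j (snd e) = \<beta> e. w e"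
  have fin: "finite ?J" by (simp add: finite_PiE)
  have card: "card ?J = m ^ n" by (simp add: card_PiE)
  have ne: "?J \<noteq> {}" using m by (auto simp: PiE_eq_empty_iff)
  have "(\<Sum>j\<in>?J. ?v j) = (\<Sum>j\<in>?J. \<Sum>e\<in>G. if j (fst e) = \<alpha> e \<and> j (snd e) = \<beta> e then w e else 0)"
    by (rule sum.cong[OF refl]) (simp add: sum.inter_filter G(1))
  also have "\<dots> = (\<Sum>e\<in>G. \<Sum>j\<in>?J. if j (fst e) = \<alpha> e \<and> j (snd e) = \<beta> e then w e else 0)"
    by (rule sum.swap)
  also have "\<dots> = (\<Sum>e\<in>G. real (m ^ n) * (w e / (real m)\<^sup>2))"
  proof (rule sum.cong[OF refl])
    fix e assume e: "e \<in> G"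
    have "(\<Sum>j\<in>?J. if j (fst e) = \<alpha> e \<and> j (snd e) = \<beta> e then w e else 0)
       = real (card {j \<in> ?J. j (fst e) = \<alpha> e \<and> j (snd e) = \<beta> e}) * w e"
      using fin by (simp add: sum.inter_filter[symmetric])
    moreover have "real (card {j \<in> ?J. j (fst e) = \<alpha> e \<and> j (snd e) = \<beta> e}) * (real m)\<^sup>2 = real (m ^ n)"
      using card_PiE_two[of "fst e" n "snd e" "\<alpha> e" m "\<beta> e"] G(2)[OF e]
      by (simp add: power2_eq_square flip: of_nat_mult)
    ultimately show "(\<Sum>j\<in>?J. if j (fst e) = \<alpha> e \<and> j (snd e) = \<beta> e then w e else 0) = real (m ^ n) * (w e / (real m)\<^sup>2)"
      using m by (simp add: field_simps flip: power_mult_distrib)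
  qed
  also have "\<dots> = (\<Sum>j\<in>?J. (\<Sum>e\<in>G. w e) / (real m)\<^sup>2)"
    by (simp only: sum_constant card sum_distrib_left[symmetric] sum_divide_distrib)
  finally have eq: "(\<Sum>j\<in>?J. ?v j) = (\<Sum>j\<in>?J. (\<Sum>e\<in>G. w e) / (real m)\<^sup>2)" .
  have "\<exists>j\<in>?J. (\<Sum>e\<in>G. w e) / (real m)\<^sup>2 \<le> ?v j"
  proof (rule ccontr)
    assume "\<not> ?thesis"
    then have "(\<Sum>j\<in>?J. ?v j) < (\<Sum>j\<in>?J. (\<Sum>e\<in>G. w e) / (real m)\<^sup>2)"
      using fin ne by (intro sum_strict_mono) (auto simp: not_le)
    then show False using eq by simp
  qed
  then show thesis using that by blast
qed

section \<open>Completeness and soundness\<close>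

context reduction
begin

lemma bij_pull:
  assumes e: "e \<in> edges"
  shows "bij_betw (pull e) (Pow {..<N}) (Pow {..<N})"
proof (rule bij_betw_imageI)
  have surj: "ug_perm U e ` {..<N} = {..<N}" using perm[OF e] by (simp add: bij_betw_def)
  show "inj_on (pull e) (Pow {..<N})"
  proof (rule inj_onI)
    fix X Y assume XY: "X \<in> Pow {..<N}" "Y \<in> Pow {..<N}" "pull e X = pull e Y"
    have "i \<in> X \<longleftrightarrow> i \<in> Y" if "i < N" for i
    proof -
      have "i \<in> ug_perm U e ` {..<N}" using surj that by simp
      then obtain k where "k < N" "i = ug_perm U e k" by auto
      then show ?thesis using XY(3) unfolding pull_def by blast
    qed
    then show "X = Y" using XY by blast
  qed
  have "Z \<in> pull e ` Pow {..<N}" if "Z \<subseteq> {..<N}" for Z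
  proof (rule image_eqI)
    have inj: "inj_on (ug_perm U e) {..<N}" using perm[OF e] by (simp add: bij_betw_def)
    show "Z = pull e (ug_perm U e ` Z)"
      using that inj by (auto simp: pull_def dest: inj_onD)
    show "ug_perm U e ` Z \<in> Pow {..<N}" using that surj by blast
  qed
  then show "pull e ` Pow {..<N} = Pow {..<N}" using pull_subset by blast
qed

text \<open>Pulling back renames the coordinates and permutes the points of the cube, so averages
  are preserved.\<close>

lemma influence_pull:
  assumes e: "e \<in> edges" and j: "j < N"
  shows "influence N (\<lambda>X. f (pull e X)) (ug_perm U e j) = influence N f j"
proof -
  have inj: "inj_on (ug_perm U e) {..<N}" using perm[OF e] by (simp add: bij_betw_def)
  have fl: "pull e (flip (ug_perm U e j) X) = flip j (pull e X)" for X
    using inj j by (auto simp: pull_def flip_def dest: inj_onD)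
  have "avg N (\<lambda>X. F (pull e X)) = avg N F" for F
    unfolding avg_def using sum.reindex_bij_betw[OF bij_pull[OF e], of F] by simp
  from this[of "\<lambda>X. of_bool (f X \<noteq> f (flip j X))"] show ?thesis
    by (simp add: influence_def fl)
qed

lemma total_influence_pull:
  assumes e: "e \<in> edges"
  shows "total_influence N (\<lambda>X. f (pull e X)) = total_influence N f"
  unfolding total_influence_def
  using sum.reindex_bij_betw[OF perm[OF e], of "influence N (\<lambda>X. f (pull e X))"]
  by (simp add: influence_pull[OF e])

lemma value_eq: "real_of_rat (ug_value U l) = (\<Sum>e | e \<in> edges \<and> ug_satisfies U l e. wt e)"
  by (simp add: ug_value_def of_rat_sum)

lemma edge_at_vertex: "p < ug_size U \<Longrightarrow> edge_at N U p = None"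
  by (rule edge_at_before) (simp add: edge_starts_def)

text \<open>The labels define dictators in all cubes, and no heavy edge is cut. Both endpoint
  functions have total influence 1, so a satisfied constraint costs \<open>2 ^ N\<close> times its
  weight and a violated one at most \<open>2 ^ r - 1\<close> times that amount in addition. The
  condition on \<eta> bounds this addition by \<open>2 ^ N\<close> overall.\<close>

lemma completeness:
  assumes l: "\<And>v. v < ug_size U \<Longrightarrow> l v < N" and val: "1 - \<eta> \<le> real_of_rat (ug_value U l)"
    and \<eta>: "(2 ^ r - 1) * \<eta> \<le> 1" and B: "B = bes_total_dem inst / 2"
  shows "\<exists>S. balanced_cut inst (bes_bal inst) S \<and> cut_weight inst S \<le> 2 ^ (N + 1)"
proof -
  \<comment> \<open>In an edge block the copies of the second endpoint follow the dictator of the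
    image of its label, which is the pulled back dictator. Blocks that belong neither to a vertex
    nor to an edge lie entirely on one side.\<close>
  define col where "col p c = (case edge_at N U p of
      Some e \<Rightarrow> (if c div 2 ^ N = 0 then l (fst e) \<in> pts N c else ug_perm U e (l (snd e)) \<in> pts N c)
    | None \<Rightarrow> p < ug_size U \<and> l p \<in> pts N c)" for p c
  define S where "S = {v. v < bes_size inst \<and> col (v div K) (v mod K)}"
  have side: "side S p c = col p c" if "p < length (enc_ug N U) + 1" "c < K" for p c
  proof -
    have "p * K + c < Suc p * K" using that by simp
    also have "\<dots> \<le> (length (enc_ug N U) + 1) * K" using that by (intro mult_right_mono) auto
    finally show ?thesis using that by (simp add: side_def S_def bes_of_def)
  qed
  have sz: "ug_size U < length (enc_ug N U) + 1" by (simp add: enc_ug_conv)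
  have nless: "node N t X < K" if "X \<subseteq> {..<N}" "t < 2 ^ r" for t X using that by (rule node_less)
  have vert: "side S v (node N 0 X) \<longleftrightarrow> l v \<in> X" if "v < ug_size U" "X \<subseteq> {..<N}" for v X
    using that sz nless[of X 0] by (simp add: side col_def edge_at_vertex)
  have edg: "side S (pos e) (node N t X) \<longleftrightarrow> (if t = 0 then l (fst e) \<in> X else ug_perm U e (l (snd e)) \<in> X)"
    if "e \<in> edges" "X \<subseteq> {..<N}" "t < 2 ^ r" for e t X
    using that nless[of X t] pos_less[of e] by (simp add: side col_def edge_at_pos)
  have pl: "l (snd e) \<in> pull e X \<longleftrightarrow> ug_perm U e (l (snd e)) \<in> X" if "e \<in> edges" for e X
    using l[of "snd e"] ends[OF that] by (auto simp: pull_def)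
  have tied: "tied S e" if e: "e \<in> edges" for e
    unfolding tied_def using ends[OF e] pull_subset[of e]
    by (auto simp: edg[OF e] vert pl[OF e])
  have inner: "inner_cut S e \<le> 2 ^ N * (1 + (2 ^ r - 1) * (if ug_satisfies U l e then 0 else 1))" if e: "e \<in> edges" for e
  proof -
    have lt: "l (fst e) < N" "ug_perm U e (l (snd e)) < N"
      using l ends[OF e] bij_betwE[OF perm[OF e]] by auto
    have 1: "total_influence N (\<lambda>X. side S (fst e) (node N 0 X)) = 1"
      using total_influence_cong[of N "\<lambda>X. side S (fst e) (node N 0 X)" "\<lambda>X. l (fst e) \<in> X"] vert ends[OF e]
        total_influence_dictator[OF lt(1)] by simp
    have s2: "side S (snd e) (node N 0 (pull e X)) \<longleftrightarrow> ug_perm U e (l (snd e)) \<in> X" for X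
      using vert[OF _ pull_subset, of "snd e" e] ends[OF e] pl[OF e] by simp
    have 2: "total_influence N (\<lambda>X. side S (snd e) (node N 0 (pull e X))) = 1"
      using total_influence_dictator[OF lt(2)] by (simp add: s2)
    have "avg N (\<lambda>X. of_bool (side S (snd e) (node N 0 (pull e X)) \<noteq> side S (fst e) (node N 0 X))) =
       avg N (\<lambda>X. of_bool ((ug_perm U e (l (snd e)) \<in> X) \<noteq> (l (fst e) \<in> X)))"
      by (rule avg_cong) (use vert ends[OF e] s2 in auto)
    also have "\<dots> \<le> (if ug_satisfies U l e then 0 else 1)"
      using avg_dictator[OF lt(2), of "l (fst e)"] by (auto simp: ug_satisfies_def split: if_splits)
    finally have 3: "avg N (\<lambda>X. of_bool (side S (snd e) (node N 0 (pull e X)) \<noteq> side S (fst e) (node N 0 X)))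
        \<le> (if ug_satisfies U l e then 0 else 1)" .
    have "(0::real) \<le> 2 ^ r - 1" by simp
    then show ?thesis
      unfolding inner_cut_tied[OF tied[OF e]] 1 2 using 3 by (intro mult_left_mono add_mono) auto
  qed
  have "real_of_rat (cut_weight inst S) = (\<Sum>e\<in>edges. wt e * inner_cut S e)"
    unfolding cut_weight_eq by (rule sum.cong) (auto simp: ties_eq_0 tied)
  also have "\<dots> \<le> (\<Sum>e\<in>edges. wt e * (2 ^ N * (1 + (2 ^ r - 1) * (if ug_satisfies U l e then 0 else 1))))"
    by (intro sum_mono mult_left_mono inner) (auto dest: wt_pos)
  also have "\<dots> = (\<Sum>e\<in>edges. 2 ^ N * wt e + 2 ^ N * (2 ^ r - 1) * (wt e - (if ug_satisfies U l e then wt e else 0)))"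
    by (rule sum.cong) (auto simp: algebra_simps)
  also have "\<dots> = 2 ^ N * (1 + (2 ^ r - 1) * (1 - real_of_rat (ug_value U l)))"
  proof -
    have v: "(\<Sum>e\<in>edges. if ug_satisfies U l e then wt e else 0) = real_of_rat (ug_value U l)"
      by (simp add: value_eq sum.inter_filter)
    show ?thesis
      by (simp only: sum.distrib sum_subtractf sum_wt v flip: sum_distrib_left) (simp add: algebra_simps)
  qed
  also have "\<dots> \<le> 2 ^ N * (1 + (2 ^ r - 1) * \<eta>)"
    using val by (intro mult_left_mono add_left_mono) auto
  also have "\<dots> \<le> 2 ^ N * 2" using \<eta> by (intro mult_left_mono) auto
  also have "\<dots> = real_of_rat (2 ^ (N + 1))" by (simp add: of_rat_mult of_rat_power)
  finally have weight: "cut_weight inst S \<le> 2 ^ (N + 1)" by (simp only: of_rat_less_eq)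
  have "antipodal N (\<lambda>X. side S (pos e) (node N 0 X)) = 1" if e: "e \<in> edges" for e
    using antipodal_cong[of N "\<lambda>X. side S (pos e) (node N 0 X)" "\<lambda>X. l (fst e) \<in> X"] edg[OF e, of _ 0]
      antipodal_dictator[of "l (fst e)" N] l ends[OF e] by simp
  then have "real_of_rat (\<Sum>e\<in>cut_edges inst S. bes_dem inst e) = real_of_rat (bes_total_dem inst)"
    unfolding cut_demand_eq total_demand_eq using sum_wt by simp
  then have dem: "(\<Sum>e\<in>cut_edges inst S. bes_dem inst e) = bes_total_dem inst" by simp
  have "0 < real_of_rat (bes_total_dem inst)" unfolding total_demand_eq by simp
  then have pos: "0 < bes_total_dem inst" by simp
  \<comment> \<open>A trivial cut would separate no demand, but the separated demand is the positive
    total.\<close>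
  have "S \<noteq> {}"
  proof
    assume "S = {}"
    then have "cut_edges inst S = {}" by (auto simp: cut_edges_def)
    then show False using dem pos by simp
  qed
  moreover have "S \<noteq> {..<bes_size inst}"
  proof
    assume "S = {..<bes_size inst}"
    then have "cut_edges inst S = {}" by (auto simp: cut_edges_def bes_edges_def Int_absorb2)
    then show False using dem pos by simp
  qed
  moreover have "S \<subseteq> {..<bes_size inst}" by (auto simp: S_def)
  moreover have "bes_bal inst \<le> bes_total_dem inst" using pos B by (simp add: bes_of_def)
  ultimately have "balanced_cut inst (bes_bal inst) S"
    using dem by (simp add: balanced_cut_def nontrivial_cut_def)
  then show ?thesis using weight by blast
qed

text \<open>On average over the constraints the cost \<open>h\<close> is at most
  \<open>2 * C\<close> and the antipodal fraction \<open>a\<close> at least 1/6. A constraint with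
  small cost and large fraction has an influential coordinate at its first endpoint, and the
  corresponding coordinate at the second endpoint is nearly as influential because the two functions
  rarely disagree. Each endpoint of such a constraint has at most \<open>m\<close> candidates, so a
  random choice hits both with probability 1 / m^2.\<close>

lemma soundness:
  fixes C \<tau> :: real
  assumes C: "1 \<le> C" and big: "C * 2 ^ (N + 1) < real_of_rat M" and B: "B = bes_total_dem inst / 2"
    and \<tau>: "0 < \<tau>" "96 * C / (real d + 1) + 3 ^ d * sqrt \<tau> * (96 * C) < 1 / 12"
    and R: "192 * C / \<tau> \<le> 2 ^ r - 1" and m: "192 * C / \<tau> \<le> real m"
    and S: "balanced_cut inst (bes_bal inst / 3) S" "real_of_rat (cut_weight inst S) \<le> C * 2 ^ (N + 1)"
  obtains l where "l \<in> {..<ug_size U} \<rightarrow>\<^sub>E {..<N}" "1 / (24 * (real m)\<^sup>2) \<le> real_of_rat (ug_value U l)"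
proof -
  define f where "f u X = side S u (node N 0 X)" for u X
  define \<delta> where "\<delta> e = avg N (\<lambda>X. of_bool (f (snd e) (pull e X) \<noteq> f (fst e) X))" for e
  define a :: "nat \<times> nat \<Rightarrow> real" where "a e = antipodal N (f (fst e))" for e
  define h where "h e = (total_influence N (f (fst e)) + total_influence N (f (snd e))) / 2 + (2 ^ r - 1) * \<delta> e" for e
  define \<rho> :: real where "\<rho> = 2 ^ r - 1"
  have \<rho>0: "0 < \<rho>" using R C \<tau>(1) unfolding \<rho>_def by (smt (verit) divide_pos_pos)
  have mpos: "0 < m" using m C \<tau>(1) by (smt (verit) divide_pos_pos of_nat_0_less_iff)
  have tied: "tied S e" if e: "e \<in> edges" for e
  proof (rule tied_if[OF e])
    have "ties S e \<le> ties S e + wt e * inner_cut S e"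
      using wt_pos[OF e] by (auto simp: inner_cut_def intro!: mult_nonneg_nonneg sum_nonneg)
    also have "\<dots> \<le> (\<Sum>e\<in>edges. ties S e + wt e * inner_cut S e)"
      by (rule member_le_sum) (use e wt_pos in \<open>auto simp: inner_cut_def ties_nonneg less_imp_le intro!: add_nonneg_nonneg mult_nonneg_nonneg sum_nonneg\<close>)
    also have "\<dots> < real_of_rat M" using S(2) big by (simp add: cut_weight_eq)
    finally show "ties S e < real_of_rat M" .
  qed
  have inner: "inner_cut S e = 2 ^ N * h e" if e: "e \<in> edges" for e
    unfolding inner_cut_tied[OF tied[OF e]]
    using total_influence_pull[OF e, of "f (snd e)"] by (simp add: h_def f_def[abs_def] \<delta>_def)
  have "2 ^ N * (\<Sum>e\<in>edges. wt e * h e) = real_of_rat (cut_weight inst S)"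
    unfolding cut_weight_eq sum_distrib_left by (rule sum.cong) (auto simp: ties_eq_0 tied inner)
  also have "\<dots> \<le> 2 ^ N * (2 * C)" using S(2) by (simp add: mult_ac)
  finally have sum_h: "(\<Sum>e\<in>edges. wt e * h e) \<le> 2 * C" by simp
  have "real_of_rat (bes_bal inst / 3) \<le> real_of_rat (\<Sum>e\<in>cut_edges inst S. bes_dem inst e)"
    using S(1) by (simp only: balanced_cut_def of_rat_less_eq)
  also have "\<dots> = 2 ^ N / 2 * (\<Sum>e\<in>edges. wt e * a e)"
    unfolding cut_demand_eq
    by (intro arg_cong2[where f = "(*)"] refl sum.cong arg_cong[of _ _ "antipodal N"] antipodal_cong)
       (use tied in \<open>auto simp: a_def f_def tied_def intro!: antipodal_cong\<close>)
  \<comment> \<open>One third of the balance is one sixth of the total demand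
    \<open>2 ^ N / 2\<close>.\<close>
  also have "real_of_rat (bes_bal inst / 3) = 2 ^ N / 2 * (1 / 6)"
  proof -
    have "real_of_rat B = real_of_rat (bes_total_dem inst / 2)" using B by (rule arg_cong)
    also have "\<dots> = 2 ^ N / 4" by (simp only: of_rat_divide total_demand_eq) simp
    finally have "real_of_rat B = 2 ^ N / 4" .
    moreover have "bes_bal inst = B" by (simp add: bes_of_def)
    ultimately show ?thesis by (simp add: of_rat_divide)
  qed
  finally have sum_a: "1 / 6 \<le> (\<Sum>e\<in>edges. wt e * a e)" by simp
  have h0: "0 \<le> total_influence N (f (fst e))" "0 \<le> total_influence N (f (snd e))" "0 \<le> \<delta> e" for e
    by (auto simp: total_influence_nonneg \<delta>_def intro!: avg_nonneg)
  then have hpos: "0 \<le> h e" for e unfolding h_def using \<rho>0 \<rho>_def by simp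
  \<comment> \<open>The thresholds leave weight 1/6 - 1/12 - 1/24 = 1/24 for \<open>G\<close>:
    constraints with small \<open>a\<close> contribute at most 1/12, and by Markov's inequality
    those with \<open>h\<close> above \<open>48 * C\<close> weigh at most
    \<open>2 * C / (48 * C)\<close>.\<close>
  define G where "G = {e \<in> edges. 1 / 12 \<le> a e \<and> h e \<le> 48 * C}"
  have "a e \<le> (if e \<in> G then 1 else 0) + 1 / 12 + h e / (48 * C)" if "e \<in> edges" for e
  proof -
    consider "e \<in> G" | "a e < 1 / 12" | "48 * C < h e" using \<open>e \<in> edges\<close> by (force simp: G_def)
    then show ?thesis
    proof cases
      case 1
      have "0 \<le> h e / (48 * C)" using hpos C by simp
      then show ?thesis using 1 antipodal_le_1[of N "f (fst e)"] by (simp add: a_def)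
    next
      case 2
      have "0 \<le> h e / (48 * C)" using hpos C by simp
      then show ?thesis using 2 by auto
    next
      case 3
      then have "1 \<le> h e / (48 * C)" using C by (simp add: le_divide_eq)
      then show ?thesis using antipodal_le_1[of N "f (fst e)"] by (auto simp: a_def)
    qed
  qed
  then have "(\<Sum>e\<in>edges. wt e * a e) \<le> (\<Sum>e\<in>edges. wt e * ((if e \<in> G then 1 else 0) + 1 / 12 + h e / (48 * C)))"
    by (intro sum_mono mult_left_mono) (auto dest: wt_pos)
  also have "\<dots> = (\<Sum>e\<in>edges. if e \<in> G then wt e else 0) + (\<Sum>e\<in>edges. wt e) / 12 + (\<Sum>e\<in>edges. wt e * h e) / (48 * C)"
    unfolding sum_divide_distrib sum.distrib[symmetric] by (rule sum.cong) (auto simp: field_simps)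
  also have "(\<Sum>e\<in>edges. if e \<in> G then wt e else 0) = (\<Sum>e\<in>G. wt e)"
    by (subst sum.inter_filter[symmetric]) (auto simp: G_def intro!: sum.cong)
  also have "(\<Sum>e\<in>edges. wt e * h e) / (48 * C) \<le> 2 * C / (48 * C)"
    using sum_h C by (intro divide_right_mono) auto
  also have "2 * C / (48 * C) = 1 / 24" using C by simp
  finally have wG: "1 / 24 \<le> (\<Sum>e\<in>G. wt e)" using sum_a sum_wt by simp

  \<comment> \<open>The threshold is half of \<tau>, so that a coordinate of influence above \<tau>
    at one endpoint still qualifies at the other. Total influence at most \<open>96 * C\<close> then
    allows at most \<open>192 * C / \<tau>\<close> candidates.\<close>
  define L where "L u = {i. i < N \<and> \<tau> / 2 < influence N (f u) i}" for u
  have finL: "finite (L u)" for u by (simp add: L_def)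
  have cardL: "card (L u) \<le> m" if "total_influence N (f u) \<le> 96 * C" for u
  proof -
    have "real (card (L u)) * (\<tau> / 2) = (\<Sum>i\<in>L u. \<tau> / 2)" by simp
    also have "\<dots> \<le> (\<Sum>i\<in>L u. influence N (f u) i)" by (rule sum_mono) (simp add: L_def)
    also have "\<dots> \<le> total_influence N (f u)"
      unfolding total_influence_def by (rule sum_mono2) (auto simp: L_def influence_nonneg)
    finally have "real (card (L u)) \<le> 192 * C / \<tau>" using that \<tau>(1) by (simp add: field_simps)
    then show ?thesis using m by linarith
  qed
  \<comment> \<open>Beyond the end of the list the value 0 keeps \<open>lab\<close> inside the label
    set.\<close>
  define lab where "lab u k = (if k < card (L u) then sorted_list_of_set (L u) ! k else 0)" for u k
  have lab_less: "lab u k < N" for u k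
  proof (cases "k < card (L u)")
    case True
    then have "sorted_list_of_set (L u) ! k \<in> set (sorted_list_of_set (L u))"
      by (intro nth_mem) (simp add: finL)
    then show ?thesis using True finL by (simp add: lab_def L_def)
  qed (use N in \<open>simp add: lab_def\<close>)
  have lab_onto: "\<exists>k<m. lab u k = i" if "i \<in> L u" "card (L u) \<le> m" for u i
  proof -
    have "i \<in> set (sorted_list_of_set (L u))" using that finL by simp
    then obtain k where "k < length (sorted_list_of_set (L u))" "sorted_list_of_set (L u) ! k = i"
      unfolding in_set_conv_nth by blast
    then have "k < card (L u)" "sorted_list_of_set (L u) ! k = i" by simp_all
    then show ?thesis using that(2) by (auto simp: lab_def intro!: exI[of _ k])
  qed
  have good: "\<exists>x y. x < m \<and> y < m \<and> lab (fst e) x = ug_perm U e (lab (snd e) y)" if eG: "e \<in> G" for e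
  proof -
    have e: "e \<in> edges" and he: "h e \<le> 48 * C" and ae: "1 / 12 \<le> a e" using eG by (auto simp: G_def)
    have hb: "(total_influence N (f (fst e)) + total_influence N (f (snd e))) / 2 + \<rho> * \<delta> e \<le> 48 * C"
      using he by (simp add: h_def \<rho>_def)
    have "0 \<le> \<rho> * \<delta> e" using \<rho>0 h0 by simp
    moreover have "a \<le> 96 * C \<and> b \<le> 96 * C \<and> x \<le> 48 * C"
      if "(a + b) / 2 + x \<le> 48 * C" "0 \<le> a" "0 \<le> b" "0 \<le> x" for a b x :: real
      using that by (simp add: field_simps)
    ultimately have I: "total_influence N (f (fst e)) \<le> 96 * C" "total_influence N (f (snd e)) \<le> 96 * C"
      and "\<rho> * \<delta> e \<le> 48 * C" using hb h0[of e] by blast+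
    \<comment> \<open>Here the number of parallel copies takes effect: disagreement costs \<rho>
      times its probability.\<close>
    then have "2 * \<delta> e \<le> 96 * C / \<rho>" using \<rho>0 by (simp add: field_simps)
    also have "\<dots> \<le> \<tau> / 2" using R \<rho>0 \<tau>(1) by (simp add: \<rho>_def field_simps)
    finally have d2: "2 * \<delta> e \<le> \<tau> / 2" .
    \<comment> \<open>The demand sits on the cube of the first endpoint, so the antipodal fraction
      is known to be large only for this function; the second function inherits the
      coordinate.\<close>
    have "\<exists>i<N. \<tau> < influence N (f (fst e)) i"
      by (rule influential_coordinate[of _ _ "96 * C" d])
         (use I(1) \<tau> ae in \<open>auto simp: total_influence_def a_def\<close>)
    then obtain i where i: "i < N" "\<tau> < influence N (f (fst e)) i" by blast
    then obtain j where j: "j < N" "ug_perm U e j = i"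
      using perm[OF e] by (metis bij_betw_imp_surj_on imageE lessThan_iff)
    have "influence N (f (fst e)) i \<le> influence N (\<lambda>X. f (snd e) (pull e X)) i + 2 * \<delta> e"
      unfolding \<delta>_def by (rule influence_perturb[OF i(1)])
    also have "influence N (\<lambda>X. f (snd e) (pull e X)) i = influence N (f (snd e)) j"
      using influence_pull[OF e j(1), of "f (snd e)"] j(2) by simp
    finally have "\<tau> / 2 < influence N (f (snd e)) j" using i(2) d2 by linarith
    then have jL: "j \<in> L (snd e)" and iL: "i \<in> L (fst e)" using i j(1) \<tau>(1) by (auto simp: L_def)
    obtain x where x: "x < m" "lab (fst e) x = i" using lab_onto[OF iL cardL[OF I(1)]] by blast
    obtain y where y: "y < m" "lab (snd e) y = j" using lab_onto[OF jL cardL[OF I(2)]] by blast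
    have "lab (fst e) x = ug_perm U e (lab (snd e) y)" using x(2) y(2) j(2) by simp
    then show ?thesis using x(1) y(1) by blast
  qed
  then obtain \<alpha> \<beta> where ab: "\<And>e. e \<in> G \<Longrightarrow> \<alpha> e < m \<and> \<beta> e < m \<and> lab (fst e) (\<alpha> e) = ug_perm U e (lab (snd e) (\<beta> e))"
    by metis
  have "finite G" by (simp add: G_def)
  moreover have "0 \<le> wt e \<and> fst e < ug_size U \<and> snd e < ug_size U \<and> fst e \<noteq> snd e \<and> \<alpha> e < m \<and> \<beta> e < m"
    if "e \<in> G" for e
    using that ab[OF that] ends[of e] wt_pos[of e] by (simp add: G_def)
  ultimately obtain j where j: "j \<in> {..<ug_size U} \<rightarrow>\<^sub>E {..<m}"
    "(\<Sum>e\<in>G. wt e) / (real m)\<^sup>2 \<le> (\<Sum>e | e \<in> G \<and> j (fst e) = \<alpha> e \<and> j (snd e) = \<beta> e. wt e)"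
    using exists_good_choice[of G wt "ug_size U" \<alpha> m \<beta>] mpos by blast
  define l where "l = restrict (\<lambda>u. lab u (j u)) {..<ug_size U}"
  have "l \<in> {..<ug_size U} \<rightarrow>\<^sub>E {..<N}" by (auto simp: l_def lab_less)
  moreover have "1 / (24 * (real m)\<^sup>2) \<le> real_of_rat (ug_value U l)"
  proof -
    have "1 / (24 * (real m)\<^sup>2) = (1 / 24) / (real m)\<^sup>2" by simp
    also have "\<dots> \<le> (\<Sum>e\<in>G. wt e) / (real m)\<^sup>2" using wG by (rule divide_right_mono) simp
    also note j(2)
    also have "(\<Sum>e | e \<in> G \<and> j (fst e) = \<alpha> e \<and> j (snd e) = \<beta> e. wt e) \<le> real_of_rat (ug_value U l)"
      unfolding value_eq
    proof (rule sum_mono2)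
      show "{e \<in> G. j (fst e) = \<alpha> e \<and> j (snd e) = \<beta> e} \<subseteq> {e \<in> edges. ug_satisfies U l e}"
      proof
        fix e assume "e \<in> {e \<in> G. j (fst e) = \<alpha> e \<and> j (snd e) = \<beta> e}"
        then have e: "e \<in> G" "j (fst e) = \<alpha> e" "j (snd e) = \<beta> e" by auto
        have "e \<in> edges" using e(1) by (simp add: G_def)
        then show "e \<in> {e \<in> edges. ug_satisfies U l e}"
          using ab[OF e(1)] e ends[of e] by (simp add: ug_satisfies_def l_def)
      qed
    qed (auto dest: wt_pos)
    finally show ?thesis .
  qed
  ultimately show thesis by (rule that)
qed

end

section \<open>The gap and the choice of the constants\<close>

lemma ug_opt_attained:
  assumes "1 \<le> N"
  shows "\<exists>l\<in>{..<ug_size U} \<rightarrow>\<^sub>E {..<N}. ug_value U l = ug_opt N U"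
    and "l \<in> {..<ug_size U} \<rightarrow>\<^sub>E {..<N} \<Longrightarrow> ug_value U l \<le> ug_opt N U"
proof -
  let ?L = "{..<ug_size U} \<rightarrow>\<^sub>E {..<N}"
  have fin: "finite (ug_value U ` ?L)" by (intro finite_imageI finite_PiE) auto
  have ne: "ug_value U ` ?L \<noteq> {}" using assms by (auto simp: PiE_eq_empty_iff lessThan_empty_iff)
  show "\<exists>l\<in>?L. ug_value U l = ug_opt N U"
    using Max_in[OF fin ne] unfolding ug_opt_def by auto
  show "l \<in> ?L \<Longrightarrow> ug_value U l \<le> ug_opt N U"
    using Max_ge[OF fin] unfolding ug_opt_def by blast
qed

lemma reduction_yes:
  fixes M :: rat
  assumes wf: "wf_ug N U" and N: "1 \<le> N" and r: "1 \<le> r" and M: "0 \<le> M"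
    and \<eta>: "(2 ^ r - 1) * \<eta> \<le> 1" and opt: "1 - \<eta> \<le> real_of_rat (ug_opt N U)"
  shows "enc_reduction N (2 ^ (N + r)) M (2 ^ N / 4) (2 ^ (N + 1)) U \<in> bes_yes"
proof -
  interpret reduction N r M "2 ^ N / 4" U using assms by unfold_locales
  have B: "2 ^ N / 4 = bes_total_dem inst / 2"
  proof -
    have "real_of_rat (bes_total_dem inst) = real_of_rat (2 ^ N / 2)"
      using total_demand_eq by (simp add: of_rat_divide of_rat_power)
    then show ?thesis by (simp only: of_rat_eq_iff)
  qed
  obtain l where l: "l \<in> {..<ug_size U} \<rightarrow>\<^sub>E {..<N}" "ug_value U l = ug_opt N U"
    using ug_opt_attained(1)[OF N] by blast
  have "\<exists>S. balanced_cut inst (bes_bal inst) S \<and> cut_weight inst S \<le> 2 ^ (N + 1)"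
    by (rule completeness[OF _ _ \<eta> B, of l]) (use l opt in auto)
  moreover have "enc_reduction N (2 ^ (N + r)) M (2 ^ N / 4) (2 ^ (N + 1)) U = enc_bes inst @ enc_rat (2 ^ (N + 1))"
    by (simp add: enc_bes_of)
  ultimately show ?thesis unfolding bes_yes_def using wf_inst[OF B] by force
qed

lemma reduction_no:
  fixes M :: rat
  assumes wf: "wf_ug N U" and N: "1 \<le> N" and r: "1 \<le> r" and C: "1 \<le> C" and big: "C * 2 ^ (N + 1) < real_of_rat M"
    and \<tau>: "0 < \<tau>" "96 * C / (real d + 1) + 3 ^ d * sqrt \<tau> * (96 * C) < 1 / 12"
    and R: "192 * C / \<tau> \<le> 2 ^ r - 1" and m: "192 * C / \<tau> \<le> real m"
    and opt: "real_of_rat (ug_opt N U) < 1 / (24 * (real m)\<^sup>2)"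
  shows "enc_reduction N (2 ^ (N + r)) M (2 ^ N / 4) (2 ^ (N + 1)) U \<in> bes_no C"
proof -
  have "0 \<le> C * 2 ^ (N + 1)" using C by simp
  then have "0 \<le> real_of_rat M" using big by linarith
  then interpret reduction N r M "2 ^ N / 4" U using wf N r by unfold_locales auto
  have B: "2 ^ N / 4 = bes_total_dem inst / 2"
  proof -
    have "real_of_rat (bes_total_dem inst) = real_of_rat (2 ^ N / 2)"
      using total_demand_eq by (simp add: of_rat_divide of_rat_power)
    then show ?thesis by (simp only: of_rat_eq_iff)
  qed
  have "C * real_of_rat (2 ^ (N + 1)) < real_of_rat (cut_weight inst S)" if S: "balanced_cut inst (bes_bal inst / 3) S" for S
  proof (rule ccontr)
    assume "\<not> ?thesis"
    then have "real_of_rat (cut_weight inst S) \<le> C * 2 ^ (N + 1)" by (simp add: of_rat_mult of_rat_power)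
    then obtain l where "l \<in> {..<ug_size U} \<rightarrow>\<^sub>E {..<N}" "1 / (24 * (real m)\<^sup>2) \<le> real_of_rat (ug_value U l)"
      using soundness[OF C big B \<tau> R m S] by blast
    moreover from this(1) have "real_of_rat (ug_value U l) \<le> real_of_rat (ug_opt N U)"
      unfolding of_rat_less_eq by (rule ug_opt_attained(2)[OF N])
    ultimately show False using opt by linarith
  qed
  moreover have "enc_reduction N (2 ^ (N + r)) M (2 ^ N / 4) (2 ^ (N + 1)) U = enc_bes inst @ enc_rat (2 ^ (N + 1))"
    by (simp add: enc_bes_of)
  moreover have "(0::rat) \<le> 2 ^ (N + 1)" by simp
  ultimately show ?thesis unfolding bes_no_def using wf_inst[OF B] by blast
qed

text \<open>Both summands of the second condition are brought down to 1/48, the first by the choice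
  of \<open>d\<close> and the second exactly by the choice of \<tau>; their sum stays below 1/12.
  Taking \<open>Suc r0\<close> for \<open>r\<close> makes it positive.\<close>

lemma constants_exist:
  fixes C :: real
  assumes C: "1 \<le> C"
  obtains \<tau> :: real and d r m :: nat where "0 < \<tau>"
    "96 * C / (real d + 1) + 3 ^ d * sqrt \<tau> * (96 * C) < 1 / 12" "192 * C / \<tau> \<le> 2 ^ r - 1"
    "192 * C / \<tau> \<le> real m" "1 \<le> r" "0 < m"
proof -
  obtain d :: nat where d: "48 * (96 * C) < real d" using reals_Archimedean2 by blast
  define \<tau> where "\<tau> = (1 / (48 * 3 ^ d * (96 * C)))\<^sup>2"
  have \<tau>: "0 < \<tau>" using C by (simp add: \<tau>_def)
  have "sqrt \<tau> = 1 / (48 * 3 ^ d * (96 * C))" using C by (simp add: \<tau>_def)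
  then have 1: "3 ^ d * sqrt \<tau> * (96 * C) = 1 / 48" using C by (simp add: field_simps)
  have 2: "96 * C / (real d + 1) \<le> 1 / 48" using d C by (simp add: field_simps)
  obtain r0 :: nat where r0: "192 * C / \<tau> + 1 < 2 ^ r0" using real_arch_pow[of 2 "192 * C / \<tau> + 1"] by auto
  have "(2::real) ^ r0 \<le> 2 ^ Suc r0" by simp
  then have r: "192 * C / \<tau> \<le> 2 ^ Suc r0 - 1" using r0 by linarith
  obtain m :: nat where m: "192 * C / \<tau> < real m" using reals_Archimedean2 by blast
  have "0 < 192 * C / \<tau>" using C \<tau> by simp
  then have "0 < m" using m by (metis less_trans of_nat_0_less_iff)
  then show thesis using that[of \<tau> d "Suc r0" m] \<tau> 1 2 r m by simp
qed

theorem theorem1p3: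
  fixes C :: real
  assumes "unique_games_conjecture"
    and "C \<ge> 1"
  shows "NP_hard_to_distinguish bes_yes (bes_no C)"
proof -
  obtain \<tau> :: real and d r m :: nat where c: "0 < \<tau>"
    "96 * C / (real d + 1) + 3 ^ d * sqrt \<tau> * (96 * C) < 1 / 12" "192 * C / \<tau> \<le> 2 ^ r - 1"
    "192 * C / \<tau> \<le> real m" "1 \<le> r" "0 < m"
    using constants_exist[OF assms(2)] by blast
  \<comment> \<open>With this \<eta> the violated constraints at most double the cost
    \<open>2 ^ N\<close> of the dictator cut. The value of \<zeta> is half of what the random choice
    guarantees, which makes the comparison strict.\<close>
  define \<eta> :: real where "\<eta> = 1 / (2 ^ r - 1)"
  define \<zeta> :: real where "\<zeta> = 1 / (48 * (real m)\<^sup>2)"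
  have "0 < 192 * C / \<tau>" using c(1) assms(2) by simp
  then have R: "(0::real) < 2 ^ r - 1" using c(3) by linarith
  then have \<eta>: "0 < \<eta>" "(2 ^ r - 1) * \<eta> \<le> 1" by (simp_all add: \<eta>_def)
  have \<zeta>: "0 < \<zeta>" "\<zeta> < 1 / (24 * (real m)\<^sup>2)" using c(6) by (simp_all add: \<zeta>_def field_simps)
  obtain N where N: "1 \<le> N" and hard: "NP_hard_to_distinguish (ug_yes N \<eta>) (ug_no N \<zeta>)"
    using assms(1) \<eta>(1) \<zeta>(1) unfolding unique_games_conjecture_def by blast
  \<comment> \<open>A rational number above C times the threshold \<open>2 ^ (N + 1)\<close>, so
    that a cut of at most that weight cannot separate a single heavy edge.\<close>
  define M :: rat where "M = of_int \<lceil>C\<rceil> * 2 ^ (N + 1) + 1"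
  have "C * 2 ^ (N + 1) \<le> of_int \<lceil>C\<rceil> * 2 ^ (N + 1)" by (intro mult_right_mono) auto
  moreover have "real_of_rat M = of_int \<lceil>C\<rceil> * 2 ^ (N + 1) + 1"
    by (simp add: M_def of_rat_add of_rat_mult of_rat_power)
  ultimately have M: "C * 2 ^ (N + 1) < real_of_rat M" by linarith
  have "0 \<le> C * 2 ^ (N + 1)" using assms(2) by simp
  then have "0 \<le> real_of_rat M" using M by linarith
  then have M0: "0 \<le> M" by simp
  show ?thesis unfolding NP_hard_to_distinguish_def
  proof
    fix L assume "L \<in> class_NP"
    then obtain h where h: "polytime h"
      "\<And>x. (x \<in> L \<longrightarrow> h x \<in> ug_yes N \<eta>) \<and> (x \<notin> L \<longrightarrow> h x \<in> ug_no N \<zeta>)"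
      using hard unfolding NP_hard_to_distinguish_def by blast
    \<comment> \<open>The given reduction maps every string to the encoding of a well-formed
      instance, so the pointer program never meets any other input.\<close>
    have "\<exists>U. h x = enc_ug N U \<and> wf_ug N U \<and> (x \<in> L \<longrightarrow> 1 - \<eta> \<le> real_of_rat (ug_opt N U)) \<and>
       (x \<notin> L \<longrightarrow> real_of_rat (ug_opt N U) \<le> \<zeta>)" for x
      using h(2)[of x] by (cases "x \<in> L") (auto simp: ug_yes_def ug_no_def)
    then obtain u where u: "\<And>x. h x = enc_ug N (u x)" "\<And>x. wf_ug N (u x)"
      "\<And>x. x \<in> L \<Longrightarrow> 1 - \<eta> \<le> real_of_rat (ug_opt N (u x))"
      "\<And>x. x \<notin> L \<Longrightarrow> real_of_rat (ug_opt N (u x)) \<le> \<zeta>"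
      by metis
    define f where "f x = enc_reduction N (2 ^ (N + r)) M (2 ^ N / 4) (2 ^ (N + 1)) (u x)" for x
    have "polytime f"
      by (rule polytime_program[OF h(1), of "Reduction N (N + r) M (2 ^ N / 4) (2 ^ (N + 1))"])
         (unfold u(1) f_def, rule big_Reduction[OF u(2)])
    moreover have "f x \<in> bes_yes" if "x \<in> L" for x
      unfolding f_def by (rule reduction_yes[OF u(2) N c(5) M0 \<eta>(2) u(3)[OF that]])
    moreover have "f x \<in> bes_no C" if "x \<notin> L" for x
      unfolding f_def
      by (rule reduction_no[OF u(2) N c(5) assms(2) M c(1-4) le_less_trans[OF u(4)[OF that] \<zeta>(2)]])
    ultimately show "\<exists>f. polytime f \<and> (\<forall>x. (x \<in> L \<longrightarrow> f x \<in> bes_yes) \<and> (x \<notin> L \<longrightarrow> f x \<in> bes_no C))"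
      by blast
  qed
qed

end
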